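(* Let $m,n\ge1$, $q=\min\{m,n\}$, let $\Phi$ be a symmetric gauge function on $\mathbb{R}^q$, and let $F$ be a complex $m\times n$ matrix of rank $r$. Consider the problem $$d_\Phi(F,\mathcal{I}_{m,n})=\min\{\,\|F-X\|_\Phi \,:\, X\in\mathcal{I}_{m,n}\,\}.\qquad( * )$$ (a) Suppose that $s_i(F)\ne 1/2$ for all $i=1,\dots,r$. (a.i) If $s_r(F)>1/2$ and $F=U|F|$ is the canonical polar decomposition, then $U$ is a minimizer of $( * )$. More generally, if $s_k(F)>1/2>s_{k+1}(F)$ for some $k=1,\dots,r-1$, then the closest partial isometry from $\mathcal{I}_{m,n}^k$ to $F$ is a minimizer of $( * )$. (a.ii) If $s_1(F)<1/2$, then the closest partial isometries from $\mathcal{I}_{m,n}^1$ to $F$ are minimizers of $( * )$. (b) Suppose that $\{j : s_j(F)=1/2\}=\{k,\dots,k+l\}$, where $1\le k\le r$ and $0\le l\le r-k$. (b.i) If $k=1$, then the closest partial isometries from $\mathcal{I}_{m,n}^1,\dots,\mathcal{I}_{m,n}^{l+1}$ to $F$ are minimizers of $( * )$. (b.ii) If $1<k\le r$, then the closest partial isometries from $\mathcal{I}_{m,n}^{k-1},\dots,\mathcal{I}_{m,n}^{k+l}$ to $F$ are minimizers of $( * )$. Moreover, in all the cases these are the only minimizers of $( * )$ provided that the symmetric gauge function $\Phi$ is strictly convex.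
   Context: A complex $m\times n$ matrix $X$ is a partial isometry if $\|Xf\|=\|f\|$ for all $f\in\ker(X)^\perp$. For $1\le k\le q$, $\mathcal{I}_{m,n}^k$ is the set of $m\times n$ partial isometries of rank $k$, and $\mathcal{I}_{m,n}=\bigcup_{k=1}^q\mathcal{I}_{m,n}^k$ is the set of (nonzero) $m\times n$ partial isometries. A closest partial isometry from $\mathcal{I}_{m,n}^k$ to $F$ is an $X_0\in\mathcal{I}_{m,n}^k$ with $\|F-X_0\|_\Phi=\min\{\|F-X\|_\Phi : X\in\mathcal{I}_{m,n}^k\}$. $s_1(F)\ge\dots\ge s_q(F)\ge 0$ are the singular values of $F$ (the $q$ largest eigenvalues of $|F|=(F^*F)^{1/2}$, with multiplicity). The canonical polar decomposition of $F$ is the unique factorization $F=U|F|$ with $U$ a partial isometry and $\ker(U)=\ker(F)$. A symmetric gauge function is a norm $\Phi$ on $\mathbb{R}^q$ with $\Phi(x_1,\dots,x_q)=\Phi(|x_{\sigma(1)}|,\dots,|x_{\sigma(q)}|)$ for every permutation $\sigma$ of $\{1,\dots,q\}$; it defines the unitarily invariant norm $\|F\|_\Phi=\Phi(s_1(F),\dots,s_q(F))$. $\Phi$ is strictly convex if $\Phi(\lambda x+(1-\lambda)y)<1$ whenever $x\ne y$, $\Phi(x)=\Phi(y)=1$ and $\lambda\in(0,1)$. *)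

theory Defs
  imports
    Complex_Main
    "HOL-Combinatorics.Permutations"
    "HOL-Computational_Algebra.Fundamental_Theorem_Algebra"
    "Jordan_Normal_Form.Matrix"
    "Jordan_Normal_Form.Matrix_Kernel"
    "Jordan_Normal_Form.DL_Rank"
    "Jordan_Normal_Form.Schur_Decomposition"
    "Jordan_Normal_Form.Char_Poly"
begin

definition l2_norm :: "complex vec \<Rightarrow> real" where
  "l2_norm v = sqrt (\<Sum>i<dim_vec v. (cmod (v $ i))\<^sup>2)"

definition mat_rank :: "complex mat \<Rightarrow> nat" where
  "mat_rank A = vec_space.rank (dim_row A) A"

definition positive_semidefinite :: "complex mat \<Rightarrow> bool" where
  "positive_semidefinite A \<longleftrightarrow>
     square_mat A \<and> mat_adjoint A = A \<and>
     (\<forall>v \<in> carrier_vec (dim_row A). 0 \<le> Re ((A *\<^sub>v v) \<bullet>c v))"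

(* |F| = (F^* F)^(1/2), the unique positive semidefinite square root. *)
definition mat_abs :: "complex mat \<Rightarrow> complex mat" where
  "mat_abs F = (THE A. A \<in> carrier_mat (dim_col F) (dim_col F) \<and>
     positive_semidefinite A \<and> A * A = mat_adjoint F * F)"

(* All dim_col F eigenvalues of |F|, with multiplicity, in decreasing order; they are real, so
   Re loses nothing. *)
definition abs_eigenvalues :: "complex mat \<Rightarrow> real list" where
  "abs_eigenvalues F =
     rev (sorted_list_of_multiset (image_mset Re (proots (char_poly (mat_abs F)))))"

(* s_j(F), counted from j = 1; meaningful for 1 \<le> j \<le> min (dim_row F) (dim_col F). *)
definition sing_val :: "complex mat \<Rightarrow> nat \<Rightarrow> real" where
  "sing_val F j = abs_eigenvalues F ! (j - 1)"

definition partial_isometry :: "complex mat \<Rightarrow> bool" where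
  "partial_isometry X \<longleftrightarrow>
     (\<forall>f \<in> carrier_vec (dim_col X).
        (\<forall>g \<in> mat_kernel X. f \<bullet>c g = 0) \<longrightarrow> l2_norm (X *\<^sub>v f) = l2_norm f)"

definition partial_isometries_rank :: "nat \<Rightarrow> nat \<Rightarrow> nat \<Rightarrow> complex mat set" where
  "partial_isometries_rank m n k =
     {X \<in> carrier_mat m n. partial_isometry X \<and> mat_rank X = k}"

definition partial_isometries :: "nat \<Rightarrow> nat \<Rightarrow> complex mat set" where
  "partial_isometries m n = (\<Union>k \<in> {1..min m n}. partial_isometries_rank m n k)"

definition canonical_polar_decomposition :: "complex mat \<Rightarrow> complex mat \<Rightarrow> bool" where
  "canonical_polar_decomposition F U \<longleftrightarrow>
     U \<in> carrier_mat (dim_row F) (dim_col F) \<and> partial_isometry U \<and>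
     mat_kernel U = mat_kernel F \<and> F = U * mat_abs F"

definition norm_on_Rn :: "nat \<Rightarrow> (real vec \<Rightarrow> real) \<Rightarrow> bool" where
  "norm_on_Rn q \<Phi> \<longleftrightarrow>
     (\<forall>x \<in> carrier_vec q. 0 \<le> \<Phi> x \<and> (\<Phi> x = 0 \<longleftrightarrow> x = 0\<^sub>v q)) \<and>
     (\<forall>c. \<forall>x \<in> carrier_vec q. \<Phi> (c \<cdot>\<^sub>v x) = \<bar>c\<bar> * \<Phi> x) \<and>
     (\<forall>x \<in> carrier_vec q. \<forall>y \<in> carrier_vec q. \<Phi> (x + y) \<le> \<Phi> x + \<Phi> y)"

definition symmetric_gauge :: "nat \<Rightarrow> (real vec \<Rightarrow> real) \<Rightarrow> bool" where
  "symmetric_gauge q \<Phi> \<longleftrightarrow>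
     norm_on_Rn q \<Phi> \<and>
     (\<forall>x \<in> carrier_vec q. \<forall>\<sigma>. \<sigma> permutes {..<q} \<longrightarrow> \<Phi> x = \<Phi> (vec q (\<lambda>i. \<bar>x $ \<sigma> i\<bar>)))"

definition strictly_convex_gauge :: "nat \<Rightarrow> (real vec \<Rightarrow> real) \<Rightarrow> bool" where
  "strictly_convex_gauge q \<Phi> \<longleftrightarrow>
     (\<forall>x \<in> carrier_vec q. \<forall>y \<in> carrier_vec q. \<forall>t.
        x \<noteq> y \<and> \<Phi> x = 1 \<and> \<Phi> y = 1 \<and> 0 < t \<and> t < 1 \<longrightarrow>
        \<Phi> (t \<cdot>\<^sub>v x + (1 - t) \<cdot>\<^sub>v y) < 1)"

(* Vectors are indexed from 0, singular values from 1. *)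
definition ui_norm :: "(real vec \<Rightarrow> real) \<Rightarrow> complex mat \<Rightarrow> real" where
  "ui_norm \<Phi> F = \<Phi> (vec (min (dim_row F) (dim_col F)) (\<lambda>i. sing_val F (i + 1)))"

(* The set of all X in S at which the minimum of the distance to F over S is attained. *)
definition nearest :: "(real vec \<Rightarrow> real) \<Rightarrow> complex mat \<Rightarrow> complex mat set \<Rightarrow> complex mat set" where
  "nearest \<Phi> F S = {X. is_arg_min (\<lambda>X. ui_norm \<Phi> (F - X)) (\<lambda>X. X \<in> S) X}"

definition closest_rank ::
  "(real vec \<Rightarrow> real) \<Rightarrow> complex mat \<Rightarrow> nat \<Rightarrow> complex mat set" where
  "closest_rank \<Phi> F k = nearest \<Phi> F (partial_isometries_rank (dim_row F) (dim_col F) k)"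

definition minimizers :: "(real vec \<Rightarrow> real) \<Rightarrow> complex mat \<Rightarrow> complex mat set" where
  "minimizers \<Phi> F = nearest \<Phi> F (partial_isometries (dim_row F) (dim_col F))"

end

theory Submission
  imports Defs
begin

text \<open>
  Write \<open>F = \<Sum>i s\<^sub>i u\<^sub>i v\<^sub>i\<^sup>*\<close> in singular value form, with indices from \<open>0\<close>, and let
  \<open>U\<^sub>k = \<Sum>i<k u\<^sub>i v\<^sub>i\<^sup>*\<close> (\<open>truncated_polar\<close>). A partial isometry \<open>X\<close> of rank \<open>j\<close> has the singular
  values \<open>1, ..., 1, 0, ..., 0\<close> with \<open>j\<close> ones, so the Mirsky inequality (\<open>mirsky\<close>) says that the
  numbers \<open>\<bar>s\<^sub>i - [i < j]\<bar>\<close> are weakly majorized by the singular values of \<open>F - X\<close>. Symmetric gauge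
  functions respect weak majorization (\<open>gauge_weak_majorization\<close>); hence
  \<open>\<Phi> (\<bar>s\<^sub>i - [i < j]\<bar>)\<^sub>i\<close> bounds the distance from \<open>F\<close> to \<open>X\<close> from below, and \<open>U\<^sub>j\<close> attains the bound.

  What remains concerns numbers. Since \<open>\<bar>s - 1\<bar> \<le> s\<close> holds exactly for \<open>s \<ge> 1/2\<close>, the ranks \<open>j\<close> for which
  \<open>[i < j]\<close> jumps from \<open>1\<close> to \<open>0\<close> where \<open>s\<close> crosses \<open>1/2\<close> make all the coordinates
  \<open>\<bar>s\<^sub>i - [i < j]\<bar>\<close> minimal at once (\<open>optimal_rank\<close>). Only \<open>j = 0\<close> is forbidden, so the coordinate \<open>i = 0\<close>
  is never in competition; this is why all singular values below \<open>1/2\<close> lead to rank \<open>1\<close>. By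
  monotonicity of \<open>\<Phi>\<close> every closest partial isometry of an optimal rank is a minimizer. A strictly
  convex \<open>\<Phi>\<close> is strictly monotone, so that then no other rank occurs (\<open>truncated_polar_optimal\<close>).

  If no singular value equals \<open>1/2\<close> and \<open>\<Phi>\<close> is strictly convex, the minimizer is unique
  as soon as \<open>s\<^sub>0 > 1/2\<close> (\<open>closest_rank_unique\<close>). Equality in the majorization bound forces the singular
  values of \<open>F - X\<close> to be a rearrangement of \<open>\<bar>s\<^sub>i - [i < k]\<bar>\<close>; comparing sums of squares in the
  basis \<open>v\<close> gives \<open>\<Sum>i s\<^sub>i Re \<langle>X v\<^sub>i, u\<^sub>i\<rangle> = \<Sum>i<k s\<^sub>i\<close>, which is only possible if \<open>X v\<^sub>i = u\<^sub>i\<close> for \<open>i < k\<close>.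

  The Mirsky inequality follows from the inequality of Lidskii for eigenvalues of Hermitian matrices
  (\<open>lidskii\<close>), applied to the Hermitian dilation \<open>[[0, F], [F\<^sup>*, 0]]\<close>, whose eigenvalues are
  \<open>\<plusminus>s\<^sub>i\<close> and zeros.
\<close>

section \<open>Orthonormal families in complex coordinate space\<close>

text \<open>Orthonormal families are functions on an initial segment of the indices, so that
  they can be extended, permuted and truncated without changing their type.\<close>

definition orthonormal :: "nat \<Rightarrow> nat \<Rightarrow> (nat \<Rightarrow> complex vec) \<Rightarrow> bool" where
  "orthonormal N k v \<longleftrightarrow> (\<forall>i<k. v i \<in> carrier_vec N) \<and>
     (\<forall>i<k. \<forall>j<k. v i \<bullet>c v j = (if i = j then 1 else 0))"

lemma orthonormal_carrier [simp]: "orthonormal N k v \<Longrightarrow> i < k \<Longrightarrow> v i \<in> carrier_vec N"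
  unfolding orthonormal_def by blast

lemma orthonormal_dim [simp]: "orthonormal N k v \<Longrightarrow> i < k \<Longrightarrow> dim_vec (v i) = N"
  using orthonormal_carrier carrier_vecD by blast

lemma orthonormal_cprod:
  "orthonormal N k v \<Longrightarrow> i < k \<Longrightarrow> j < k \<Longrightarrow> v i \<bullet>c v j = (if i = j then 1 else 0)"
  unfolding orthonormal_def by blast

lemma cprod_sum:
  fixes x y :: "complex vec"
  assumes "y \<in> carrier_vec N"
  shows "x \<bullet>c y = (\<Sum>a<N. x $ a * cnj (y $ a))"
  using assms unfolding scalar_prod_def by (auto simp: lessThan_atLeast0 intro!: sum.cong)

lemma cprod_self:
  fixes x :: "complex vec"
  shows "x \<bullet>c x = complex_of_real ((l2_norm x)\<^sup>2)"
proof -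
  have "x \<bullet>c x = (\<Sum>a<dim_vec x. x $ a * cnj (x $ a))"
    by (rule cprod_sum) auto
  also have "\<dots> = (\<Sum>a<dim_vec x. complex_of_real ((cmod (x $ a))\<^sup>2))"
    by (intro sum.cong refl) (metis complex_norm_square of_real_power)
  also have "\<dots> = complex_of_real ((l2_norm x)\<^sup>2)"
    unfolding l2_norm_def by (simp add: sum_nonneg)
  finally show ?thesis .
qed

lemma l2_norm_nonneg [simp]: "0 \<le> l2_norm x"
  unfolding l2_norm_def by (simp add: sum_nonneg)

lemma cprod_commute:
  fixes x y :: "complex vec"
  assumes "x \<in> carrier_vec N" "y \<in> carrier_vec N"
  shows "x \<bullet>c y = cnj (y \<bullet>c x)"
  using assms by (simp add: cprod_sum[of _ N] mult.commute)

lemma cprod_smult_left: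
  fixes x y :: "complex vec"
  assumes "x \<in> carrier_vec N" "y \<in> carrier_vec N"
  shows "(c \<cdot>\<^sub>v x) \<bullet>c y = c * (x \<bullet>c y)"
  using assms by (simp add: cprod_sum[of _ N] sum_distrib_left mult.assoc)

lemma cprod_smult_right:
  fixes x y :: "complex vec"
  assumes "x \<in> carrier_vec N" "y \<in> carrier_vec N"
  shows "x \<bullet>c (c \<cdot>\<^sub>v y) = cnj c * (x \<bullet>c y)"
  using assms by (simp add: cprod_sum[of _ N] sum_distrib_left mult_ac)

lemma cprod_add_left:
  fixes x y :: "complex vec"
  assumes "x \<in> carrier_vec N" "y \<in> carrier_vec N" "z \<in> carrier_vec N"
  shows "(x + y) \<bullet>c z = x \<bullet>c z + y \<bullet>c z"
  using assms by (simp add: cprod_sum[of _ N] sum.distrib algebra_simps)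

lemma cprod_minus_left:
  fixes x y :: "complex vec"
  assumes "x \<in> carrier_vec N" "y \<in> carrier_vec N" "z \<in> carrier_vec N"
  shows "(x - y) \<bullet>c z = x \<bullet>c z - y \<bullet>c z"
  using assms by (simp add: cprod_sum[of _ N] sum_subtractf algebra_simps)

lemma cprod_zero_left [simp]: "y \<in> carrier_vec N \<Longrightarrow> 0\<^sub>v N \<bullet>c y = (0::complex)"
  by (simp add: cprod_sum[of _ N])

lemma l2_norm_eq_0_iff: "x \<in> carrier_vec N \<Longrightarrow> l2_norm x = 0 \<longleftrightarrow> x = 0\<^sub>v N"
  using conjugate_square_eq_0_vec[of x N] unfolding cprod_self by simp

lemma mat_adjoint_index [simp]:
  "i < dim_col A \<Longrightarrow> j < dim_row A \<Longrightarrow> mat_adjoint A $$ (i, j) = cnj ((A :: complex mat) $$ (j, i))"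
  unfolding mat_adjoint_def by (simp add: mat_of_rows_index)

lemma mat_adjoint_dim [simp]:
  "dim_row (mat_adjoint A) = dim_col A" "dim_col (mat_adjoint A) = dim_row A"
  unfolding mat_adjoint_def by auto

lemma mat_adjoint_carrier [simp]: "A \<in> carrier_mat m n \<Longrightarrow> mat_adjoint A \<in> carrier_mat n m"
  by (intro carrier_matI) simp_all

lemma mult_mat_vec_index_sum:
  "A \<in> carrier_mat m n \<Longrightarrow> x \<in> carrier_vec n \<Longrightarrow> a < m \<Longrightarrow>
     (A *\<^sub>v x) $ a = (\<Sum>b<n. A $$ (a, b) * x $ b)"
  by (auto simp: scalar_prod_def lessThan_atLeast0 intro!: sum.cong)

lemma cprod_adjoint:
  fixes A :: "complex mat"
  assumes A: "A \<in> carrier_mat m n" and x: "x \<in> carrier_vec n" and y: "y \<in> carrier_vec m"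
  shows "(A *\<^sub>v x) \<bullet>c y = x \<bullet>c (mat_adjoint A *\<^sub>v y)"
proof -
  have "(A *\<^sub>v x) \<bullet>c y = (\<Sum>a<m. \<Sum>b<n. A $$ (a, b) * x $ b * cnj (y $ a))"
    using y by (simp add: cprod_sum[of y m] mult_mat_vec_index_sum[OF A x] sum_distrib_right
        del: index_mult_mat_vec)
  also have "\<dots> = (\<Sum>b<n. \<Sum>a<m. A $$ (a, b) * x $ b * cnj (y $ a))"
    by (rule sum.swap)
  also have "\<dots> = (\<Sum>b<n. x $ b * cnj ((mat_adjoint A *\<^sub>v y) $ b))"
    using A by (intro sum.cong refl)
      (simp add: mult_mat_vec_index_sum[OF mat_adjoint_carrier[OF A] y] sum_distrib_left mult_ac
        del: index_mult_mat_vec)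
  also have "\<dots> = x \<bullet>c (mat_adjoint A *\<^sub>v y)"
    by (rule cprod_sum[symmetric]) (rule mult_mat_vec_carrier[OF mat_adjoint_carrier[OF A] y])
  finally show ?thesis .
qed

text \<open>A square system padded with a zero equation has determinant \<open>0\<close>, hence a nonzero solution. It
  takes the place of intersecting subspaces by a count of dimensions.\<close>

lemma underdetermined_orthogonal:
  fixes w :: "nat \<Rightarrow> complex vec"
  assumes "k < N" and w: "\<And>i. i < k \<Longrightarrow> w i \<in> carrier_vec N"
  obtains x where "x \<in> carrier_vec N" "x \<noteq> 0\<^sub>v N" "\<And>i. i < k \<Longrightarrow> x \<bullet>c w i = 0"
proof -
  define A where "A = mat N N (\<lambda>(i, j). if i < k then cnj (w i $ j) else 0)"
  have A: "A \<in> carrier_mat N N" unfolding A_def by simp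
  have "A = mat\<^sub>r N N (\<lambda>i. if i = k then 0\<^sub>v N else row A i)"
    by (intro eq_matI) (simp_all add: A_def)
  then have "det A = 0"
    using det_row_0[OF \<open>k < N\<close>, of "row A"] A by simp
  then obtain x where x: "x \<in> carrier_vec N" "x \<noteq> 0\<^sub>v N" "A *\<^sub>v x = 0\<^sub>v N"
    using det_0_iff_vec_prod_zero_field[OF A] by blast
  have "x \<bullet>c w i = 0" if "i < k" for i
  proof -
    have "x \<bullet>c w i = (A *\<^sub>v x) $ i"
      using that \<open>k < N\<close> unfolding cprod_sum[OF w[OF that]] mult_mat_vec_index_sum[OF A x(1) less_trans[OF that \<open>k < N\<close>]]
      by (intro sum.cong) (auto simp: A_def)
    then show ?thesis using x(3) that \<open>k < N\<close> by simp
  qed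
  with x that show ?thesis by blast
qed

lemma unit_vector_multiple:
  fixes x :: "complex vec"
  assumes x: "x \<in> carrier_vec N" "x \<noteq> 0\<^sub>v N"
  obtains c y where "y = c \<cdot>\<^sub>v x" "y \<in> carrier_vec N" "y \<bullet>c y = 1"
proof -
  define c where "c = complex_of_real (1 / l2_norm x)"
  have "l2_norm x \<noteq> 0" using x l2_norm_eq_0_iff by blast
  then have "c * (cnj c * (x \<bullet>c x)) = 1"
    by (simp add: cprod_self c_def power2_eq_square)
  then have "(c \<cdot>\<^sub>v x) \<bullet>c (c \<cdot>\<^sub>v x) = 1"
    using x cprod_smult_left[of x N "c \<cdot>\<^sub>v x" c] cprod_smult_right[of x N x c] by simp
  then show ?thesis using x that by simp
qed

lemma orthonormal_extend:
  assumes "orthonormal N k v" "k \<le> N"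
  obtains w where "orthonormal N N w" "\<And>i. i < k \<Longrightarrow> w i = v i"
proof -
  have "\<exists>w. orthonormal N (k + d) w \<and> (\<forall>i<k. w i = v i)" if "k + d \<le> N" for d
    using that
  proof (induction d)
    case 0
    then show ?case using assms by auto
  next
    case (Suc d)
    then obtain w where w: "orthonormal N (k + d) w" "\<forall>i<k. w i = v i" by auto
    obtain x where x: "x \<in> carrier_vec N" "x \<noteq> 0\<^sub>v N" "\<And>i. i < k + d \<Longrightarrow> x \<bullet>c w i = 0"
      using underdetermined_orthogonal[of "k + d" N w] Suc.prems w(1) by auto
    obtain c y where y: "y = c \<cdot>\<^sub>v x" "y \<in> carrier_vec N" "y \<bullet>c y = 1"
      using unit_vector_multiple[OF x(1,2)] by blast
    have yw: "y \<bullet>c w i = 0" if "i < k + d" for i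
      using x(1,3) that w(1) unfolding y(1) by (simp add: cprod_smult_left[of _ N])
    moreover have "w i \<bullet>c y = 0" if "i < k + d" for i
      using cprod_commute[OF _ y(2), of "w i"] yw[OF that] that w(1) by simp
    ultimately have "orthonormal N (k + Suc d) (w(k + d := y))"
      using y w(1) unfolding orthonormal_def by (auto simp: less_Suc_eq)
    moreover have "\<forall>i<k. (w(k + d := y)) i = v i" using w(2) by auto
    ultimately show ?case by blast
  qed
  from this[of "N - k"] assms(2) that show ?thesis by auto
qed

text \<open>A left inverse of a square matrix is also a right inverse; this turns orthonormality
  into completeness.\<close>

lemma orthonormal_unitary:
  fixes v :: "nat \<Rightarrow> complex vec"
  assumes v: "orthonormal N N v"
  defines "V \<equiv> mat N N (\<lambda>(a, i). v i $ a)"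
  shows "mat_adjoint V * V = 1\<^sub>m N" and "V * mat_adjoint V = 1\<^sub>m N"
proof -
  have V: "V \<in> carrier_mat N N" unfolding V_def by simp
  show VV: "mat_adjoint V * V = 1\<^sub>m N"
  proof (rule eq_matI)
    fix i j assume ij: "i < dim_row (1\<^sub>m N :: complex mat)" "j < dim_col (1\<^sub>m N :: complex mat)"
    then have "(mat_adjoint V * V) $$ (i, j) = v j \<bullet>c v i"
      using V v by (auto simp: scalar_prod_def V_def mult.commute intro!: sum.cong)
    then show "(mat_adjoint V * V) $$ (i, j) = 1\<^sub>m N $$ (i, j)"
      using ij orthonormal_cprod[OF v, of j i] by auto
  qed (use V in auto)
  then show "V * mat_adjoint V = 1\<^sub>m N"
    using mat_mult_left_right_inverse V mat_adjoint_carrier by blast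
qed

lemma orthonormal_completeness:
  assumes v: "orthonormal N N v" and "a < N" "b < N"
  shows "(\<Sum>i<N. v i $ a * cnj (v i $ b)) = (if a = b then 1 else 0)"
proof -
  define V where "V = mat N N (\<lambda>(a, i). v i $ a)"
  have V: "V \<in> carrier_mat N N" unfolding V_def by simp
  have "V * mat_adjoint V = 1\<^sub>m N" unfolding V_def by (rule orthonormal_unitary(2)[OF v])
  then have "(V * mat_adjoint V) $$ (a, b) = (if a = b then 1 else 0)" using assms by simp
  moreover have "(V * mat_adjoint V) $$ (a, b) = (\<Sum>i<N. v i $ a * cnj (v i $ b))"
    using assms V by (auto simp: scalar_prod_def V_def lessThan_atLeast0 intro!: sum.cong)
  ultimately show ?thesis by simp
qed

lemma parseval:
  fixes x y :: "complex vec"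
  assumes v: "orthonormal N N v" and x: "x \<in> carrier_vec N" and y: "y \<in> carrier_vec N"
  shows "x \<bullet>c y = (\<Sum>i<N. (x \<bullet>c v i) * (v i \<bullet>c y))"
proof -
  have "(\<Sum>i<N. (x \<bullet>c v i) * (v i \<bullet>c y)) =
        (\<Sum>i<N. \<Sum>a<N. \<Sum>b<N. (x $ a * cnj (v i $ a)) * (v i $ b * cnj (y $ b)))"
    using v y by (intro sum.cong refl) (simp add: cprod_sum[of _ N] sum_product)
  also have "\<dots> = (\<Sum>a<N. \<Sum>b<N. \<Sum>i<N. (x $ a * cnj (v i $ a)) * (v i $ b * cnj (y $ b)))"
  proof -
    have "(\<Sum>i<N. \<Sum>a<N. \<Sum>b<N. f i a b) = (\<Sum>a<N. \<Sum>b<N. \<Sum>i<N. f i a b)" for f :: "nat \<Rightarrow> nat \<Rightarrow> nat \<Rightarrow> complex"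
      using sum.swap[of "\<lambda>i a. \<Sum>b<N. f i a b" "{..<N}" "{..<N}"] sum.swap[of "\<lambda>i b. f i _ b" "{..<N}" "{..<N}"]
      by simp
    then show ?thesis .
  qed
  also have "\<dots> = (\<Sum>a<N. \<Sum>b<N. x $ a * cnj (y $ b) * (\<Sum>i<N. v i $ b * cnj (v i $ a)))"
    by (intro sum.cong refl) (simp add: sum_distrib_left mult_ac)
  also have "\<dots> = (\<Sum>a<N. \<Sum>b<N. if b = a then x $ a * cnj (y $ b) else 0)"
    using orthonormal_completeness[OF v] by (intro sum.cong refl) auto
  also have "\<dots> = x \<bullet>c y" using y by (simp add: cprod_sum[of _ N])
  finally show ?thesis ..
qed

lemma parseval_norm:
  assumes v: "orthonormal N N v" and x: "x \<in> carrier_vec N"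
  shows "(l2_norm x)\<^sup>2 = (\<Sum>i<N. (cmod (x \<bullet>c v i))\<^sup>2)"
proof -
  have "complex_of_real ((l2_norm x)\<^sup>2) = (\<Sum>i<N. (x \<bullet>c v i) * (v i \<bullet>c x))"
    using parseval[OF v x x] unfolding cprod_self .
  also have "\<dots> = (\<Sum>i<N. complex_of_real ((cmod (x \<bullet>c v i))\<^sup>2))"
  proof (intro sum.cong refl)
    fix i assume "i \<in> {..<N}"
    then have "v i \<bullet>c x = cnj (x \<bullet>c v i)" using v x by (intro cprod_commute) auto
    then show "(x \<bullet>c v i) * (v i \<bullet>c x) = complex_of_real ((cmod (x \<bullet>c v i))\<^sup>2)"
      by (metis complex_norm_square)
  qed
  also have "\<dots> = complex_of_real (\<Sum>i<N. (cmod (x \<bullet>c v i))\<^sup>2)" by simp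
  finally show ?thesis using of_real_eq_iff by blast
qed

lemma vec_eq_by_basis:
  fixes x y :: "complex vec"
  assumes v: "orthonormal N N v" and x: "x \<in> carrier_vec N" and y: "y \<in> carrier_vec N"
    and eq: "\<And>i. i < N \<Longrightarrow> x \<bullet>c v i = y \<bullet>c v i"
  shows "x = y"
proof -
  have "(l2_norm (x - y))\<^sup>2 = 0"
    using x y v eq by (subst parseval_norm[OF v]) (auto simp: cprod_minus_left[of _ N])
  then have "x - y = 0\<^sub>v N" using l2_norm_eq_0_iff[of "x - y" N] x y by simp
  then have "x $ i - y $ i = 0" if "i < N" for i using that x y by (metis carrier_vecD index_minus_vec(1) index_zero_vec(1))
  then show ?thesis using x y by (intro eq_vecI) auto
qed

lemma mat_eq_by_basis:
  fixes A B :: "complex mat"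
  assumes v: "orthonormal n n v" and A: "A \<in> carrier_mat m n" and B: "B \<in> carrier_mat m n"
    and eq: "\<And>i. i < n \<Longrightarrow> A *\<^sub>v v i = B *\<^sub>v v i"
  shows "A = B"
proof -
  have *: "C $$ (a, b) = (\<Sum>i<n. (C *\<^sub>v v i) $ a * cnj (v i $ b))"
    if C: "C \<in> carrier_mat m n" and ab: "a < m" "b < n" for C a b
  proof -
    have "(\<Sum>i<n. (C *\<^sub>v v i) $ a * cnj (v i $ b)) = (\<Sum>i<n. \<Sum>c<n. C $$ (a, c) * v i $ c * cnj (v i $ b))"
      using C v ab by (intro sum.cong refl) (simp add: mult_mat_vec_index_sum[of C m n] sum_distrib_right del: index_mult_mat_vec)
    also have "\<dots> = (\<Sum>c<n. C $$ (a, c) * (\<Sum>i<n. v i $ c * cnj (v i $ b)))"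
      by (subst sum.swap) (simp add: sum_distrib_left mult_ac)
    also have "\<dots> = (\<Sum>c<n. if c = b then C $$ (a, c) else 0)"
      using orthonormal_completeness[OF v _ ab(2)] by (intro sum.cong refl) auto
    finally show ?thesis using ab by simp
  qed
  show ?thesis
    using A B *[OF A] *[OF B] eq by (intro eq_matI) auto
qed

text \<open>The matrix \<open>\<Sum>i<k t\<^sub>i u\<^sub>i v\<^sub>i\<^sup>*\<close>. It serves as spectral decomposition (\<open>u = v\<close>) and as singular value
  decomposition.\<close>

definition dyad_sum ::
  "nat \<Rightarrow> nat \<Rightarrow> nat \<Rightarrow> (nat \<Rightarrow> real) \<Rightarrow> (nat \<Rightarrow> complex vec) \<Rightarrow> (nat \<Rightarrow> complex vec) \<Rightarrow> complex mat" where
  "dyad_sum m n k t u v = mat m n (\<lambda>(a, b). \<Sum>i<k. complex_of_real (t i) * u i $ a * cnj (v i $ b))"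

lemma dyad_sum_carrier [simp]: "dyad_sum m n k t u v \<in> carrier_mat m n"
  unfolding dyad_sum_def by simp

lemma dyad_sum_mult_index:
  assumes v: "\<And>i. i < k \<Longrightarrow> v i \<in> carrier_vec n" and x: "x \<in> carrier_vec n" and "a < m"
  shows "(dyad_sum m n k t u v *\<^sub>v x) $ a = (\<Sum>i<k. complex_of_real (t i) * (x \<bullet>c v i) * u i $ a)"
proof -
  have "(dyad_sum m n k t u v *\<^sub>v x) $ a = (\<Sum>b<n. \<Sum>i<k. complex_of_real (t i) * u i $ a * cnj (v i $ b) * x $ b)"
    using assms by (subst mult_mat_vec_index_sum[of _ m n])
      (simp_all add: dyad_sum_def sum_distrib_right)
  also have "\<dots> = (\<Sum>i<k. \<Sum>b<n. complex_of_real (t i) * u i $ a * cnj (v i $ b) * x $ b)"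
    by (rule sum.swap)
  also have "\<dots> = (\<Sum>i<k. complex_of_real (t i) * (x \<bullet>c v i) * u i $ a)"
    using v by (intro sum.cong refl) (simp add: cprod_sum[of _ n] sum_distrib_left sum_distrib_right mult_ac)
  finally show ?thesis .
qed

lemma dyad_sum_cprod:
  assumes v: "\<And>i. i < k \<Longrightarrow> v i \<in> carrier_vec n" and u: "\<And>i. i < k \<Longrightarrow> u i \<in> carrier_vec m"
    and x: "x \<in> carrier_vec n" and y: "y \<in> carrier_vec m"
  shows "(dyad_sum m n k t u v *\<^sub>v x) \<bullet>c y = (\<Sum>i<k. complex_of_real (t i) * (x \<bullet>c v i) * (u i \<bullet>c y))"
proof -
  have "(dyad_sum m n k t u v *\<^sub>v x) \<bullet>c y =
      (\<Sum>a<m. (\<Sum>i<k. complex_of_real (t i) * (x \<bullet>c v i) * u i $ a) * cnj (y $ a))"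
    using y by (simp add: cprod_sum[OF y] dyad_sum_mult_index[OF v x] del: index_mult_mat_vec)
  also have "\<dots> = (\<Sum>i<k. \<Sum>a<m. complex_of_real (t i) * (x \<bullet>c v i) * u i $ a * cnj (y $ a))"
    by (subst sum.swap) (simp add: sum_distrib_right)
  also have "\<dots> = (\<Sum>i<k. complex_of_real (t i) * (x \<bullet>c v i) * (u i \<bullet>c y))"
    using y by (intro sum.cong refl) (simp add: cprod_sum[OF y] sum_distrib_left mult_ac)
  finally show ?thesis .
qed

lemma dyad_sum_basis:
  assumes v: "orthonormal n n v" and u: "\<And>i. i < k \<Longrightarrow> u i \<in> carrier_vec m" and "k \<le> n" "j < n"
  shows "dyad_sum m n k t u v *\<^sub>v v j = (if j < k then complex_of_real (t j) \<cdot>\<^sub>v u j else 0\<^sub>v m)"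
proof (rule eq_vecI)
  fix a assume "a < dim_vec (if j < k then complex_of_real (t j) \<cdot>\<^sub>v u j else 0\<^sub>v m)"
  then have a: "a < m" using u[of j] carrier_vecD[of "u j" m] by (auto split: if_splits)
  have "(dyad_sum m n k t u v *\<^sub>v v j) $ a = (\<Sum>i<k. complex_of_real (t i) * (v j \<bullet>c v i) * u i $ a)"
    using assms a by (intro dyad_sum_mult_index) auto
  also have "\<dots> = (\<Sum>i<k. if i = j then complex_of_real (t i) * u i $ a else 0)"
    using assms by (intro sum.cong refl) (auto simp: orthonormal_cprod[OF v])
  finally show "(dyad_sum m n k t u v *\<^sub>v v j) $ a = (if j < k then complex_of_real (t j) \<cdot>\<^sub>v u j else 0\<^sub>v m) $ a"
    using a \<open>j < n\<close> by (cases "j < k") (simp_all add: carrier_vecD[OF u])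
qed (use carrier_vecD[OF u[of j]] in \<open>auto simp: dyad_sum_def\<close>)

lemma dyad_sum_adjoint: "mat_adjoint (dyad_sum m n k t u v) = dyad_sum n m k t v u"
  by (intro eq_matI) (simp_all add: dyad_sum_def, intro sum.cong refl, simp)

section \<open>Hermitian matrices and the Lidskii inequality\<close>

lemma quadratic_form_in_eigenbasis:
  assumes v: "orthonormal N N v" and x: "x \<in> carrier_vec N" and A: "A \<in> carrier_mat N N"
    and herm: "mat_adjoint A = A"
    and eig: "\<And>i. i < N \<Longrightarrow> A *\<^sub>v v i = complex_of_real (l i) \<cdot>\<^sub>v v i"
  shows "Re ((A *\<^sub>v x) \<bullet>c x) = (\<Sum>i<N. l i * (cmod (x \<bullet>c v i))\<^sup>2)"
proof -
  have Ax: "A *\<^sub>v x \<in> carrier_vec N" using A x by simp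
  have "(A *\<^sub>v x) \<bullet>c x = (\<Sum>i<N. ((A *\<^sub>v x) \<bullet>c v i) * (v i \<bullet>c x))"
    using parseval[OF v Ax x] .
  also have "\<dots> = (\<Sum>i<N. complex_of_real (l i * (cmod (x \<bullet>c v i))\<^sup>2))"
  proof (intro sum.cong refl)
    fix i assume "i \<in> {..<N}"
    then have i: "i < N" by simp
    have vi: "v i \<in> carrier_vec N" using v i by simp
    have "(A *\<^sub>v x) \<bullet>c v i = complex_of_real (l i) * (x \<bullet>c v i)"
      using cprod_adjoint[OF A x vi] eig[OF i] cprod_smult_right[OF x vi] herm by simp
    moreover have "v i \<bullet>c x = cnj (x \<bullet>c v i)" by (rule cprod_commute[OF vi x])
    ultimately show "((A *\<^sub>v x) \<bullet>c v i) * (v i \<bullet>c x) = complex_of_real (l i * (cmod (x \<bullet>c v i))\<^sup>2)"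
      by (metis (no_types, opaque_lifting) complex_norm_square mult.assoc of_real_mult of_real_power)
  qed
  finally show ?thesis by (simp flip: of_real_sum)
qed

definition lin_comb :: "nat \<Rightarrow> nat \<Rightarrow> (nat \<Rightarrow> complex) \<Rightarrow> (nat \<Rightarrow> complex vec) \<Rightarrow> complex vec" where
  "lin_comb N k c w = vec N (\<lambda>a. \<Sum>i<k. c i * w i $ a)"

lemma lin_comb_carrier [simp]: "lin_comb N k c w \<in> carrier_vec N"
  unfolding lin_comb_def by simp

lemma lin_comb_cprod:
  assumes y: "y \<in> carrier_vec N" and w: "\<And>i. i < k \<Longrightarrow> w i \<in> carrier_vec N"
  shows "lin_comb N k c w \<bullet>c y = (\<Sum>i<k. c i * (w i \<bullet>c y))"
proof -
  have "lin_comb N k c w \<bullet>c y = (\<Sum>a<N. \<Sum>i<k. c i * w i $ a * cnj (y $ a))"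
    by (simp add: cprod_sum[OF y] lin_comb_def sum_distrib_right)
  also have "\<dots> = (\<Sum>i<k. \<Sum>a<N. c i * w i $ a * cnj (y $ a))" by (rule sum.swap)
  also have "\<dots> = (\<Sum>i<k. c i * (w i \<bullet>c y))"
    by (simp add: cprod_sum[OF y] sum_distrib_left mult.assoc)
  finally show ?thesis .
qed

lemma hermitian_eigenvalue_real:
  assumes A: "A \<in> carrier_mat N N" "mat_adjoint A = A" and x: "x \<in> carrier_vec N" "x \<bullet>c x = 1"
    and eig: "A *\<^sub>v x = e \<cdot>\<^sub>v x"
  shows "e = complex_of_real (Re e)"
proof -
  have "e = cnj e"
    using cprod_adjoint[OF A(1) x(1) x(1)] A(2) eig x
      cprod_smult_left[OF x(1) x(1), of e] cprod_smult_right[OF x(1) x(1), of e] by simp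
  then show ?thesis by (metis Reals_cnj_iff of_real_Re)
qed

lemma unit_eigenvector_exists:
  fixes A :: "complex mat"
  assumes A: "A \<in> carrier_mat N N" and "0 < N"
  obtains e x where "x \<in> carrier_vec N" "x \<bullet>c x = 1" "A *\<^sub>v x = e \<cdot>\<^sub>v x"
proof -
  obtain as where as: "char_poly A = (\<Prod>a\<leftarrow>as. [:- a, 1:])" "length as = N"
    using char_poly_factorized[OF A] by blast
  then obtain e as' where "as = e # as'" using \<open>0 < N\<close> by (cases as) auto
  then have "poly (char_poly A) e = 0" using as by simp
  then obtain y where y: "y \<in> carrier_vec N" "y \<noteq> 0\<^sub>v N" "A *\<^sub>v y = e \<cdot>\<^sub>v y"
    using eigenvalue_root_char_poly[OF A] A unfolding eigenvalue_def eigenvector_def by auto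
  obtain c x where x: "x = c \<cdot>\<^sub>v y" "x \<in> carrier_vec N" "x \<bullet>c x = 1"
    using unit_vector_multiple[OF y(1,2)] by blast
  have "A *\<^sub>v x = e \<cdot>\<^sub>v x"
    using mult_mat_vec[OF A y(1), of c] y unfolding x(1) by (simp add: smult_smult_assoc mult.commute)
  with x that show ?thesis by blast
qed

text \<open>Deflation: the orthogonal complement of an eigenvector is invariant under a Hermitian matrix. In an
  orthonormal basis \<open>w\<close> that starts with a unit eigenvector, the compression \<open>B\<close> to the remaining basis
  vectors is again Hermitian, and its eigenvectors are the coordinates of further eigenvectors of \<open>A\<close>.\<close>

lemma hermitian_orthonormal_eigenbasis:
  fixes A :: "complex mat"
  assumes "A \<in> carrier_mat N N" "mat_adjoint A = A"
  shows "\<exists>v (l :: nat \<Rightarrow> real). orthonormal N N v \<and> (\<forall>i<N. A *\<^sub>v v i = complex_of_real (l i) \<cdot>\<^sub>v v i)"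
  using assms
proof (induction N arbitrary: A)
  case 0
  show ?case by (intro exI[of _ "\<lambda>_. 0\<^sub>v 0"] exI[of _ "\<lambda>_. 0"]) (simp add: orthonormal_def)
next
  case (Suc N)
  note A = Suc.prems
  obtain e x where x: "x \<in> carrier_vec (Suc N)" "x \<bullet>c x = 1" "A *\<^sub>v x = e \<cdot>\<^sub>v x"
    using unit_eigenvector_exists[OF A(1)] by blast
  have "orthonormal (Suc N) 1 (\<lambda>_. x)" using x unfolding orthonormal_def by simp
  then obtain w where w: "orthonormal (Suc N) (Suc N) w" and w0: "w 0 = x"
    using orthonormal_extend[of "Suc N" 1 "\<lambda>_. x"] by auto
  have wc: "w i \<in> carrier_vec (Suc N)" if "i < Suc N" for i using w that by simp
  have Aw: "A *\<^sub>v w i \<in> carrier_vec (Suc N)" if "i < Suc N" for i using A(1) wc[OF that] by simp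
  define B where "B = mat N N (\<lambda>(i, j). (A *\<^sub>v w (Suc j)) \<bullet>c w (Suc i))"
  have B: "B \<in> carrier_mat N N" unfolding B_def by simp
  have move: "w j \<bullet>c (A *\<^sub>v w i) = (A *\<^sub>v w j) \<bullet>c w i" if "i < Suc N" "j < Suc N" for i j
    using cprod_adjoint[OF A(1) wc[OF that(2)] wc[OF that(1)]] A(2) by simp
  have "mat_adjoint B = B"
  proof (rule eq_matI)
    fix i j assume "i < dim_row B" "j < dim_col B"
    then have ij: "i < N" "j < N" using B by auto
    then show "mat_adjoint B $$ (i, j) = B $$ (i, j)"
      using cprod_commute[OF Aw wc, of "Suc i" "Suc j"] move[of "Suc i" "Suc j"] B
      by (simp add: B_def)
  qed (use B in simp_all)
  from Suc.IH[OF B this] obtain z and l :: "nat \<Rightarrow> real"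
    where z: "orthonormal N N z" and Bz: "\<forall>i<N. B *\<^sub>v z i = complex_of_real (l i) \<cdot>\<^sub>v z i" by blast
  define y where "y k = lin_comb (Suc N) N (\<lambda>i. z k $ i) (\<lambda>i. w (Suc i))" for k
  have yc: "y k \<in> carrier_vec (Suc N)" for k unfolding y_def by simp
  have yw: "y k \<bullet>c w (Suc i) = z k $ i" if "i < N" for k i
  proof -
    have "y k \<bullet>c w (Suc i) = (\<Sum>j<N. z k $ j * (w (Suc j) \<bullet>c w (Suc i)))"
      unfolding y_def using that by (intro lin_comb_cprod wc) auto
    also have "\<dots> = (\<Sum>j<N. if j = i then z k $ j else 0)"
      using that by (intro sum.cong refl) (simp add: orthonormal_cprod[OF w])
    finally show ?thesis using that by simp
  qed
  have y0: "y k \<bullet>c w 0 = 0" for k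
    unfolding y_def by (subst lin_comb_cprod) (auto intro!: wc sum.neutral simp: orthonormal_cprod[OF w])
  have wy: "w (Suc i) \<bullet>c y k = cnj (z k $ i)" if "i < N" for i k
    using cprod_commute[OF wc yc, of "Suc i" k] yw[OF that] that by simp
  have wy0: "w 0 \<bullet>c y k = 0" for k
    using cprod_commute[OF wc yc, of 0 k] y0 by simp
  have yy: "y k \<bullet>c y j = (if k = j then 1 else 0)" if "k < N" "j < N" for k j
  proof -
    have "y k \<bullet>c y j = (\<Sum>i<N. z k $ i * cnj (z j $ i))"
      using parseval[OF w yc yc, of k j] by (simp add: sum.lessThan_Suc_shift y0 yw wy del: sum.lessThan_Suc)
    also have "\<dots> = z k \<bullet>c z j" using z that by (simp add: cprod_sum[of _ N])
    finally show ?thesis using orthonormal_cprod[OF z that] by simp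
  qed
  have Ay: "A *\<^sub>v y k = complex_of_real (l k) \<cdot>\<^sub>v y k" if k: "k < N" for k
  proof (rule vec_eq_by_basis[OF w])
    show "A *\<^sub>v y k \<in> carrier_vec (Suc N)" "complex_of_real (l k) \<cdot>\<^sub>v y k \<in> carrier_vec (Suc N)"
      using A(1) yc by auto
    fix i assume i: "i < Suc N"
    have s: "(A *\<^sub>v y k) \<bullet>c w i = y k \<bullet>c (A *\<^sub>v w i)"
      using cprod_adjoint[OF A(1) yc wc[OF i]] A(2) by simp
    show "(A *\<^sub>v y k) \<bullet>c w i = (complex_of_real (l k) \<cdot>\<^sub>v y k) \<bullet>c w i"
    proof (cases i)
      case 0
      then show ?thesis using s x w0 y0 cprod_smult_right[OF yc x(1), of k e] cprod_smult_left[OF yc x(1)] by simp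
    next
      case (Suc i')
      then have i': "i' < N" using i by simp
      have "y k \<bullet>c (A *\<^sub>v w i) = (\<Sum>j<N. z k $ j * ((A *\<^sub>v w (Suc j)) \<bullet>c w (Suc i')))"
        using parseval[OF w yc Aw[OF i], of k] Suc i'
        by (simp add: sum.lessThan_Suc_shift y0 yw move del: sum.lessThan_Suc)
      also have "\<dots> = (B *\<^sub>v z k) $ i'"
        using i' k z by (subst mult_mat_vec_index_sum[OF B]) (auto simp: B_def mult.commute)
      also have "\<dots> = complex_of_real (l k) * z k $ i'" using Bz k i' z by simp
      also have "\<dots> = (complex_of_real (l k) \<cdot>\<^sub>v y k) \<bullet>c w i"
        using cprod_smult_left[OF yc wc[OF i]] yw[OF i'] Suc by simp
      finally show ?thesis using s by simp
    qed
  qed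
  define v where "v k = (case k of 0 \<Rightarrow> x | Suc j \<Rightarrow> y j)" for k
  have "orthonormal (Suc N) (Suc N) v"
    unfolding orthonormal_def v_def
    using x yc yy y0 wy0 w0 by (auto split: nat.split)
  moreover have "\<forall>i<Suc N. A *\<^sub>v v i = complex_of_real (case i of 0 \<Rightarrow> Re e | Suc j \<Rightarrow> l j) \<cdot>\<^sub>v v i"
    unfolding v_def using Ay x hermitian_eigenvalue_real[OF A x] by (auto split: nat.split)
  ultimately show ?case by blast
qed

lemma decreasing_rearrangement:
  fixes f :: "nat \<Rightarrow> real"
  obtains \<sigma> where "\<sigma> permutes {..<n}" "\<And>i j. i \<le> j \<Longrightarrow> j < n \<Longrightarrow> f (\<sigma> j) \<le> f (\<sigma> i)"
proof -
  define xs where "xs = map f [0..<n]"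
  define ys where "ys = rev (sort xs)"
  have "mset ys = mset xs" unfolding ys_def by simp
  then obtain \<sigma> where \<sigma>: "\<sigma> permutes {..<length xs}" "permute_list \<sigma> xs = ys"
    using mset_eq_permutation by blast
  have n: "length xs = n" "length ys = n" unfolding ys_def xs_def by auto
  have "\<sigma> i < n" if "i < n" for i using \<sigma>(1) n that permutes_in_image[of \<sigma> "{..<n}"] by simp
  then have *: "f (\<sigma> i) = ys ! i" if "i < n" for i
    using \<sigma>(2) that n permute_list_nth[OF \<sigma>(1)] unfolding xs_def by (auto simp: )
  have "ys ! j \<le> ys ! i" if "i \<le> j" "j < n" for i j
    using that n unfolding ys_def by (simp add: rev_nth sorted_nth_mono)
  then show ?thesis using that \<sigma>(1) n * by simp
qed

lemma orthonormal_permute: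
  assumes "orthonormal N k v" "\<sigma> permutes {..<k}"
  shows "orthonormal N k (\<lambda>i. v (\<sigma> i))"
  using assms permutes_in_image[OF assms(2)] permutes_inj[OF assms(2)]
  unfolding orthonormal_def by (auto dest: injD)

definition eigensystem :: "nat \<Rightarrow> complex mat \<Rightarrow> (nat \<Rightarrow> real) \<Rightarrow> (nat \<Rightarrow> complex vec) \<Rightarrow> bool" where
  "eigensystem N A l v \<longleftrightarrow> A \<in> carrier_mat N N \<and> mat_adjoint A = A \<and> orthonormal N N v \<and>
     (\<forall>i<N. A *\<^sub>v v i = complex_of_real (l i) \<cdot>\<^sub>v v i) \<and> (\<forall>i j. i \<le> j \<longrightarrow> j < N \<longrightarrow> l j \<le> l i)"

theorem spectral_theorem:
  assumes "A \<in> carrier_mat N N" "mat_adjoint A = A"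
  obtains l v where "eigensystem N A l v"
proof -
  obtain v and l :: "nat \<Rightarrow> real" where v: "orthonormal N N v"
    and l: "\<forall>i<N. A *\<^sub>v v i = complex_of_real (l i) \<cdot>\<^sub>v v i"
    using hermitian_orthonormal_eigenbasis[OF assms] by blast
  obtain \<sigma> where \<sigma>: "\<sigma> permutes {..<N}" "\<And>i j. i \<le> j \<Longrightarrow> j < N \<Longrightarrow> l (\<sigma> j) \<le> l (\<sigma> i)"
    using decreasing_rearrangement[of N l] by blast
  have "eigensystem N A (\<lambda>i. l (\<sigma> i)) (\<lambda>i. v (\<sigma> i))"
    unfolding eigensystem_def
    using assms orthonormal_permute[OF v \<sigma>(1)] l \<sigma> permutes_in_image[OF \<sigma>(1)] by auto
  then show ?thesis using that by blast
qed

lemma eigensystem_quadratic_form: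
  assumes "eigensystem N A l v" "x \<in> carrier_vec N"
  shows "Re ((A *\<^sub>v x) \<bullet>c x) = (\<Sum>i<N. l i * (cmod (x \<bullet>c v i))\<^sup>2)"
  using assms quadratic_form_in_eigenbasis[of N v x A l] unfolding eigensystem_def by blast

text \<open>Courant--Fischer argument: some nonzero \<open>x\<close> lies both in the span of \<open>a 0, ..., a i\<close>, where the form
  of \<open>A\<close> is at least \<open>\<alpha> i\<close>, and in the span of \<open>b i, ..., b (N - 1)\<close>, where the form of \<open>B\<close> is at most
  \<open>\<beta> i\<close>.\<close>

lemma weyl_monotonicity:
  assumes A: "eigensystem N A \<alpha> a" and B: "eigensystem N B \<beta> b"
    and le: "\<And>x. x \<in> carrier_vec N \<Longrightarrow> Re ((A *\<^sub>v x) \<bullet>c x) \<le> Re ((B *\<^sub>v x) \<bullet>c x) + c * (l2_norm x)\<^sup>2"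
    and i: "i < N"
  shows "\<alpha> i \<le> \<beta> i + c"
proof -
  have a: "orthonormal N N a" and b: "orthonormal N N b" using A B unfolding eigensystem_def by auto
  \<comment> \<open>The \<open>i\<close> vectors \<open>b 0, ..., b (i - 1)\<close> and the \<open>N - 1 - i\<close> vectors \<open>a (i + 1), ..., a (N - 1)\<close>
    leave room for one more direction.\<close>
  define w where "w j = (if j < i then b j else a (Suc j))" for j
  have wc: "w j \<in> carrier_vec N" if "j < N - 1" for j
    unfolding w_def using that i a b by auto
  have less: "N - 1 < N" using i by simp
  obtain x where x: "x \<in> carrier_vec N" "x \<noteq> 0\<^sub>v N"
    and orth: "\<And>j. j < N - 1 \<Longrightarrow> x \<bullet>c w j = 0"
    using underdetermined_orthogonal[of "N - 1" N w, OF less wc] by blast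
  have xb: "x \<bullet>c b j = 0" if "j < i" for j using orth[of j] that i by (simp add: w_def)
  have xa: "x \<bullet>c a j = 0" if "i < j" "j < N" for j using orth[of "j - 1"] that by (cases j) (auto simp: w_def)
  have "\<alpha> i * (l2_norm x)\<^sup>2 = (\<Sum>j<N. \<alpha> i * (cmod (x \<bullet>c a j))\<^sup>2)"
    by (simp add: parseval_norm[OF a x(1)] sum_distrib_left)
  also have "\<dots> \<le> (\<Sum>j<N. \<alpha> j * (cmod (x \<bullet>c a j))\<^sup>2)"
  proof (intro sum_mono)
    fix j assume "j \<in> {..<N}"
    then show "\<alpha> i * (cmod (x \<bullet>c a j))\<^sup>2 \<le> \<alpha> j * (cmod (x \<bullet>c a j))\<^sup>2"
      using A i xa[of j] unfolding eigensystem_def by (cases "j \<le> i") (auto intro!: mult_right_mono)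
  qed
  also have "\<dots> \<le> (\<Sum>j<N. \<beta> j * (cmod (x \<bullet>c b j))\<^sup>2) + c * (l2_norm x)\<^sup>2"
    using le[OF x(1)] eigensystem_quadratic_form[OF A x(1)] eigensystem_quadratic_form[OF B x(1)] by simp
  also have "(\<Sum>j<N. \<beta> j * (cmod (x \<bullet>c b j))\<^sup>2) \<le> (\<Sum>j<N. \<beta> i * (cmod (x \<bullet>c b j))\<^sup>2)"
  proof (intro sum_mono)
    fix j assume "j \<in> {..<N}"
    then show "\<beta> j * (cmod (x \<bullet>c b j))\<^sup>2 \<le> \<beta> i * (cmod (x \<bullet>c b j))\<^sup>2"
      using B i xb[of j] unfolding eigensystem_def by (cases "i \<le> j") (auto intro!: mult_right_mono)
  qed
  also have "(\<Sum>j<N. \<beta> i * (cmod (x \<bullet>c b j))\<^sup>2) = \<beta> i * (l2_norm x)\<^sup>2"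
    by (simp add: parseval_norm[OF b x(1)] sum_distrib_left)
  finally have "\<alpha> i * (l2_norm x)\<^sup>2 \<le> (\<beta> i + c) * (l2_norm x)\<^sup>2" by (simp add: algebra_simps)
  moreover have "0 < (l2_norm x)\<^sup>2" using x l2_norm_eq_0_iff[OF x(1)] by simp
  ultimately show ?thesis by simp
qed

lemma trace_in_basis:
  fixes A :: "complex mat"
  assumes v: "orthonormal N N v" and A: "A \<in> carrier_mat N N"
  shows "(\<Sum>i<N. (A *\<^sub>v v i) \<bullet>c v i) = (\<Sum>a<N. A $$ (a, a))"
proof -
  have "(\<Sum>i<N. (A *\<^sub>v v i) \<bullet>c v i) = (\<Sum>i<N. \<Sum>a<N. \<Sum>b<N. A $$ (a, b) * v i $ b * cnj (v i $ a))"
    using v by (intro sum.cong refl)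
      (simp add: cprod_sum[of _ N] mult_mat_vec_index_sum[OF A] sum_distrib_right del: index_mult_mat_vec)
  also have "\<dots> = (\<Sum>a<N. \<Sum>b<N. \<Sum>i<N. A $$ (a, b) * v i $ b * cnj (v i $ a))"
    using sum.swap[of "\<lambda>i a. \<Sum>b<N. A $$ (a, b) * v i $ b * cnj (v i $ a)" "{..<N}" "{..<N}"]
      sum.swap[of "\<lambda>i b. A $$ (_, b) * v i $ b * cnj (v i $ _)" "{..<N}" "{..<N}"] by simp
  also have "\<dots> = (\<Sum>a<N. \<Sum>b<N. A $$ (a, b) * (\<Sum>i<N. v i $ b * cnj (v i $ a)))"
    by (simp add: sum_distrib_left mult.assoc)
  also have "\<dots> = (\<Sum>a<N. \<Sum>b<N. if b = a then A $$ (a, b) else 0)"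
    using orthonormal_completeness[OF v] by (intro sum.cong refl) auto
  finally show ?thesis by simp
qed

lemma eigensystem_trace:
  assumes "eigensystem N A l v"
  shows "complex_of_real (\<Sum>i<N. l i) = (\<Sum>a<N. A $$ (a, a))"
proof -
  have v: "orthonormal N N v" and A: "A \<in> carrier_mat N N" using assms unfolding eigensystem_def by auto
  have "(A *\<^sub>v v i) \<bullet>c v i = complex_of_real (l i)" if "i < N" for i
    using assms that cprod_smult_left[of "v i" N "v i"] orthonormal_cprod[OF v that that] v
    unfolding eigensystem_def by simp
  then show ?thesis using trace_in_basis[OF v A] by simp
qed

text \<open>The proof is due to Li and Mathias. With \<open>p = card J\<close> and \<open>c = \<epsilon> (p - 1)\<close>, the difference \<open>A - B\<close> is
  at most \<open>P + c\<close>, where \<open>P\<close> is the positive part of \<open>A - B - c\<close> and has trace \<open>\<Sum>i<p \<epsilon> i - c\<close>. Passing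
  from \<open>B\<close> to \<open>B + P\<close> raises every eigenvalue, so the increase over \<open>J\<close> is at most the total increase,
  which is the trace of \<open>P\<close>; the shift by \<open>c\<close> adds \<open>p c\<close>.\<close>

theorem lidskii:
  assumes A: "eigensystem N A \<alpha> a" and B: "eigensystem N B \<beta> b" and E: "eigensystem N (A - B) \<epsilon> e"
    and J: "J \<subseteq> {..<N}"
  shows "(\<Sum>i\<in>J. \<alpha> i - \<beta> i) \<le> (\<Sum>i<card J. \<epsilon> i)"
proof (cases "J = {}")
  case False
  have fin: "finite J" using J finite_subset by blast
  define p where "p = card J"
  have p: "0 < p" "p \<le> N"
    using False fin J card_mono[OF _ J] unfolding p_def by (auto simp: card_gt_0_iff)
  define c where "c = \<epsilon> (p - 1)"
  have Am: "A \<in> carrier_mat N N" and Bm: "B \<in> carrier_mat N N" and Bh: "mat_adjoint B = B"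
    and e: "orthonormal N N e"
    using A B E unfolding eigensystem_def by auto
  define P where "P = dyad_sum N N p (\<lambda>i. \<epsilon> i - c) e e"
  have Pm: "P \<in> carrier_mat N N" unfolding P_def by simp
  have Ph: "mat_adjoint P = P" unfolding P_def by (rule dyad_sum_adjoint)
  have BP: "B + P \<in> carrier_mat N N" using Bm Pm by simp
  have "mat_adjoint (B + P) = B + P"
  proof (rule eq_matI)
    fix i j assume "i < dim_row (B + P)" "j < dim_col (B + P)"
    then have ij: "i < N" "j < N" using Pm by auto
    have "cnj (B $$ (j, i)) = B $$ (i, j)" "cnj (P $$ (j, i)) = P $$ (i, j)"
      using ij Bm Pm Bh Ph mat_adjoint_index[of i B j] mat_adjoint_index[of i P j] by auto
    then show "mat_adjoint (B + P) $$ (i, j) = (B + P) $$ (i, j)" using ij Bm Pm by simp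
  qed (use Bm Pm in auto)
  then obtain \<gamma> g where C: "eigensystem N (B + P) \<gamma> g" using spectral_theorem[OF BP] by blast
  have Pform: "Re ((P *\<^sub>v x) \<bullet>c x) = (\<Sum>i<p. (\<epsilon> i - c) * (cmod (x \<bullet>c e i))\<^sup>2)" if x: "x \<in> carrier_vec N" for x
  proof -
    have "(P *\<^sub>v x) \<bullet>c x = (\<Sum>i<p. complex_of_real (\<epsilon> i - c) * (x \<bullet>c e i) * (e i \<bullet>c x))"
      unfolding P_def using e p x by (intro dyad_sum_cprod) auto
    also have "\<dots> = (\<Sum>i<p. complex_of_real ((\<epsilon> i - c) * (cmod (x \<bullet>c e i))\<^sup>2))"
    proof (intro sum.cong refl)
      fix i assume "i \<in> {..<p}"
      then have "e i \<bullet>c x = cnj (x \<bullet>c e i)" using e p x by (intro cprod_commute) auto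
      then show "complex_of_real (\<epsilon> i - c) * (x \<bullet>c e i) * (e i \<bullet>c x) =
          complex_of_real ((\<epsilon> i - c) * (cmod (x \<bullet>c e i))\<^sup>2)"
        by (metis (no_types, opaque_lifting) complex_norm_square mult.assoc of_real_mult of_real_power)
    qed
    finally show ?thesis by (simp flip: of_real_sum)
  qed
  have addform: "Re (((B + P) *\<^sub>v x) \<bullet>c x) = Re ((B *\<^sub>v x) \<bullet>c x) + Re ((P *\<^sub>v x) \<bullet>c x)"
    if x: "x \<in> carrier_vec N" for x
    using cprod_add_left[of "B *\<^sub>v x" N "P *\<^sub>v x" x] add_mult_distrib_mat_vec[OF Bm Pm x] Bm Pm x by simp
  have \<epsilon>_c: "c \<le> \<epsilon> i" if "i < p" for i
    using E that p unfolding c_def eigensystem_def by auto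
  have c_\<epsilon>: "\<epsilon> i \<le> c" if "\<not> i < p" "i < N" for i
    using E that p unfolding c_def eigensystem_def by auto
  have "\<alpha> i \<le> \<gamma> i + c" if "i < N" for i
  proof (rule weyl_monotonicity[OF A C _ that])
    fix x :: "complex vec" assume x: "x \<in> carrier_vec N"
    have "Re ((A *\<^sub>v x) \<bullet>c x) - Re ((B *\<^sub>v x) \<bullet>c x) = Re (((A - B) *\<^sub>v x) \<bullet>c x)"
      using cprod_minus_left[of "A *\<^sub>v x" N "B *\<^sub>v x" x] minus_mult_distrib_mat_vec[OF Am Bm x] Am Bm x by simp
    also have "\<dots> = (\<Sum>i<N. \<epsilon> i * (cmod (x \<bullet>c e i))\<^sup>2)" by (rule eigensystem_quadratic_form[OF E x])
    also have "\<dots> \<le> (\<Sum>i<N. (if i < p then \<epsilon> i - c else 0) * (cmod (x \<bullet>c e i))\<^sup>2 + c * (cmod (x \<bullet>c e i))\<^sup>2)"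
      using c_\<epsilon> by (intro sum_mono) (auto simp: algebra_simps intro!: mult_right_mono)
    also have "\<dots> = (\<Sum>i<p. (\<epsilon> i - c) * (cmod (x \<bullet>c e i))\<^sup>2) + c * (l2_norm x)\<^sup>2"
    proof -
      have "(\<Sum>i<N. (if i < p then \<epsilon> i - c else 0) * (cmod (x \<bullet>c e i))\<^sup>2) =
          (\<Sum>i<p. (\<epsilon> i - c) * (cmod (x \<bullet>c e i))\<^sup>2)"
        using p by (intro sum.mono_neutral_cong_right) auto
      then show ?thesis by (simp add: sum.distrib parseval_norm[OF e x] sum_distrib_left)
    qed
    finally show "Re ((A *\<^sub>v x) \<bullet>c x) \<le> Re (((B + P) *\<^sub>v x) \<bullet>c x) + c * (l2_norm x)\<^sup>2"
      using Pform[OF x] addform[OF x] by simp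
  qed
  note \<alpha>\<gamma> = this
  have \<beta>\<gamma>: "\<beta> i \<le> \<gamma> i" if "i < N" for i
  proof -
    have "\<beta> i \<le> \<gamma> i + 0"
    proof (rule weyl_monotonicity[OF B C _ that])
      fix x :: "complex vec" assume x: "x \<in> carrier_vec N"
      have "0 \<le> Re ((P *\<^sub>v x) \<bullet>c x)" unfolding Pform[OF x] using \<epsilon>_c by (intro sum_nonneg) auto
      then show "Re ((B *\<^sub>v x) \<bullet>c x) \<le> Re (((B + P) *\<^sub>v x) \<bullet>c x) + 0 * (l2_norm x)\<^sup>2"
        using addform[OF x] by simp
    qed
    then show ?thesis by simp
  qed
  have \<gamma>_sum: "(\<Sum>i<N. \<gamma> i - \<beta> i) = (\<Sum>i<p. \<epsilon> i - c)"
  proof -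
    have "(\<Sum>i<N. (P *\<^sub>v e i) \<bullet>c e i) = (\<Sum>i<N. if i < p then complex_of_real (\<epsilon> i - c) else 0)"
    proof (intro sum.cong refl)
      fix i assume "i \<in> {..<N}"
      then have i: "i < N" by simp
      have "P *\<^sub>v e i = (if i < p then complex_of_real (\<epsilon> i - c) \<cdot>\<^sub>v e i else 0\<^sub>v N)"
        unfolding P_def using e p i by (intro dyad_sum_basis) auto
      then show "(P *\<^sub>v e i) \<bullet>c e i = (if i < p then complex_of_real (\<epsilon> i - c) else 0)"
        using cprod_smult_left[of "e i" N "e i"] orthonormal_cprod[OF e i i] orthonormal_carrier[OF e i]
        by (auto simp del: of_real_diff)
    qed
    also have "\<dots> = complex_of_real (\<Sum>i<p. \<epsilon> i - c)"
      unfolding of_real_sum using p by (intro sum.mono_neutral_cong_right) auto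
    finally have "(\<Sum>a<N. P $$ (a, a)) = complex_of_real (\<Sum>i<p. \<epsilon> i - c)"
      using trace_in_basis[OF e Pm] by simp
    moreover have "(\<Sum>a<N. (B + P) $$ (a, a)) = (\<Sum>a<N. B $$ (a, a)) + (\<Sum>a<N. P $$ (a, a))"
      using Bm Pm by (simp add: sum.distrib)
    ultimately have "complex_of_real (\<Sum>i<N. \<gamma> i) = complex_of_real ((\<Sum>i<N. \<beta> i) + (\<Sum>i<p. \<epsilon> i - c))"
      using eigensystem_trace[OF B] eigensystem_trace[OF C] by simp
    then have "(\<Sum>i<N. \<gamma> i) = (\<Sum>i<N. \<beta> i) + (\<Sum>i<p. \<epsilon> i - c)" using of_real_eq_iff by blast
    then show ?thesis by (simp add: sum_subtractf)
  qed
  have "(\<Sum>i\<in>J. \<alpha> i - \<beta> i) \<le> (\<Sum>i\<in>J. (\<gamma> i - \<beta> i) + c)"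
  proof (intro sum_mono)
    fix i assume "i \<in> J"
    then have "i < N" using J by auto
    from \<alpha>\<gamma>[OF this] show "\<alpha> i - \<beta> i \<le> (\<gamma> i - \<beta> i) + c" by simp
  qed
  also have "\<dots> = (\<Sum>i\<in>J. \<gamma> i - \<beta> i) + p * c" by (simp add: sum.distrib p_def)
  also have "(\<Sum>i\<in>J. \<gamma> i - \<beta> i) \<le> (\<Sum>i<N. \<gamma> i - \<beta> i)"
    using J \<beta>\<gamma> by (intro sum_mono2) auto
  also have "(\<Sum>i<N. \<gamma> i - \<beta> i) + p * c = (\<Sum>i<p. \<epsilon> i)"
    unfolding \<gamma>_sum by (simp add: sum_subtractf)
  finally show ?thesis by (simp add: p_def)
qed simp

section \<open>Symmetric gauge functions and weak majorization\<close>

lemma gauge_signed_permutation: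
  assumes "symmetric_gauge q \<Phi>" "\<sigma> permutes {..<q}"
    and "\<And>i. i < q \<Longrightarrow> \<bar>y i\<bar> = \<bar>x (\<sigma> i)\<bar>"
  shows "\<Phi> (vec q y) = \<Phi> (vec q x)"
proof -
  have sg: "\<Phi> z = \<Phi> (vec q (\<lambda>i. \<bar>z $ \<tau> i\<bar>))" if "z \<in> carrier_vec q" "\<tau> permutes {..<q}" for z \<tau>
    using assms(1) that unfolding symmetric_gauge_def by blast
  have "\<Phi> (vec q x) = \<Phi> (vec q (\<lambda>i. \<bar>vec q x $ \<sigma> i\<bar>))" by (rule sg) (use assms in auto)
  also have "vec q (\<lambda>i. \<bar>vec q x $ \<sigma> i\<bar>) = vec q (\<lambda>i. \<bar>vec q y $ id i\<bar>)"
    using assms(3) permutes_in_image[OF assms(2)] by (intro eq_vecI) auto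
  also have "\<Phi> \<dots> = \<Phi> (vec q y)" by (rule sg[symmetric, OF _ permutes_id]) simp
  finally show ?thesis ..
qed

lemma gauge_abs:
  assumes "symmetric_gauge q \<Phi>" "\<And>i. i < q \<Longrightarrow> \<bar>y i\<bar> = \<bar>x i\<bar>"
  shows "\<Phi> (vec q y) = \<Phi> (vec q x)"
  by (rule gauge_signed_permutation[OF assms(1) permutes_id]) (use assms(2) in auto)

text \<open>Strict convexity refers to the unit sphere; scaling carries it to spheres of other radii.\<close>

lemma gauge_convex_step:
  assumes sg: "symmetric_gauge q \<Phi>" and eq: "\<Phi> (vec q y) = \<Phi> (vec q x)" and \<theta>: "0 < \<theta>" "\<theta> < 1"
    and z: "\<And>i. i < q \<Longrightarrow> z i = (1 - \<theta>) * x i + \<theta> * y i"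
  shows "\<Phi> (vec q z) \<le> \<Phi> (vec q x)"
    and "strictly_convex_gauge q \<Phi> \<Longrightarrow> \<exists>i<q. x i \<noteq> y i \<Longrightarrow> \<Phi> (vec q z) < \<Phi> (vec q x)"
proof -
  have norm: "norm_on_Rn q \<Phi>" using sg unfolding symmetric_gauge_def by blast
  have pos: "0 \<le> \<Phi> u" and zero: "\<Phi> u = 0 \<longleftrightarrow> u = 0\<^sub>v q"
    and scale: "\<Phi> (c \<cdot>\<^sub>v u) = \<bar>c\<bar> * \<Phi> u" if "u \<in> carrier_vec q" for u c
    using norm that unfolding norm_on_Rn_def by blast+
  have tri: "\<Phi> (u + v) \<le> \<Phi> u + \<Phi> v" if "u \<in> carrier_vec q" "v \<in> carrier_vec q" for u v
    using norm that unfolding norm_on_Rn_def by blast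
  have zv: "vec q z = (1 - \<theta>) \<cdot>\<^sub>v vec q x + \<theta> \<cdot>\<^sub>v vec q y" using z by (intro eq_vecI) auto
  have "\<Phi> (vec q z) \<le> (1 - \<theta>) * \<Phi> (vec q x) + \<theta> * \<Phi> (vec q y)"
    unfolding zv using tri[of "(1 - \<theta>) \<cdot>\<^sub>v vec q x" "\<theta> \<cdot>\<^sub>v vec q y"] scale[of "vec q x" "1 - \<theta>"]
      scale[of "vec q y" \<theta>] \<theta> by simp
  then show "\<Phi> (vec q z) \<le> \<Phi> (vec q x)" using eq by (simp add: algebra_simps)
  assume sc: "strictly_convex_gauge q \<Phi>" and neq: "\<exists>i<q. x i \<noteq> y i"
  define c where "c = \<Phi> (vec q x)"
  have xy: "vec q x \<noteq> vec q y" using neq by (metis index_vec)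
  have "c \<noteq> 0" using zero[of "vec q x"] zero[of "vec q y"] xy eq unfolding c_def by auto
  then have c: "0 < c" using pos[of "vec q x"] unfolding c_def by simp
  define u v where "u = (1 / c) \<cdot>\<^sub>v vec q x" and "v = (1 / c) \<cdot>\<^sub>v vec q y"
  have uv: "u \<in> carrier_vec q" "v \<in> carrier_vec q" "\<Phi> u = 1" "\<Phi> v = 1"
    unfolding u_def v_def using c scale[of "vec q x" "1 / c"] scale[of "vec q y" "1 / c"] eq
    by (auto simp: c_def)
  have "u \<noteq> v"
  proof
    assume "u = v"
    then have "u $ i = v $ i" for i by simp
    then have "x i = y i" if "i < q" for i using that c by (metis (no_types, lifting) u_def v_def
        dim_vec index_smult_vec(1) index_vec mult_cancel_left not_less_iff_gr_or_eq zero_less_divide_1_iff)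
    then show False using neq by blast
  qed
  then have "\<Phi> ((1 - \<theta>) \<cdot>\<^sub>v u + (1 - (1 - \<theta>)) \<cdot>\<^sub>v v) < 1"
    using sc uv \<theta> unfolding strictly_convex_gauge_def by (metis diff_gt_0_iff_gt diff_less_eq less_add_same_cancel1)
  moreover have "vec q z = c \<cdot>\<^sub>v ((1 - \<theta>) \<cdot>\<^sub>v u + (1 - (1 - \<theta>)) \<cdot>\<^sub>v v)"
    unfolding u_def v_def using c by (intro eq_vecI) (auto simp: z field_simps)
  ultimately show "\<Phi> (vec q z) < \<Phi> (vec q x)"
    using scale[of "(1 - \<theta>) \<cdot>\<^sub>v u + (1 - (1 - \<theta>)) \<cdot>\<^sub>v v" c] uv c
    by (simp add: c_def[symmetric])
qed

text \<open>Induction on the number of coordinates in which \<open>x\<close> and \<open>y\<close> differ. As long as some \<open>x j < y j\<close>,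
  an earlier coordinate \<open>i\<close> has a surplus \<open>x i > y i\<close>, because partial sums of \<open>x\<close> dominate; moving the
  smaller of surplus and deficit from \<open>i\<close> to \<open>j\<close> is a convex combination of \<open>x\<close> with its transposition and
  settles one of the two coordinates. Once \<open>y \<le> x\<close> everywhere, lowering \<open>x i\<close> to \<open>y i\<close> is a convex
  combination of \<open>x\<close> with the vector in which the sign of \<open>x i\<close> is reversed. Since \<open>y j \<le> y i\<close>, a transfer
  is at most half of \<open>x i - x j\<close>, so that the convex combination is a proper one.\<close>

lemma gauge_weak_majorization_sorted:
  assumes sg: "symmetric_gauge q \<Phi>"
    and y: "\<And>i. i < q \<Longrightarrow> 0 \<le> y i" "\<And>i j. i \<le> j \<Longrightarrow> j < q \<Longrightarrow> y j \<le> y i"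
    and x: "\<And>i. i < q \<Longrightarrow> 0 \<le> x i"
    and maj: "\<And>p. p \<le> q \<Longrightarrow> (\<Sum>i<p. y i) \<le> (\<Sum>i<p. x i)"
  shows "\<Phi> (vec q y) \<le> \<Phi> (vec q x) \<and>
    (strictly_convex_gauge q \<Phi> \<longrightarrow> (\<exists>i<q. x i \<noteq> y i) \<longrightarrow> \<Phi> (vec q y) < \<Phi> (vec q x))"
  using x maj
proof (induction "card {i. i < q \<and> x i \<noteq> y i}" arbitrary: x rule: less_induct)
  case less
  have step: ?case
    if w: "\<Phi> (vec q w) = \<Phi> (vec q x)" and \<theta>: "0 < \<theta>" "\<theta> < 1" and ne: "\<exists>i<q. x i \<noteq> w i"
      and x': "\<And>i. i < q \<Longrightarrow> x' i = (1 - \<theta>) * x i + \<theta> * w i"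
      and keep: "\<And>i. i < q \<Longrightarrow> x i = y i \<Longrightarrow> x' i = y i" and k: "k < q" "x k \<noteq> y k" "x' k = y k"
      and nn: "\<And>i. i < q \<Longrightarrow> 0 \<le> x' i" and maj': "\<And>p. p \<le> q \<Longrightarrow> (\<Sum>i<p. y i) \<le> (\<Sum>i<p. x' i)"
    for w x' \<theta> k
  proof -
    have "{i. i < q \<and> x' i \<noteq> y i} \<subset> {i. i < q \<and> x i \<noteq> y i}" using keep k by blast
    then have "card {i. i < q \<and> x' i \<noteq> y i} < card {i. i < q \<and> x i \<noteq> y i}"
      by (intro psubset_card_mono) auto
    from less.hyps[OF this nn maj'] have "\<Phi> (vec q y) \<le> \<Phi> (vec q x')" by blast
    then show ?thesis
      using gauge_convex_step[OF sg w \<theta> x'] ne by fastforce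
  qed
  consider (eq) "\<forall>i<q. x i = y i" | (dom) i where "\<forall>j<q. y j \<le> x j" "i < q" "y i < x i"
    | (deficit) j where "j < q" "x j < y j" by (metis linorder_cases not_le)
  then show ?case
  proof cases
    case eq
    then have "vec q x = vec q y" by (intro eq_vecI) auto
    then show ?thesis using eq by auto
  next
    case (dom i)
    define x' where "x' = x(i := y i)"
    define w where "w = x(i := - x i)"
    \<comment> \<open>the solution of \<open>(1 - \<theta>) * x i - \<theta> * x i = y i\<close>\<close>
    define \<theta> where "\<theta> = (x i - y i) / (2 * x i)"
    have xi: "0 < x i" using dom y(1)[of i] by simp
    have yi: "0 \<le> y i" using dom y(1)[of i] by simp
    show ?thesis
    proof (rule step[of w \<theta> x' i])
      show "\<Phi> (vec q w) = \<Phi> (vec q x)" by (rule gauge_abs[OF sg]) (simp add: w_def)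
      show "0 < \<theta>" "\<theta> < 1" using dom xi yi by (auto simp: \<theta>_def field_simps)
      show "\<exists>i<q. x i \<noteq> w i" using dom xi by (intro exI[of _ i]) (simp add: w_def)
      show "x' k = (1 - \<theta>) * x k + \<theta> * w k" for k
        using xi by (simp add: x'_def w_def \<theta>_def field_simps)
      show "0 \<le> x' k" if "k < q" for k using less.prems(1)[OF that] yi by (simp add: x'_def)
      show "(\<Sum>i<p. y i) \<le> (\<Sum>i<p. x' i)" if "p \<le> q" for p
        using dom that by (intro sum_mono) (simp add: x'_def)
    qed (use dom in \<open>auto simp: x'_def\<close>)
  next
    case deficit
    define j where "j = (LEAST j. j < q \<and> x j < y j)"
    have j: "j < q" "x j < y j" unfolding j_def using LeastI[of "\<lambda>j. j < q \<and> x j < y j"] deficit by blast+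
    have before: "y k \<le> x k" if "k < j" for k
      using not_less_Least[of k "\<lambda>j. j < q \<and> x j < y j"] that j(1) unfolding j_def by force
    obtain i where i: "i < j" "y i < x i"
    proof -
      have "\<exists>i<j. y i < x i"
      proof (rule ccontr)
        assume "\<not> (\<exists>i<j. y i < x i)"
        then have "(\<Sum>i<j. x i) \<le> (\<Sum>i<j. y i)" by (intro sum_mono) (meson lessThan_iff not_less)
        then show False using less.prems(2)[of "Suc j"] j by simp
      qed
      then show ?thesis using that by blast
    qed
    have yij: "y j \<le> y i" "0 \<le> y i" using y i j by auto
    define \<delta> where "\<delta> = min (x i - y i) (y j - x j)"
    have \<delta>: "0 < \<delta>" "\<delta> \<le> x i - y i" "\<delta> \<le> y j - x j" using i j unfolding \<delta>_def by auto
    define x' where "x' k = x k - (if k = i then \<delta> else 0) + (if k = j then \<delta> else 0)" for k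
    define \<theta> where "\<theta> = \<delta> / (x i - x j)"
    define w where "w k = x (Transposition.transpose i j k)" for k
    have xij: "0 < x i - x j" "\<delta> < x i - x j" using i j yij \<delta> by auto
    have perm: "Transposition.transpose i j permutes {..<q}" using i j by (intro permutes_swap_id) auto
    have \<theta>x: "\<theta> * (x i - x j) = \<delta>" using xij by (simp add: \<theta>_def)
    show ?thesis
    proof (rule step[of w \<theta> x' "if x' i = y i then i else j"])
      show "\<Phi> (vec q w) = \<Phi> (vec q x)"
        by (rule gauge_signed_permutation[OF sg perm]) (simp add: w_def)
      show "0 < \<theta>" "\<theta> < 1" using \<delta> xij by (auto simp: \<theta>_def)
      show "\<exists>i<q. x i \<noteq> w i" using i j xij by (intro exI[of _ i]) (simp add: w_def)
      show "x' k = (1 - \<theta>) * x k + \<theta> * w k" for k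
        using \<theta>x i by (simp add: x'_def w_def Transposition.transpose_def algebra_simps)
      show "0 \<le> x' k" if "k < q" for k
        using less.prems(1)[OF that] yij \<delta> i j less.prems(1)[OF j(1)] by (auto simp: x'_def)
      show "(\<Sum>i<p. y i) \<le> (\<Sum>i<p. x' i)" if p: "p \<le> q" for p
      proof -
        have s: "(\<Sum>k<p. x' k) = (\<Sum>k<p. x k) - (if i < p then \<delta> else 0) + (if j < p then \<delta> else 0)"
          by (simp add: x'_def sum.distrib sum_subtractf)
        \<comment> \<open>Up to the first deficit \<open>j\<close> no term of \<open>x - y\<close> is negative, and the term \<open>i\<close> alone is at least \<open>\<delta>\<close>.\<close>
        have "\<delta> \<le> (\<Sum>k<p. x k) - (\<Sum>k<p. y k)" if "i < p" "\<not> j < p"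
        proof -
          have "x i - y i \<le> (\<Sum>k<p. x k - y k)"
            using that before by (intro member_le_sum) auto
          then show ?thesis using \<delta> by (simp add: sum_subtractf)
        qed
        then show ?thesis using less.prems(2)[OF p] \<delta>(1) i unfolding s by auto
      qed
      show "x' k = y k" if "k < q" "x k = y k" for k using that i j by (auto simp: x'_def)
      show "(if x' i = y i then i else j) < q" using i j by auto
      show "x (if x' i = y i then i else j) \<noteq> y (if x' i = y i then i else j)" using i j by auto
      show "x' (if x' i = y i then i else j) = y (if x' i = y i then i else j)"
        using i by (auto simp: x'_def \<delta>_def min_def)
    qed
  qed
qed

text \<open>For a strictly convex gauge, equality makes \<open>x\<close> a rearrangement of \<open>y\<close>; the equality of the
  sums of squares records this without naming the permutation.\<close>

lemma gauge_weak_majorization: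
  assumes sg: "symmetric_gauge q \<Phi>"
    and y: "\<And>i. i < q \<Longrightarrow> 0 \<le> y i" and x: "\<And>i. i < q \<Longrightarrow> 0 \<le> x i"
    and maj: "\<And>J. J \<subseteq> {..<q} \<Longrightarrow> (\<Sum>i\<in>J. y i) \<le> (\<Sum>i<card J. x i)"
  shows "\<Phi> (vec q y) \<le> \<Phi> (vec q x)"
    and "strictly_convex_gauge q \<Phi> \<Longrightarrow> \<Phi> (vec q x) \<le> \<Phi> (vec q y) \<Longrightarrow>
      (\<Sum>i<q. (x i)\<^sup>2) = (\<Sum>i<q. (y i)\<^sup>2)"
proof -
  obtain \<sigma> where \<sigma>: "\<sigma> permutes {..<q}" "\<And>i j. i \<le> j \<Longrightarrow> j < q \<Longrightarrow> y (\<sigma> j) \<le> y (\<sigma> i)"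
    using decreasing_rearrangement[of q y] by blast
  have \<sigma>q: "\<sigma> i < q" if "i < q" for i using permutes_in_image[OF \<sigma>(1)] that by auto
  have "(\<Sum>i<p. y (\<sigma> i)) \<le> (\<Sum>i<p. x i)" if "p \<le> q" for p
  proof -
    have inj: "inj_on \<sigma> {..<p}" using permutes_inj[OF \<sigma>(1)] by (rule inj_on_subset) simp
    have "(\<Sum>i\<in>\<sigma> ` {..<p}. y i) \<le> (\<Sum>i<card (\<sigma> ` {..<p}). x i)"
      using that \<sigma>q by (intro maj) auto
    then show ?thesis using inj by (simp add: sum.reindex card_image)
  qed
  from gauge_weak_majorization_sorted[of q \<Phi> "\<lambda>i. y (\<sigma> i)" x, OF sg y[OF \<sigma>q] \<sigma>(2) x this]
  have *: "\<Phi> (vec q (\<lambda>i. y (\<sigma> i))) \<le> \<Phi> (vec q x) \<and>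
    (strictly_convex_gauge q \<Phi> \<longrightarrow> (\<exists>i<q. x i \<noteq> y (\<sigma> i)) \<longrightarrow> \<Phi> (vec q (\<lambda>i. y (\<sigma> i))) < \<Phi> (vec q x))"
    by blast
  have y\<sigma>: "\<Phi> (vec q (\<lambda>i. y (\<sigma> i))) = \<Phi> (vec q y)"
    by (rule gauge_signed_permutation[OF sg \<sigma>(1)]) simp
  show "\<Phi> (vec q y) \<le> \<Phi> (vec q x)" using * y\<sigma> by simp
  assume "strictly_convex_gauge q \<Phi>" "\<Phi> (vec q x) \<le> \<Phi> (vec q y)"
  then have "\<forall>i<q. x i = y (\<sigma> i)" using * y\<sigma> by force
  then have "(\<Sum>i<q. (x i)\<^sup>2) = (\<Sum>i<q. (y (\<sigma> i))\<^sup>2)" by (intro sum.cong) auto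
  also have "\<dots> = (\<Sum>i<q. (y i)\<^sup>2)"
    using sum.permute[OF \<sigma>(1), of "\<lambda>i. (y i)\<^sup>2"] by (simp add: o_def)
  finally show "(\<Sum>i<q. (x i)\<^sup>2) = (\<Sum>i<q. (y i)\<^sup>2)" .
qed

lemma gauge_mono:
  assumes sg: "symmetric_gauge q \<Phi>" and yx: "\<And>i. i < q \<Longrightarrow> 0 \<le> y i \<and> y i \<le> x i"
  shows "\<Phi> (vec q y) \<le> \<Phi> (vec q x)"
    and "strictly_convex_gauge q \<Phi> \<Longrightarrow> \<exists>i<q. y i \<noteq> x i \<Longrightarrow> \<Phi> (vec q y) < \<Phi> (vec q x)"
proof -
  obtain \<sigma> where \<sigma>: "\<sigma> permutes {..<q}" "\<And>i j. i \<le> j \<Longrightarrow> j < q \<Longrightarrow> y (\<sigma> j) \<le> y (\<sigma> i)"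
    using decreasing_rearrangement[of q y] by blast
  have \<sigma>q: "\<sigma> i < q" if "i < q" for i using permutes_in_image[OF \<sigma>(1)] that by auto
  have *: "\<Phi> (vec q (\<lambda>i. y (\<sigma> i))) \<le> \<Phi> (vec q (\<lambda>i. x (\<sigma> i))) \<and>
    (strictly_convex_gauge q \<Phi> \<longrightarrow> (\<exists>i<q. x (\<sigma> i) \<noteq> y (\<sigma> i)) \<longrightarrow>
      \<Phi> (vec q (\<lambda>i. y (\<sigma> i))) < \<Phi> (vec q (\<lambda>i. x (\<sigma> i))))"
  proof (rule gauge_weak_majorization_sorted[OF sg])
    show "0 \<le> y (\<sigma> i)" "0 \<le> x (\<sigma> i)" if "i < q" for i using yx[OF \<sigma>q[OF that]] by auto
    show "(\<Sum>i<p. y (\<sigma> i)) \<le> (\<Sum>i<p. x (\<sigma> i))" if "p \<le> q" for p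
      using yx \<sigma>q that by (intro sum_mono) auto
  qed (rule \<sigma>(2))
  have p: "\<Phi> (vec q (\<lambda>i. z (\<sigma> i))) = \<Phi> (vec q z)" for z
    by (rule gauge_signed_permutation[OF sg \<sigma>(1)]) simp
  show "\<Phi> (vec q y) \<le> \<Phi> (vec q x)" using * unfolding p by simp
  assume sc: "strictly_convex_gauge q \<Phi>" and "\<exists>i<q. y i \<noteq> x i"
  then obtain i where "i < q" "y i \<noteq> x i" by blast
  then obtain k where "k < q" "\<sigma> k = i" using permutes_image[OF \<sigma>(1)] by (metis imageE lessThan_iff)
  then show "\<Phi> (vec q y) < \<Phi> (vec q x)" using * sc \<open>y i \<noteq> x i\<close> unfolding p by metis
qed

section \<open>Singular value decomposition\<close>

lemma orthonormal_length_le: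
  assumes v: "orthonormal N k v"
  shows "k \<le> N"
proof (rule ccontr)
  assume "\<not> k \<le> N"
  then have "N < k" by simp
  define w where "w i = vec k (\<lambda>j. cnj (v j $ i))" for i
  have wc: "w i \<in> carrier_vec k" for i unfolding w_def by simp
  obtain x where x: "x \<in> carrier_vec k" "x \<noteq> 0\<^sub>v k" "\<And>i. i < N \<Longrightarrow> x \<bullet>c w i = 0"
    using underdetermined_orthogonal[of N k w, OF \<open>N < k\<close> wc] by blast
  have "lin_comb N k (\<lambda>j. x $ j) v = 0\<^sub>v N"
  proof (rule eq_vecI)
    fix i assume "i < dim_vec (0\<^sub>v N)"
    then have i: "i < N" by simp
    then show "lin_comb N k (\<lambda>j. x $ j) v $ i = 0\<^sub>v N $ i"
      using x(3)[OF i] cprod_sum[OF wc, of x i] by (simp add: lin_comb_def w_def)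
  qed (simp add: lin_comb_def)
  moreover have "lin_comb N k (\<lambda>j. x $ j) v \<bullet>c v l = x $ l" if "l < k" for l
  proof -
    have "lin_comb N k (\<lambda>j. x $ j) v \<bullet>c v l = (\<Sum>j<k. x $ j * (v j \<bullet>c v l))"
      using v that by (intro lin_comb_cprod) auto
    also have "\<dots> = (\<Sum>j<k. if j = l then x $ j else 0)"
      using that by (intro sum.cong refl) (simp add: orthonormal_cprod[OF v])
    finally show ?thesis using that by simp
  qed
  ultimately have "x $ l = 0" if "l < k" for l
    using that cprod_zero_left[OF orthonormal_carrier[OF v that]] by simp
  then have "x = 0\<^sub>v k" using x(1) by (intro eq_vecI) auto
  then show False using x(2) by simp
qed

text \<open>A singular value decomposition in which the values may be unordered and negative. The difference of \<open>F\<close>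
  and a truncated polar factor has this form with respect to the bases of \<open>F\<close>.\<close>

definition singular_system ::
  "nat \<Rightarrow> nat \<Rightarrow> complex mat \<Rightarrow> (nat \<Rightarrow> real) \<Rightarrow> (nat \<Rightarrow> complex vec) \<Rightarrow> (nat \<Rightarrow> complex vec) \<Rightarrow> bool" where
  "singular_system m n F t u v \<longleftrightarrow> F \<in> carrier_mat m n \<and> orthonormal m m u \<and> orthonormal n n v \<and>
     (\<forall>i<n. F *\<^sub>v v i = (if i < m then complex_of_real (t i) \<cdot>\<^sub>v u i else 0\<^sub>v m))"

definition svd ::
  "nat \<Rightarrow> nat \<Rightarrow> complex mat \<Rightarrow> (nat \<Rightarrow> real) \<Rightarrow> (nat \<Rightarrow> complex vec) \<Rightarrow> (nat \<Rightarrow> complex vec) \<Rightarrow> bool" where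
  "svd m n F s u v \<longleftrightarrow> singular_system m n F s u v \<and> (\<forall>i<min m n. 0 \<le> s i) \<and>
     (\<forall>i j. i \<le> j \<longrightarrow> j < min m n \<longrightarrow> s j \<le> s i)"

lemma singular_systemD:
  assumes "singular_system m n F t u v"
  shows "F \<in> carrier_mat m n" "orthonormal m m u" "orthonormal n n v"
    and "i < min m n \<Longrightarrow> F *\<^sub>v v i = complex_of_real (t i) \<cdot>\<^sub>v u i"
    and "m \<le> i \<Longrightarrow> i < n \<Longrightarrow> F *\<^sub>v v i = 0\<^sub>v m"
  using assms unfolding singular_system_def by auto

lemma svdD:
  assumes "svd m n F s u v"
  shows "singular_system m n F s u v" "i < min m n \<Longrightarrow> 0 \<le> s i"
    and "i \<le> j \<Longrightarrow> j < min m n \<Longrightarrow> s j \<le> s i"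
  using assms unfolding svd_def by auto

lemma singular_system_adjoint:
  assumes F: "singular_system m n F t u v"
  shows "singular_system n m (mat_adjoint F) t v u"
proof -
  note D = singular_systemD[OF F]
  have "mat_adjoint F *\<^sub>v u i = (if i < n then complex_of_real (t i) \<cdot>\<^sub>v v i else 0\<^sub>v n)" (is "_ = ?r") if i: "i < m" for i
  proof (rule vec_eq_by_basis[OF D(3)])
    have ui: "u i \<in> carrier_vec m" using D(2) i by simp
    show Fu: "mat_adjoint F *\<^sub>v u i \<in> carrier_vec n" using D(1) ui by (meson mat_adjoint_carrier mult_mat_vec_carrier)
    show "?r \<in> carrier_vec n" using D(3) by simp
    fix j assume j: "j < n"
    have vj: "v j \<in> carrier_vec n" using D(3) j by simp
    have "(mat_adjoint F *\<^sub>v u i) \<bullet>c v j = cnj ((F *\<^sub>v v j) \<bullet>c u i)"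
      using cprod_commute[OF Fu vj] cprod_adjoint[OF D(1) vj ui] by simp
    also have "\<dots> = (if i = j then complex_of_real (t i) else 0)"
    proof (cases "j < m")
      case True
      then show ?thesis
        using D(4)[of j] j i cprod_smult_left[of "u j" m "u i"] D(2) orthonormal_cprod[OF D(2), of j i] by simp
    next
      case False
      then show ?thesis using D(5)[of j] j i ui by simp
    qed
    also have "\<dots> = ?r \<bullet>c v j"
      using cprod_smult_left[of "v i" n "v j"] D(3) vj j orthonormal_cprod[OF D(3), of i j] orthonormal_cprod[OF D(3) j j]
      by auto
    finally show "(mat_adjoint F *\<^sub>v u i) \<bullet>c v j = ?r \<bullet>c v j" .
  qed
  then show ?thesis using D(1-3) unfolding singular_system_def by simp
qed

lemma decreasing_support:
  fixes s :: "nat \<Rightarrow> real"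
  assumes "\<And>i j. i \<le> j \<Longrightarrow> j < q \<Longrightarrow> s j \<le> s i"
  obtains k where "k \<le> q" "\<And>i. i < q \<Longrightarrow> 0 < s i \<longleftrightarrow> i < k"
proof (cases "\<exists>i<q. \<not> 0 < s i")
  case True
  define k where "k = (LEAST i. i < q \<and> \<not> 0 < s i)"
  have k: "k < q" "\<not> 0 < s k" unfolding k_def using LeastI_ex[of "\<lambda>i. i < q \<and> \<not> 0 < s i"] True by auto
  have "0 < s i" if "i < k" for i
    using not_less_Least[of i "\<lambda>i. i < q \<and> \<not> 0 < s i"] that k(1) unfolding k_def by auto
  moreover have "\<not> 0 < s i" if "\<not> i < k" "i < q" for i using assms[of k i] that k by auto
  ultimately show ?thesis using that[of k] k by auto
qed (use that[of q] in auto)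

text \<open>The right singular vectors are eigenvectors of \<open>F\<^sup>* F\<close>. Where the eigenvalue \<open>l i\<close> is positive, the vectors
  \<open>F v\<^sub>i / \<surd>(l i)\<close> are orthonormal; the other left singular vectors come from an arbitrary extension to a basis.\<close>

theorem svd_exists:
  assumes F: "F \<in> carrier_mat m n"
  obtains s u v where "svd m n F s u v"
proof -
  have FF: "mat_adjoint F * F \<in> carrier_mat n n" using F mat_adjoint_carrier by (metis mult_carrier_mat)
  have "mat_adjoint (mat_adjoint F * F) = mat_adjoint F * F"
    using F by (intro eq_matI) (auto simp: scalar_prod_def mult.commute intro!: sum.cong)
  then obtain l v where lv: "eigensystem n (mat_adjoint F * F) l v" using spectral_theorem[OF FF] by blast
  have v: "orthonormal n n v" using lv unfolding eigensystem_def by blast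
  have vc: "v i \<in> carrier_vec n" if "i < n" for i using v that by simp
  have Fv: "F *\<^sub>v v i \<in> carrier_vec m" if "i < n" for i using F vc[OF that] by simp
  have gram: "(F *\<^sub>v v i) \<bullet>c (F *\<^sub>v v j) = (if i = j then complex_of_real (l i) else 0)" if "i < n" "j < n" for i j
  proof -
    have "(F *\<^sub>v v i) \<bullet>c (F *\<^sub>v v j) = v i \<bullet>c ((mat_adjoint F * F) *\<^sub>v v j)"
      using cprod_adjoint[OF F vc[OF that(1)] Fv[OF that(2)]]
        assoc_mult_mat_vec[OF mat_adjoint_carrier[OF F] F vc[OF that(2)]] by simp
    also have "\<dots> = complex_of_real (l j) * (v i \<bullet>c v j)"
      using lv that(2) cprod_smult_right[OF vc[OF that(1)] vc[OF that(2)]] unfolding eigensystem_def by simp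
    finally show ?thesis using orthonormal_cprod[OF v that] by auto
  qed
  have norm: "(l2_norm (F *\<^sub>v v i))\<^sup>2 = l i" if "i < n" for i
    using gram[OF that that] unfolding cprod_self by (simp flip: of_real_power)
  have l0: "0 \<le> l i" if "i < n" for i using norm[OF that] by (metis zero_le_power2)
  have ld: "l j \<le> l i" if "i \<le> j" "j < n" for i j using lv that unfolding eigensystem_def by blast
  obtain k where k: "k \<le> n" "\<And>i. i < n \<Longrightarrow> 0 < l i \<longleftrightarrow> i < k"
    using decreasing_support[of n l, OF ld] by blast
  define s where "s i = sqrt (l i)" for i
  define w where "w i = complex_of_real (1 / s i) \<cdot>\<^sub>v (F *\<^sub>v v i)" for i
  have w: "orthonormal m k w"
    unfolding orthonormal_def
  proof (intro conjI allI impI)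
    fix i assume i: "i < k"
    then have i': "i < n" using k by simp
    show "w i \<in> carrier_vec m" using Fv[OF i'] unfolding w_def by simp
    fix j assume j: "j < k"
    then have j': "j < n" using k by simp
    have s: "0 < s i" "s i * s i = l i" using k(2)[OF i'] i unfolding s_def by auto
    have s2: "complex_of_real (l i) = complex_of_real (s i) * complex_of_real (s i)"
      using s(2) by (metis of_real_mult)
    have "w i \<bullet>c w j = complex_of_real (1 / s i) * (complex_of_real (1 / s j) * (if i = j then complex_of_real (l i) else 0))"
      unfolding w_def using Fv[OF i'] Fv[OF j'] gram[OF i' j']
        cprod_smult_left[OF Fv[OF i'], of "complex_of_real (1 / s j) \<cdot>\<^sub>v (F *\<^sub>v v j)" "complex_of_real (1 / s i)"]
        cprod_smult_right[OF Fv[OF i'] Fv[OF j'], of "complex_of_real (1 / s j)"] by simp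
    also have "\<dots> = (if i = j then 1 else 0)"
      using s(1) s2 by (cases "i = j") auto
    finally show "w i \<bullet>c w j = (if i = j then 1 else 0)" .
  qed
  have "k \<le> m" by (rule orthonormal_length_le[OF w])
  then obtain u where u: "orthonormal m m u" "\<And>i. i < k \<Longrightarrow> u i = w i"
    using orthonormal_extend[OF w] by blast
  have Fv_u: "F *\<^sub>v v i = complex_of_real (s i) \<cdot>\<^sub>v u i" if "i < k" for i
  proof -
    have i: "i < n" using that k by simp
    have "s i \<noteq> 0" using k(2)[OF i] that unfolding s_def by simp
    then show ?thesis unfolding u(2)[OF that] w_def by (simp add: smult_smult_assoc)
  qed
  have Fv_0: "F *\<^sub>v v i = 0\<^sub>v m" "s i = 0" if "\<not> i < k" "i < n" for i
  proof -
    have "l i = 0" using k(2)[OF that(2)] that l0[OF that(2)] by auto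
    then show "F *\<^sub>v v i = 0\<^sub>v m" "s i = 0"
      using norm[OF that(2)] l2_norm_eq_0_iff[OF Fv[OF that(2)]] by (auto simp: s_def)
  qed
  have "F *\<^sub>v v i = (if i < m then complex_of_real (s i) \<cdot>\<^sub>v u i else 0\<^sub>v m)" if "i < n" for i
  proof (cases "i < k")
    case True
    then show ?thesis using Fv_u \<open>k \<le> m\<close> by simp
  next
    case False
    have "0 \<cdot>\<^sub>v u i = 0\<^sub>v m" if "i < m" using u(1) that by (intro eq_vecI) auto
    then show ?thesis using Fv_0[OF False that] by auto
  qed
  then have "svd m n F s u v"
    using F u(1) v lv l0 unfolding svd_def singular_system_def eigensystem_def s_def by auto
  then show ?thesis using that by blast
qed

lemma smult_zero_vec: "x \<in> carrier_vec m \<Longrightarrow> 0 \<cdot>\<^sub>v x = (0\<^sub>v m :: complex vec)"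
  by (intro eq_vecI) auto

text \<open>With \<open>y = A x - c x\<close>, the hypothesis reads \<open>A y = - c y\<close>. A positive semidefinite matrix has no negative
  eigenvalue, so \<open>y = 0\<close> if \<open>c > 0\<close>; for \<open>c = 0\<close>, \<open>\<parallel>A x\<parallel>\<^sup>2 = \<langle>A (A x), x\<rangle> = 0\<close>. This is the
  uniqueness of the positive semidefinite square root.\<close>

lemma psd_sqrt_eigenvector:
  assumes A: "A \<in> carrier_mat n n" "positive_semidefinite A" and x: "x \<in> carrier_vec n" and "0 \<le> c"
    and AA: "A *\<^sub>v (A *\<^sub>v x) = complex_of_real (c\<^sup>2) \<cdot>\<^sub>v x"
  shows "A *\<^sub>v x = complex_of_real c \<cdot>\<^sub>v x"
proof -
  have herm: "mat_adjoint A = A" and psd: "\<And>y. y \<in> carrier_vec n \<Longrightarrow> 0 \<le> Re ((A *\<^sub>v y) \<bullet>c y)"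
    using A unfolding positive_semidefinite_def by auto
  have Ax: "A *\<^sub>v x \<in> carrier_vec n" using A x by simp
  define y where "y = A *\<^sub>v x - complex_of_real c \<cdot>\<^sub>v x"
  have y: "y \<in> carrier_vec n" unfolding y_def using Ax x by simp
  have "A *\<^sub>v y = complex_of_real (- c) \<cdot>\<^sub>v y"
  proof -
    have "A *\<^sub>v y = A *\<^sub>v (A *\<^sub>v x) - complex_of_real c \<cdot>\<^sub>v (A *\<^sub>v x)"
      unfolding y_def using mult_minus_distrib_mat_vec[OF A(1) Ax] mult_mat_vec[OF A(1) x] x by simp
    also have "\<dots> = complex_of_real (- c) \<cdot>\<^sub>v y"
      unfolding AA y_def using A(1) x Ax
      by (intro eq_vecI) (auto simp: power2_eq_square algebra_simps simp del: index_mult_mat_vec)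
    finally show ?thesis .
  qed
  then have "(A *\<^sub>v y) \<bullet>c y = complex_of_real (- c * (l2_norm y)\<^sup>2)"
    using cprod_smult_left[OF y y] cprod_self[of y] by simp
  then have neg: "c * (l2_norm y)\<^sup>2 \<le> 0" using psd[OF y] by simp
  have "y = 0\<^sub>v n"
  proof (cases "c = 0")
    case True
    have "(A *\<^sub>v x) \<bullet>c (A *\<^sub>v x) = (A *\<^sub>v (A *\<^sub>v x)) \<bullet>c x"
      using cprod_adjoint[OF A(1) Ax x] herm by simp
    also have "\<dots> = 0" using AA True x by (simp add: smult_zero_vec[OF x])
    finally have "A *\<^sub>v x = 0\<^sub>v n" using conjugate_square_eq_0_vec[OF Ax] by simp
    then show ?thesis unfolding y_def using True x by (simp add: smult_zero_vec[OF x])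
  next
    case False
    then have "(l2_norm y)\<^sup>2 \<le> 0" using neg \<open>0 \<le> c\<close> by (simp add: mult_le_0_iff)
    then show ?thesis using l2_norm_eq_0_iff[OF y] by simp
  qed
  then have "(A *\<^sub>v x) $ i - complex_of_real c * x $ i = 0" if "i < n" for i
    using that A x Ax unfolding y_def by (metis carrier_vecD dim_vec index_minus_vec(1) index_smult_vec(1,2) index_zero_vec(1))
  then show ?thesis using A(1) x by (intro eq_vecI) auto
qed

lemma mat_abs_svd:
  assumes svd: "svd m n F s u v"
  shows "mat_abs F = dyad_sum n n n (\<lambda>i. if i < m then s i else 0) v v"
proof -
  define t where "t i = (if i < m then s i else 0)" for i
  note D = singular_systemD[OF svdD(1)[OF svd]]
  note D' = singular_systemD[OF singular_system_adjoint[OF svdD(1)[OF svd]]]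
  have t0: "0 \<le> t i" if "i < n" for i using svdD(2)[OF svd, of i] that unfolding t_def by simp
  have vc: "v i \<in> carrier_vec n" if "i < n" for i using D(3) that by simp
  define A where "A = dyad_sum n n n t v v"
  have A: "A \<in> carrier_mat n n" unfolding A_def by simp
  have herm: "mat_adjoint A = A" unfolding A_def by (rule dyad_sum_adjoint)
  have Av: "A *\<^sub>v v i = complex_of_real (t i) \<cdot>\<^sub>v v i" if "i < n" for i
    unfolding A_def using dyad_sum_basis[OF D(3), of n v n i t] vc that by simp
  have FFv: "(mat_adjoint F * F) *\<^sub>v v i = complex_of_real ((t i)\<^sup>2) \<cdot>\<^sub>v v i" if i: "i < n" for i
  proof -
    have *: "(mat_adjoint F * F) *\<^sub>v v i = mat_adjoint F *\<^sub>v (F *\<^sub>v v i)"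
      using assoc_mult_mat_vec[OF mat_adjoint_carrier[OF D(1)] D(1) vc[OF i]] .
    show ?thesis
    proof (cases "i < m")
      case True
      have "u i \<in> carrier_vec m" using D(2) True by simp
      then have "mat_adjoint F *\<^sub>v (complex_of_real (s i) \<cdot>\<^sub>v u i) = complex_of_real (s i) \<cdot>\<^sub>v (complex_of_real (s i) \<cdot>\<^sub>v v i)"
        using mult_mat_vec[OF mat_adjoint_carrier[OF D(1)]] D'(4)[of i] True i by simp
      then show ?thesis using * D(4)[of i] True i
        by (simp add: t_def smult_smult_assoc power2_eq_square)
    next
      case False
      have "mat_adjoint F *\<^sub>v 0\<^sub>v m = 0\<^sub>v n"
        using D(1) by (intro eq_vecI) auto
      then show ?thesis using * D(5)[of i] False i smult_zero_vec[OF vc[OF i]] by (simp add: t_def)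
    qed
  qed
  have FF: "mat_adjoint F * F \<in> carrier_mat n n" using D(1) mat_adjoint_carrier by (metis mult_carrier_mat)
  have "A * A = mat_adjoint F * F"
  proof (rule mat_eq_by_basis[OF D(3) _ FF])
    show "A * A \<in> carrier_mat n n" using A by simp
    fix i assume i: "i < n"
    have "(A * A) *\<^sub>v v i = A *\<^sub>v (A *\<^sub>v v i)" using assoc_mult_mat_vec[OF A A vc[OF i]] .
    also have "\<dots> = complex_of_real (t i) \<cdot>\<^sub>v (complex_of_real (t i) \<cdot>\<^sub>v v i)"
      using Av[OF i] mult_mat_vec[OF A vc[OF i]] by simp
    finally show "(A * A) *\<^sub>v v i = (mat_adjoint F * F) *\<^sub>v v i"
      using FFv[OF i] by (simp add: smult_smult_assoc power2_eq_square)
  qed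
  moreover have "positive_semidefinite A"
    unfolding positive_semidefinite_def
  proof (intro conjI ballI)
    show "square_mat A" using A by simp
    fix x :: "complex vec" assume "x \<in> carrier_vec (dim_row A)"
    then have x: "x \<in> carrier_vec n" using A by simp
    have "Re ((A *\<^sub>v x) \<bullet>c x) = (\<Sum>i<n. t i * (cmod (x \<bullet>c v i))\<^sup>2)"
      by (rule quadratic_form_in_eigenbasis[OF D(3) x A herm Av])
    moreover have "0 \<le> (\<Sum>i<n. t i * (cmod (x \<bullet>c v i))\<^sup>2)" using t0 by (intro sum_nonneg) auto
    ultimately show "0 \<le> Re ((A *\<^sub>v x) \<bullet>c x)" by simp
  qed (rule herm)
  moreover have "B = A" if B: "B \<in> carrier_mat n n" "positive_semidefinite B" "B * B = mat_adjoint F * F" for B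
  proof (rule mat_eq_by_basis[OF D(3) B(1) A])
    fix i assume i: "i < n"
    have "B *\<^sub>v (B *\<^sub>v v i) = complex_of_real ((t i)\<^sup>2) \<cdot>\<^sub>v v i"
      using assoc_mult_mat_vec[OF B(1) B(1) vc[OF i]] FFv[OF i] B(3) by simp
    then show "B *\<^sub>v v i = A *\<^sub>v v i"
      using psd_sqrt_eigenvector[OF B(1,2) vc[OF i] t0[OF i]] Av[OF i] by simp
  qed
  moreover have n: "dim_col F = n" using D(1) by simp
  ultimately have "mat_abs F = A"
    unfolding mat_abs_def n using A by (intro the_equality) blast+
  then show ?thesis unfolding A_def t_def .
qed

lemma char_poly_eigenbasis:
  assumes v: "orthonormal n n v" and A: "A \<in> carrier_mat n n"
    and eig: "\<And>i. i < n \<Longrightarrow> A *\<^sub>v v i = complex_of_real (t i) \<cdot>\<^sub>v v i"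
  shows "char_poly A = (\<Prod>a\<leftarrow>map (\<lambda>i. complex_of_real (t i)) [0..<n]. [:- a, 1:])"
proof -
  define V where "V = mat n n (\<lambda>(a, i). v i $ a)"
  define D where "D = mat n n (\<lambda>(i, j). if i = j then complex_of_real (t i) else 0)"
  have V: "V \<in> carrier_mat n n" and D: "D \<in> carrier_mat n n" unfolding V_def D_def by auto
  have Va: "mat_adjoint V \<in> carrier_mat n n" using V by simp
  have VV: "mat_adjoint V * V = 1\<^sub>m n" and VV': "V * mat_adjoint V = 1\<^sub>m n"
    unfolding V_def by (rule orthonormal_unitary[OF v])+
  have col: "col V i = v i" if "i < n" for i using v that unfolding V_def by (intro eq_vecI) auto
  have "A * V = V * D"
  proof (rule eq_matI)
    fix a i assume "a < dim_row (V * D)" "i < dim_col (V * D)"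
    then have ai: "a < n" "i < n" using V D by auto
    have "(A * V) $$ (a, i) = (A *\<^sub>v v i) $ a" using A V ai col by simp
    also have "\<dots> = complex_of_real (t i) * v i $ a" using eig[OF ai(2)] v ai by simp
    also have "\<dots> = (V * D) $$ (a, i)"
      using V D ai by (simp add: scalar_prod_def V_def D_def if_distrib[of "(*) _"] mult.commute cong: if_cong)
    finally show "(A * V) $$ (a, i) = (V * D) $$ (a, i)" .
  qed (use A V D in auto)
  then have "A = V * D * mat_adjoint V"
    using assoc_mult_mat[OF A V Va] VV' A by simp
  then have "similar_mat_wit A D V (mat_adjoint V)"
    by (rule similar_mat_witI[OF VV' VV _ A D V Va])
  then have "char_poly A = char_poly D" using char_poly_similar unfolding similar_mat_def by blast
  also have "\<dots> = (\<Prod>a\<leftarrow>diag_mat D. [:- a, 1:])"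
    by (rule char_poly_upper_triangular[OF D]) (auto simp: D_def)
  also have "diag_mat D = map (\<lambda>i. complex_of_real (t i)) [0..<n]"
    unfolding diag_mat_def D_def by (auto intro!: map_cong)
  finally show ?thesis .
qed

lemma proots_linear_factors: "proots (\<Prod>a\<leftarrow>as. [:- a, 1:]) = mset (as :: complex list)"
proof (induction as)
  case (Cons a as)
  have "(\<Prod>a\<leftarrow>as. [:- a, 1:]) \<noteq> (0 :: complex poly)" by (auto simp: prod_list_zero_iff)
  then show ?case using Cons by (simp add: proots_mult del: mult_pCons_left)
qed simp

text \<open>The values of any decreasing singular value decomposition are the singular values defined through the
  characteristic polynomial of \<open>\<bar>F\<bar>\<close>; for \<open>m < n\<close> the latter has \<open>n - m\<close> further zero roots, which
  stand at the end of the list.\<close>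

theorem sing_val_svd:
  assumes svd: "svd m n F s u v" and "i < min m n"
  shows "sing_val F (i + 1) = s i"
proof -
  define t where "t i = (if i < m then s i else 0)" for i
  note D = singular_systemD[OF svdD(1)[OF svd]]
  define A where "A = dyad_sum n n n t v v"
  have A: "A \<in> carrier_mat n n" unfolding A_def by simp
  have abs: "mat_abs F = A" using mat_abs_svd[OF svd] unfolding A_def t_def .
  have Av: "A *\<^sub>v v i = complex_of_real (t i) \<cdot>\<^sub>v v i" if "i < n" for i
    unfolding A_def using dyad_sum_basis[OF D(3), of n v n i t] D(3) that by simp
  have cp: "char_poly A = (\<Prod>a\<leftarrow>map (\<lambda>i. complex_of_real (t i)) [0..<n]. [:- a, 1:])"
    by (rule char_poly_eigenbasis[OF D(3) A Av])
  have "image_mset Re (proots (char_poly (mat_abs F))) = mset (map t [0..<n])"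
    unfolding abs cp proots_linear_factors by (simp add: multiset.map_comp o_def)
  moreover have "sort (map t [0..<n]) = rev (map t [0..<n])"
  proof (rule properties_for_sort)
    have "t j \<le> t i" if "i \<le> j" "j < n" for i j
      using svdD(2,3)[OF svd] that unfolding t_def by auto
    then show "sorted (rev (map t [0..<n]))"
      by (auto simp: sorted_iff_nth_mono rev_nth intro!: \<open>\<And>i j. i \<le> j \<Longrightarrow> j < n \<Longrightarrow> t j \<le> t i\<close>)
  qed simp
  ultimately have "abs_eigenvalues F = map t [0..<n]"
    unfolding abs_eigenvalues_def by (simp only: sorted_list_of_multiset_mset rev_rev_ident)
  then show ?thesis using assms(2) unfolding sing_val_def by (simp add: t_def)
qed

lemma ui_norm_svd:
  assumes "svd m n F s u v"
  shows "ui_norm \<Phi> F = \<Phi> (vec (min m n) s)"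
proof -
  have "F \<in> carrier_mat m n" using singular_systemD[OF svdD(1)[OF assms]] by blast
  then have "ui_norm \<Phi> F = \<Phi> (vec (min m n) (\<lambda>i. sing_val F (i + 1)))" unfolding ui_norm_def by simp
  also have "vec (min m n) (\<lambda>i. sing_val F (i + 1)) = vec (min m n) s"
    using sing_val_svd[OF assms] by (intro eq_vecI) auto
  finally show ?thesis .
qed

section \<open>The Mirsky inequality\<close>

lemma append_vec_cprod:
  fixes x x' y y' :: "complex vec"
  assumes "x \<in> carrier_vec m" "x' \<in> carrier_vec m" "y \<in> carrier_vec n" "y' \<in> carrier_vec n"
  shows "(x @\<^sub>v y) \<bullet>c (x' @\<^sub>v y') = x \<bullet>c x' + y \<bullet>c y'"
proof -
  have "conjugate (x' @\<^sub>v y') = conjugate x' @\<^sub>v conjugate y'"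
    by (intro eq_vecI) auto
  then show ?thesis using assms scalar_prod_append[of x m y n "conjugate x'" "conjugate y'"] by simp
qed

text \<open>The dilation is Hermitian and additive in \<open>F\<close>, so that inequalities between eigenvalues of
  Hermitian matrices apply to singular values of rectangular ones.\<close>

definition dilation :: "nat \<Rightarrow> nat \<Rightarrow> complex mat \<Rightarrow> complex mat" where
  "dilation m n F = four_block_mat (0\<^sub>m m m) F (mat_adjoint F) (0\<^sub>m n n)"

lemma dilation_carrier [simp]: "F \<in> carrier_mat m n \<Longrightarrow> dilation m n F \<in> carrier_mat (m + n) (m + n)"
  unfolding dilation_def by (intro four_block_carrier_mat) auto

lemma dilation_adjoint:
  assumes F: "F \<in> carrier_mat m n"
  shows "mat_adjoint (dilation m n F) = dilation m n F"
proof (rule eq_matI)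
  fix i j assume "i < dim_row (dilation m n F)" "j < dim_col (dilation m n F)"
  then have ij: "i < m + n" "j < m + n" using dilation_carrier[OF F] by auto
  have "dim_row F = m" "dim_col F = n" using F by auto
  then show "mat_adjoint (dilation m n F) $$ (i, j) = dilation m n F $$ (i, j)"
    using ij by (simp add: dilation_def)
qed (use dilation_carrier[OF F] in simp_all)

lemma dilation_diff:
  assumes A: "A \<in> carrier_mat m n" and B: "B \<in> carrier_mat m n"
  shows "dilation m n (A - B) = dilation m n A - dilation m n B"
proof (rule eq_matI)
  fix i j assume "i < dim_row (dilation m n A - dilation m n B)" "j < dim_col (dilation m n A - dilation m n B)"
  then have ij: "i < m + n" "j < m + n" using dilation_carrier[OF B] by auto
  have "dim_row A = m" "dim_col A = n" "dim_row B = m" "dim_col B = n" using A B by auto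
  then show "dilation m n (A - B) $$ (i, j) = (dilation m n A - dilation m n B) $$ (i, j)"
    using ij by (simp add: dilation_def)
qed (use B in \<open>simp_all add: dilation_def\<close>)

lemma dilation_mult:
  assumes F: "F \<in> carrier_mat m n" and x: "x \<in> carrier_vec m" and y: "y \<in> carrier_vec n"
  shows "dilation m n F *\<^sub>v (x @\<^sub>v y) = (F *\<^sub>v y) @\<^sub>v (mat_adjoint F *\<^sub>v x)"
proof -
  have "dilation m n F *\<^sub>v (x @\<^sub>v y) =
      (0\<^sub>m m m *\<^sub>v x + F *\<^sub>v y) @\<^sub>v (mat_adjoint F *\<^sub>v x + 0\<^sub>m n n *\<^sub>v y)"
    unfolding dilation_def using F x y mat_adjoint_carrier[OF F] by (intro four_block_mat_mult_vec) auto
  also have "0\<^sub>m m m *\<^sub>v x + F *\<^sub>v y = F *\<^sub>v y" using F x y by (intro eq_vecI) auto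
  also have "mat_adjoint F *\<^sub>v x + 0\<^sub>m n n *\<^sub>v y = mat_adjoint F *\<^sub>v x" using F x y by (intro eq_vecI) auto
  finally show ?thesis .
qed

text \<open>The eigenvalues of the dilation in decreasing order: the singular values, then \<open>\<bar>m - n\<bar>\<close> zeros, then the
  negated singular values in reverse, which places \<open>- s i\<close> at the mirror index \<open>m + n - 1 - i\<close>.\<close>

definition dilation_value :: "nat \<Rightarrow> nat \<Rightarrow> (nat \<Rightarrow> real) \<Rightarrow> nat \<Rightarrow> real" where
  "dilation_value m n s k =
     (if k < min m n then s k else if k < max m n then 0 else - s (m + n - 1 - k))"

text \<open>To \<open>\<plusminus>s i\<close> belong the vectors \<open>(u i, \<plusminus>v i) / \<surd>2\<close>. For \<open>i\<close> between \<open>min m n\<close> and \<open>max m n\<close> exactly one of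
  \<open>u i\<close> and \<open>v i\<close> exists, and it is padded by zero.\<close>

definition dilation_vector ::
  "nat \<Rightarrow> nat \<Rightarrow> (nat \<Rightarrow> complex vec) \<Rightarrow> (nat \<Rightarrow> complex vec) \<Rightarrow> nat \<Rightarrow> complex vec" where
  "dilation_vector m n u v k =
     (let i = (if k < max m n then k else m + n - 1 - k);
          a = (if min m n \<le> k \<and> k < max m n then 1 else 1 / sqrt 2);
          b = (if k < max m n then a else - a)
      in (complex_of_real a \<cdot>\<^sub>v (if i < m then u i else 0\<^sub>v m)) @\<^sub>v
         (complex_of_real b \<cdot>\<^sub>v (if i < n then v i else 0\<^sub>v n)))"

lemma dilation_eigensystem:
  assumes svd: "svd m n F s u v"
  shows "eigensystem (m + n) (dilation m n F) (dilation_value m n s) (dilation_vector m n u v)"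
proof -
  note D = singular_systemD[OF svdD(1)[OF svd]]
  note D' = singular_systemD[OF singular_system_adjoint[OF svdD(1)[OF svd]]]
  define ix where "ix k = (if k < max m n then k else m + n - 1 - k)" for k
  define a :: "nat \<Rightarrow> real" where "a k = (if min m n \<le> k \<and> k < max m n then 1 else 1 / sqrt 2)" for k
  define b where "b k = (if k < max m n then a k else - a k)" for k
  \<comment> \<open>Padding by zero vectors treats the cases \<open>m < n\<close> and \<open>n < m\<close> alike.\<close>
  define U where "U i = (if i < m then u i else 0\<^sub>v m)" for i
  define V where "V i = (if i < n then v i else 0\<^sub>v n)" for i
  have w: "dilation_vector m n u v k = (complex_of_real (a k) \<cdot>\<^sub>v U (ix k)) @\<^sub>v (complex_of_real (b k) \<cdot>\<^sub>v V (ix k))" for k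
    unfolding dilation_vector_def ix_def a_def b_def U_def V_def Let_def by simp
  have U: "U i \<in> carrier_vec m" and V: "V i \<in> carrier_vec n" for i
    using D(2,3) unfolding U_def V_def by auto
  have UU: "U i \<bullet>c U j = (if i = j \<and> i < m then 1 else 0)" for i j
    using D(2) orthonormal_cprod[OF D(2), of i j] unfolding U_def by auto
  have VV: "V i \<bullet>c V j = (if i = j \<and> i < n then 1 else 0)" for i j
    using D(3) orthonormal_cprod[OF D(3), of i j] unfolding V_def by auto
  have ix: "ix k < max m n" if "k < m + n" for k using that unfolding ix_def by auto
  have "orthonormal (m + n) (m + n) (dilation_vector m n u v)"
    unfolding orthonormal_def
  proof (intro conjI allI impI)
    fix k assume k: "k < m + n"
    show "dilation_vector m n u v k \<in> carrier_vec (m + n)" unfolding w using U V by (intro append_carrier_vec) auto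
    fix l assume l: "l < m + n"
    have "dilation_vector m n u v k \<bullet>c dilation_vector m n u v l =
        complex_of_real (a k) * (complex_of_real (a l) * (U (ix k) \<bullet>c U (ix l))) +
        complex_of_real (b k) * (complex_of_real (b l) * (V (ix k) \<bullet>c V (ix l)))"
      unfolding w using U V
      by (subst append_vec_cprod[of _ m _ _ n])
        (auto simp: cprod_smult_left[of _ m] cprod_smult_left[of _ n] cprod_smult_right[of _ m] cprod_smult_right[of _ n])
    also have "\<dots> = complex_of_real (if ix k = ix l
        then (if ix k < m then a k * a l else 0) + (if ix k < n then b k * b l else 0) else 0)"
      unfolding UU VV by auto
    also have "\<dots> = (if k = l then 1 else 0)"
    proof (cases "ix k = ix l")
      case True
      show ?thesis
      proof (cases "ix k < min m n")
        case lt: True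
        \<comment> \<open>Distinct \<open>k\<close> and \<open>l\<close> with the same \<open>ix\<close> are mirror indices, where the \<open>b\<close> have opposite signs.\<close>
        then have "a k = 1 / sqrt 2" "a l = 1 / sqrt 2" and kl: "k \<noteq> l \<longrightarrow> (k < max m n \<longleftrightarrow> \<not> l < max m n)"
          using True k l unfolding ix_def a_def by (auto split: if_splits)
        then have "a k * a l + b k * b l = (if k = l then 1 else 0)" by (auto simp: b_def)
        then show ?thesis using True lt by (simp del: of_real_add of_real_mult)
      next
        case False
        then have kx: "k = ix k" "l = ix l" using True k l unfolding ix_def by (auto split: if_splits)
        have "a k = 1" "a l = 1" "b k = 1" "b l = 1"
          using kx False True ix[OF k] unfolding a_def b_def by auto
        moreover have "k = l" using kx True by simp
        moreover have "ix k < m \<longleftrightarrow> \<not> ix k < n" using False ix[OF k] by auto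
        ultimately show ?thesis using True by simp
      qed
    next
      case False
      then show ?thesis by auto
    qed
    finally show "dilation_vector m n u v k \<bullet>c dilation_vector m n u v l = (if k = l then 1 else 0)" .
  qed
  moreover have "dilation m n F *\<^sub>v dilation_vector m n u v k =
      complex_of_real (dilation_value m n s k) \<cdot>\<^sub>v dilation_vector m n u v k" if k: "k < m + n" for k
  proof -
    define t where "t i = (if i < min m n then s i else 0)" for i
    have FV: "F *\<^sub>v V i = complex_of_real (t i) \<cdot>\<^sub>v U i" for i
    proof (cases "i < min m n")
      case True
      then show ?thesis using D(4)[of i] by (simp add: V_def U_def t_def)
    next
      case False
      have "F *\<^sub>v 0\<^sub>v n = 0\<^sub>v m" using D(1) by (intro eq_vecI) auto
      then show ?thesis using D(5)[of i] False smult_zero_vec[OF U[of i]] by (auto simp: V_def t_def)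
    qed
    have FU: "mat_adjoint F *\<^sub>v U i = complex_of_real (t i) \<cdot>\<^sub>v V i" for i
    proof (cases "i < min m n")
      case True
      then show ?thesis using D'(4)[of i] by (simp add: V_def U_def t_def)
    next
      case False
      have "mat_adjoint F *\<^sub>v 0\<^sub>v m = 0\<^sub>v n" using D(1) by (intro eq_vecI) auto
      then show ?thesis using D'(5)[of i] False smult_zero_vec[OF V[of i]] by (auto simp: U_def t_def)
    qed
    have 1: "b k * t (ix k) = dilation_value m n s k * a k" "a k * t (ix k) = dilation_value m n s k * b k"
      using k unfolding b_def t_def dilation_value_def ix_def by auto
    have "dilation m n F *\<^sub>v dilation_vector m n u v k =
        (complex_of_real (b k) \<cdot>\<^sub>v (complex_of_real (t (ix k)) \<cdot>\<^sub>v U (ix k))) @\<^sub>v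
        (complex_of_real (a k) \<cdot>\<^sub>v (complex_of_real (t (ix k)) \<cdot>\<^sub>v V (ix k)))"
      unfolding w using U V D(1)
      by (subst dilation_mult) (auto simp: mult_mat_vec[of F m n] mult_mat_vec[OF mat_adjoint_carrier[OF D(1)]] FV FU)
    also have "\<dots> = (complex_of_real (dilation_value m n s k * a k) \<cdot>\<^sub>v U (ix k)) @\<^sub>v
        (complex_of_real (dilation_value m n s k * b k) \<cdot>\<^sub>v V (ix k))"
      unfolding smult_smult_assoc of_real_mult[symmetric] 1 ..
    also have "\<dots> = complex_of_real (dilation_value m n s k) \<cdot>\<^sub>v dilation_vector m n u v k"
      unfolding w by (intro eq_vecI) auto
    finally show ?thesis .
  qed
  moreover have "dilation_value m n s l \<le> dilation_value m n s k" if "k \<le> l" "l < m + n" for k l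
  proof -
    have refl_less: "m + n - 1 - i < min m n" if "\<not> i < max m n" "i < m + n" for i using that by linarith
    have "0 \<le> s (m + n - 1 - l)" if "\<not> l < max m n"
      using svdD(2)[OF svd refl_less[OF that \<open>l < m + n\<close>]] .
    moreover have "s (m + n - 1 - k) \<le> s (m + n - 1 - l)" if "\<not> k < max m n"
      using svdD(3)[OF svd _ refl_less[OF that], of "m + n - 1 - l"] \<open>k \<le> l\<close> \<open>l < m + n\<close> by simp
    moreover have "0 \<le> s k" if "k < min m n" using svdD(2)[OF svd that] .
    moreover have "s l \<le> s k" if "l < min m n" using svdD(3)[OF svd \<open>k \<le> l\<close> that] .
    moreover have "min m n \<le> max m n" by simp
    ultimately show ?thesis
      using \<open>k \<le> l\<close> unfolding dilation_value_def by (smt (verit) le_less_trans less_le_trans)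
  qed
  ultimately show ?thesis
    using dilation_carrier[OF D(1)] dilation_adjoint[OF D(1)] unfolding eigensystem_def by blast
qed

text \<open>The absolute values are produced by the choice of the index set in the inequality of Lidskii: an index
  \<open>i\<close> with \<open>t i \<le> s i\<close> is kept, and one with \<open>s i < t i\<close> is replaced by its mirror index, where the
  eigenvalues of the dilations are \<open>- s i\<close> and \<open>- t i\<close>.\<close>

theorem mirsky:
  assumes A: "svd m n A s u v" and B: "svd m n B t u' v'" and E: "svd m n (A - B) e u'' v''"
    and I: "I \<subseteq> {..<min m n}"
  shows "(\<Sum>i\<in>I. \<bar>s i - t i\<bar>) \<le> (\<Sum>i<card I. e i)"
proof -
  define q where "q = min m n"
  define P where "P = {i \<in> I. t i \<le> s i}"
  define M where "M = {i \<in> I. s i < t i}"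
  define r where "r i = m + n - 1 - i" for i :: nat
  have fin: "finite I" using I finite_subset by blast
  have IPM: "I = P \<union> M" "P \<inter> M = {}" and finPM: "finite P" "finite M"
    using fin unfolding P_def M_def by auto
  have Iq: "i < q" if "i \<in> I" for i using I that unfolding q_def by auto
  have inj: "inj_on r M"
  proof (rule inj_onI)
    fix i j assume "i \<in> M" "j \<in> M" "r i = r j"
    then show "i = j" using Iq[of i] Iq[of j] unfolding r_def M_def q_def by auto
  qed
  have disj: "P \<inter> r ` M = {}"
  proof -
    have "r i \<noteq> j" if "i \<in> M" "j \<in> P" for i j
      using Iq[of i] Iq[of j] that unfolding r_def M_def P_def q_def by auto
    then show ?thesis by auto
  qed
  have val: "dilation_value m n x i = x i" if "i \<in> I" for x i
    using Iq[OF that] unfolding dilation_value_def q_def by simp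
  have valr: "dilation_value m n x (r i) = - x i" if "i \<in> I" for x i
    using Iq[OF that] unfolding dilation_value_def q_def r_def by auto
  define J where "J = P \<union> r ` M"
  have "J \<subseteq> {..<m + n}" using Iq unfolding J_def P_def M_def r_def q_def by fastforce
  have "card J = card P + card M"
    unfolding J_def using disj finPM card_image[OF inj] by (subst card_Un_disjoint) auto
  then have card: "card J = card I" using IPM finPM card_Un_disjoint[of P M] by simp
  have AB: "A \<in> carrier_mat m n" "B \<in> carrier_mat m n"
    using singular_systemD(1)[OF svdD(1)[OF A]] singular_systemD(1)[OF svdD(1)[OF B]] .
  have "(\<Sum>i\<in>I. \<bar>s i - t i\<bar>) = (\<Sum>i\<in>P. s i - t i) + (\<Sum>i\<in>M. t i - s i)"
    unfolding IPM(1) using IPM(2) finPM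
    by (subst sum.union_disjoint) (auto simp: P_def M_def intro!: arg_cong2[of _ _ _ _ "(+)"] sum.cong)
  also have "\<dots> = (\<Sum>i\<in>P. dilation_value m n s i - dilation_value m n t i) +
      (\<Sum>i\<in>M. dilation_value m n s (r i) - dilation_value m n t (r i))"
    using val valr by (auto simp: P_def M_def intro!: arg_cong2[of _ _ _ _ "(+)"] sum.cong)
  also have "\<dots> = (\<Sum>i\<in>J. dilation_value m n s i - dilation_value m n t i)"
    unfolding J_def using disj finPM by (subst sum.union_disjoint) (auto simp: sum.reindex[OF inj])
  also have "\<dots> \<le> (\<Sum>i<card J. dilation_value m n e i)"
    using lidskii[OF dilation_eigensystem[OF A] dilation_eigensystem[OF B] _ \<open>J \<subseteq> _\<close>]
      dilation_eigensystem[OF E] dilation_diff[OF AB] by simp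
  also have "\<dots> = (\<Sum>i<card I. e i)"
    using card card_mono[OF _ I] unfolding dilation_value_def by (intro sum.cong) auto
  finally show ?thesis .
qed

section \<open>Rank and partial isometries\<close>

lemma svd_positive_count:
  assumes "svd m n F s u v"
  obtains k where "k \<le> min m n" "\<And>i. i < min m n \<Longrightarrow> 0 < s i \<longleftrightarrow> i < k"
proof -
  have "s j \<le> s i" if "i \<le> j" "j < min m n" for i j using svdD(3)[OF assms] that by blast
  then show ?thesis using decreasing_support[of "min m n" s] that by blast
qed

text \<open>The column space is spanned by the orthonormal vectors \<open>u 0, ..., u (k - 1)\<close>, that is, it is the
  column space of a matrix with linearly independent columns.\<close>

lemma mat_rank_singular_system:
  assumes F: "singular_system m n F s u v" and k: "k \<le> min m n"
    and supp: "\<And>i. i < min m n \<Longrightarrow> s i \<noteq> 0 \<longleftrightarrow> i < k"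
  shows "mat_rank F = k"
proof -
  interpret vec_space "TYPE(complex)" m .
  note D = singular_systemD[OF F]
  define q where "q = min m n"
  define U where "U = mat m k (\<lambda>(a, i). u i $ a)"
  have U: "U \<in> carrier_mat m k" unfolding U_def by simp
  have uc: "u i \<in> carrier_vec m" if "i < k" for i using D(2) that k by simp
  have vc: "v i \<in> carrier_vec n" if "i < q" for i using D(3) that unfolding q_def by simp
  have u_on: "orthonormal m k u" using D(2) k unfolding orthonormal_def by simp
  have Uy: "U *\<^sub>v y = lin_comb m k (\<lambda>i. y $ i) u" if "y \<in> carrier_vec k" for y
  proof (rule eq_vecI)
    fix a assume "a < dim_vec (lin_comb m k (\<lambda>i. y $ i) u)"
    then have a: "a < m" by (simp add: lin_comb_def)
    show "(U *\<^sub>v y) $ a = lin_comb m k (\<lambda>i. y $ i) u $ a"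
      unfolding mult_mat_vec_index_sum[OF U that a] using a by (simp add: lin_comb_def U_def mult.commute)
  qed (simp add: lin_comb_def U_def)
  have coord: "(U *\<^sub>v y) \<bullet>c u l = y $ l" if y: "y \<in> carrier_vec k" and l: "l < k" for y l
  proof -
    have "(U *\<^sub>v y) \<bullet>c u l = (\<Sum>i<k. y $ i * (u i \<bullet>c u l))"
      unfolding Uy[OF y] using uc l by (intro lin_comb_cprod) auto
    also have "\<dots> = (\<Sum>i<k. if i = l then y $ i else 0)"
      using l by (intro sum.cong refl) (simp add: orthonormal_cprod[OF u_on])
    finally show ?thesis using l by simp
  qed
  have Fx: "F *\<^sub>v x = U *\<^sub>v vec k (\<lambda>i. complex_of_real (s i) * (x \<bullet>c v i))" if x: "x \<in> carrier_vec n" for x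
  proof -
    have "F = dyad_sum m n q s u v"
    proof (rule mat_eq_by_basis[OF D(3) D(1)])
      fix i assume i: "i < n"
      have "dyad_sum m n q s u v *\<^sub>v v i = (if i < q then complex_of_real (s i) \<cdot>\<^sub>v u i else 0\<^sub>v m)"
        using D(2) i by (intro dyad_sum_basis[OF D(3)]) (auto simp: q_def)
      then show "F *\<^sub>v v i = dyad_sum m n q s u v *\<^sub>v v i"
        using D(4)[of i] D(5)[of i] i unfolding q_def by auto
    qed simp
    then have *: "(F *\<^sub>v x) $ a = (\<Sum>i<q. complex_of_real (s i) * (x \<bullet>c v i) * u i $ a)" if "a < m" for a
      using dyad_sum_mult_index[of q v n x a m s u] vc x that by simp
    show ?thesis
    proof (subst Uy, simp, rule eq_vecI)
      fix a assume "a < dim_vec (lin_comb m k (\<lambda>i. vec k (\<lambda>i. complex_of_real (s i) * (x \<bullet>c v i)) $ i) u)"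
      then have a: "a < m" by (simp add: lin_comb_def)
      have "(\<Sum>i<q. complex_of_real (s i) * (x \<bullet>c v i) * u i $ a) =
          (\<Sum>i<k. complex_of_real (s i) * (x \<bullet>c v i) * u i $ a)"
        using k supp unfolding q_def by (intro sum.mono_neutral_right) auto
      then show "(F *\<^sub>v x) $ a = lin_comb m k (\<lambda>i. vec k (\<lambda>i. complex_of_real (s i) * (x \<bullet>c v i)) $ i) u $ a"
        unfolding *[OF a] using a by (simp add: lin_comb_def)
    qed (use D(1) in \<open>simp add: lin_comb_def\<close>)
  qed
  have "col_space F = col_space U"
  proof -
    have "(\<exists>x\<in>carrier_vec n. F *\<^sub>v x = y) \<longleftrightarrow> (\<exists>z\<in>carrier_vec k. U *\<^sub>v z = y)" for y
    proof
      assume "\<exists>x\<in>carrier_vec n. F *\<^sub>v x = y"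
      then show "\<exists>z\<in>carrier_vec k. U *\<^sub>v z = y" using Fx by (metis vec_carrier)
    next
      assume "\<exists>z\<in>carrier_vec k. U *\<^sub>v z = y"
      then obtain z where z: "z \<in> carrier_vec k" "U *\<^sub>v z = y" by blast
      define x where "x = lin_comb n k (\<lambda>i. z $ i / complex_of_real (s i)) v"
      have "x \<bullet>c v i = z $ i / complex_of_real (s i)" if i: "i < k" for i
      proof -
        have "x \<bullet>c v i = (\<Sum>j<k. z $ j / complex_of_real (s j) * (v j \<bullet>c v i))"
          unfolding x_def using vc k i by (intro lin_comb_cprod) (auto simp: q_def)
        also have "\<dots> = (\<Sum>j<k. if j = i then z $ j / complex_of_real (s j) else 0)"
          using i k by (intro sum.cong refl) (simp add: orthonormal_cprod[OF D(3)])
        finally show ?thesis using i by simp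
      qed
      then have "vec k (\<lambda>i. complex_of_real (s i) * (x \<bullet>c v i)) = z"
        using supp k z(1) by (intro eq_vecI) auto
      then have "F *\<^sub>v x = y" using Fx[of x] z(2) by (simp add: x_def)
      then show "\<exists>x\<in>carrier_vec n. F *\<^sub>v x = y" unfolding x_def by (metis lin_comb_carrier)
    qed
    then show ?thesis using col_space_eq[OF D(1)] col_space_eq[OF U] D(1) U by auto
  qed
  then have "rank F = rank U" unfolding rank_def col_space_def by simp
  also have "rank U = k"
  proof (rule lin_indpt_full_rank[OF U])
    have col: "col U i = u i" if "i < k" for i
      using uc[OF that] that unfolding U_def by (intro eq_vecI) auto
    show dist: "distinct (cols U)"
      unfolding distinct_conv_nth
    proof (intro allI impI)
      fix i j assume ij: "i < length (cols U)" "j < length (cols U)" "i \<noteq> j"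
      then have "i < k" "j < k" using U by auto
      then have "col U i \<noteq> col U j"
        using col orthonormal_cprod[OF u_on, of i j] orthonormal_cprod[OF u_on, of j j] ij(3) by auto
      then show "cols U ! i \<noteq> cols U ! j" using ij by simp
    qed
    show "lin_indpt (set (cols U))"
    proof
      assume "lin_dep (set (cols U))"
      then obtain y where y: "y \<in> carrier_vec k" "y \<noteq> 0\<^sub>v k" "U *\<^sub>v y = 0\<^sub>v m"
        using lin_depE[OF U _ dist] by blast
      have "y $ l = 0" if "l < k" for l using coord[OF y(1) that] y(3) uc[OF that] by simp
      then have "y = 0\<^sub>v k" using y(1) by (intro eq_vecI) auto
      then show False using y(2) by simp
    qed
  qed
  finally show ?thesis using D(1) unfolding mat_rank_def by simp
qed

lemma l2_norm_unit: "orthonormal N k v \<Longrightarrow> i < k \<Longrightarrow> l2_norm (v i) = 1"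
  using orthonormal_cprod[of N k v i i] l2_norm_nonneg[of "v i"] unfolding cprod_self
  by (simp flip: of_real_power add: power2_eq_1_iff)

lemma l2_norm_smult_unit:
  "orthonormal N k v \<Longrightarrow> i < k \<Longrightarrow> l2_norm (complex_of_real c \<cdot>\<^sub>v v i) = \<bar>c\<bar>"
proof -
  assume v: "orthonormal N k v" "i < k"
  have "complex_of_real ((l2_norm (complex_of_real c \<cdot>\<^sub>v v i))\<^sup>2) = complex_of_real (c\<^sup>2)"
    using v cprod_smult_left[of "v i" N "complex_of_real c \<cdot>\<^sub>v v i"] cprod_smult_right[of "v i" N "v i"]
      orthonormal_cprod[of N k v i i] unfolding cprod_self[symmetric] by (simp add: power2_eq_square)
  then have "(l2_norm (complex_of_real c \<cdot>\<^sub>v v i))\<^sup>2 = c\<^sup>2" using of_real_eq_iff by blast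
  then show ?thesis by (metis l2_norm_nonneg power2_eq_iff_nonneg abs_ge_zero power2_abs)
qed

text \<open>A right singular vector for a nonzero singular value is orthogonal to the kernel, so its norm is
  preserved.\<close>

lemma partial_isometry_singular_value:
  assumes X: "partial_isometry X" and F: "singular_system m n X s u v" and i: "i < min m n" "s i \<noteq> 0"
  shows "\<bar>s i\<bar> = 1"
proof -
  note D = singular_systemD[OF F]
  note D' = singular_systemD[OF singular_system_adjoint[OF F]]
  have vi: "v i \<in> carrier_vec n" and ui: "u i \<in> carrier_vec m" using D(2,3) i by auto
  have "v i \<bullet>c g = 0" if "g \<in> mat_kernel X" for g
  proof -
    have g: "g \<in> carrier_vec n" "X *\<^sub>v g = 0\<^sub>v m" using mat_kernelD[OF D(1) that] by auto
    have "0 = (X *\<^sub>v g) \<bullet>c u i" using g(2) ui by simp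
    also have "\<dots> = complex_of_real (s i) * (g \<bullet>c v i)"
      using cprod_adjoint[OF D(1) g(1) ui] D'(4)[of i] i cprod_smult_right[OF g(1) vi] by simp
    finally show ?thesis using i(2) cprod_commute[OF vi g(1)] by simp
  qed
  then have "l2_norm (X *\<^sub>v v i) = l2_norm (v i)"
    using X vi D(1) unfolding partial_isometry_def by auto
  then show ?thesis using D(4)[OF i(1)] l2_norm_smult_unit[OF D(2)] l2_norm_unit[OF D(3)] i by simp
qed

lemma partial_isometry_svd:
  assumes X: "partial_isometry X" and F: "svd m n X s u v" and i: "i < min m n"
  shows "s i = (if i < mat_rank X then 1 else 0)"
proof -
  obtain k where k: "k \<le> min m n" "\<And>i. i < min m n \<Longrightarrow> 0 < s i \<longleftrightarrow> i < k"
    using svd_positive_count[OF F] by blast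
  have nz: "s i \<noteq> 0 \<longleftrightarrow> i < k" if "i < min m n" for i using k(2)[OF that] svdD(2)[OF F that] by auto
  have rk: "mat_rank X = k" by (rule mat_rank_singular_system[OF svdD(1)[OF F] k(1) nz])
  show "s i = (if i < mat_rank X then 1 else 0)"
    using nz[OF i] partial_isometry_singular_value[OF X svdD(1)[OF F] i] svdD(2)[OF F i] rk by auto
qed

lemma singular_system_partial_isometry:
  assumes F: "singular_system m n X t u v" and t: "\<And>i. i < min m n \<Longrightarrow> t i = 0 \<or> t i = 1"
  shows "partial_isometry X"
  unfolding partial_isometry_def
proof (intro ballI impI)
  note D = singular_systemD[OF F]
  note D' = singular_systemD[OF singular_system_adjoint[OF F]]
  fix f assume "f \<in> carrier_vec (dim_col X)" and orth: "\<forall>g\<in>mat_kernel X. f \<bullet>c g = 0"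
  then have f: "f \<in> carrier_vec n" using D(1) by simp
  have Xf: "X *\<^sub>v f \<in> carrier_vec m" using D(1) f by simp
  have fv: "f \<bullet>c v i = 0" if "i < n" "i < m \<longrightarrow> t i = 0" for i
  proof -
    have "X *\<^sub>v v i = 0\<^sub>v m"
      using D(4)[of i] D(5)[of i] that smult_zero_vec[of "u i" m] D(2) by (cases "i < m") auto
    then have "v i \<in> mat_kernel X" using D(1,3) that by (intro mat_kernelI) auto
    then show ?thesis using orth by blast
  qed
  have Xfu: "(cmod ((X *\<^sub>v f) \<bullet>c u i))\<^sup>2 = (if i < n then (cmod (f \<bullet>c v i))\<^sup>2 else 0)" if "i < m" for i
  proof (cases "i < n")
    case True
    have "(X *\<^sub>v f) \<bullet>c u i = complex_of_real (t i) * (f \<bullet>c v i)"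
      using cprod_adjoint[OF D(1) f, of "u i"] D'(4)[of i] cprod_smult_right[OF f, of "v i"] that True D(2,3) by simp
    then show ?thesis using True fv[of i] that t[of i] by auto
  next
    case False
    have "(X *\<^sub>v f) \<bullet>c u i = 0"
      using cprod_adjoint[OF D(1) f, of "u i"] D'(5)[of i] that False D(2) f by (simp add: cprod_sum[of _ n])
    then show ?thesis using False by simp
  qed
  have "(l2_norm (X *\<^sub>v f))\<^sup>2 = (\<Sum>i<m. if i < n then (cmod (f \<bullet>c v i))\<^sup>2 else 0)"
    unfolding parseval_norm[OF D(2) Xf] using Xfu by (intro sum.cong) auto
  also have "\<dots> = (\<Sum>i<min m n. (cmod (f \<bullet>c v i))\<^sup>2)"
    by (intro sum.mono_neutral_cong_right) auto
  also have "\<dots> = (\<Sum>i<n. (cmod (f \<bullet>c v i))\<^sup>2)"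
    using fv by (intro sum.mono_neutral_left) auto
  also have "\<dots> = (l2_norm f)\<^sup>2" using parseval_norm[OF D(3) f] by simp
  finally show "l2_norm (X *\<^sub>v f) = l2_norm f" by (simp add: power2_eq_iff_nonneg)
qed

text \<open>Sorting the absolute values and moving the signs into the left singular vectors gives an ordered
  decomposition, and \<open>\<Phi>\<close> does not see the permutation.\<close>

lemma ui_norm_singular_system:
  assumes F: "singular_system m n G t u v" and sg: "symmetric_gauge (min m n) \<Phi>"
  shows "ui_norm \<Phi> G = \<Phi> (vec (min m n) (\<lambda>i. \<bar>t i\<bar>))"
proof -
  define q where "q = min m n"
  note D = singular_systemD[OF F]
  obtain \<sigma> where \<sigma>: "\<sigma> permutes {..<q}" "\<And>i j. i \<le> j \<Longrightarrow> j < q \<Longrightarrow> \<bar>t (\<sigma> j)\<bar> \<le> \<bar>t (\<sigma> i)\<bar>"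
    using decreasing_rearrangement[of q "\<lambda>i. \<bar>t i\<bar>"] by blast
  have \<sigma>m: "\<sigma> permutes {..<m}" and \<sigma>n: "\<sigma> permutes {..<n}"
    using permutes_subset[OF \<sigma>(1)] unfolding q_def by auto
  have \<sigma>q: "\<sigma> i < q \<longleftrightarrow> i < q" for i using permutes_in_image[OF \<sigma>(1), of i] by auto
  have fixed: "\<sigma> i = i" if "q \<le> i" for i using permutes_not_in[OF \<sigma>(1), of i] that by auto
  define \<epsilon> :: "nat \<Rightarrow> complex" where "\<epsilon> i = (if t (\<sigma> i) < 0 then -1 else 1)" for i
  define u' where "u' i = \<epsilon> i \<cdot>\<^sub>v u (\<sigma> i)" for i
  define v' where "v' i = v (\<sigma> i)" for i
  have uc: "u (\<sigma> i) \<in> carrier_vec m" if "i < m" for i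
    using orthonormal_carrier[OF orthonormal_permute[OF D(2) \<sigma>m] that] .
  have v': "orthonormal n n v'" unfolding v'_def by (rule orthonormal_permute[OF D(3) \<sigma>n])
  have u': "orthonormal m m u'"
    unfolding orthonormal_def
  proof (intro conjI allI impI)
    fix i assume i: "i < m"
    show "u' i \<in> carrier_vec m" using uc[OF i] unfolding u'_def by simp
    fix j assume j: "j < m"
    have "u' i \<bullet>c u' j = \<epsilon> i * (cnj (\<epsilon> j) * (u (\<sigma> i) \<bullet>c u (\<sigma> j)))"
      unfolding u'_def using uc[OF i] uc[OF j] cprod_smult_left[of "u (\<sigma> i)" m] cprod_smult_right[of "u (\<sigma> i)" m] by simp
    then show "u' i \<bullet>c u' j = (if i = j then 1 else 0)"
      using orthonormal_cprod[OF orthonormal_permute[OF D(2) \<sigma>m] i j] by (auto simp: \<epsilon>_def)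
  qed
  have "G *\<^sub>v v' i = (if i < m then complex_of_real \<bar>t (\<sigma> i)\<bar> \<cdot>\<^sub>v u' i else 0\<^sub>v m)" if i: "i < n" for i
  proof (cases "i < q")
    case True
    then have "G *\<^sub>v v' i = complex_of_real (t (\<sigma> i)) \<cdot>\<^sub>v u (\<sigma> i)"
      using D(4)[of "\<sigma> i"] \<sigma>q unfolding v'_def q_def by simp
    also have "\<dots> = complex_of_real \<bar>t (\<sigma> i)\<bar> \<cdot>\<^sub>v u' i"
      unfolding u'_def smult_smult_assoc by (simp add: \<epsilon>_def)
    finally show ?thesis using True unfolding q_def by simp
  next
    case False
    then show ?thesis using D(5)[of i] fixed[of i] i unfolding v'_def q_def by auto
  qed
  then have "svd m n G (\<lambda>i. \<bar>t (\<sigma> i)\<bar>) u' v'"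
    using D(1) u' v' \<sigma>(2) unfolding svd_def singular_system_def q_def by auto
  from ui_norm_svd[OF this] have "ui_norm \<Phi> G = \<Phi> (vec q (\<lambda>i. \<bar>t (\<sigma> i)\<bar>))" unfolding q_def .
  also have "\<dots> = \<Phi> (vec q (\<lambda>i. \<bar>t i\<bar>))"
    using sg unfolding q_def[symmetric] by (rule gauge_signed_permutation[OF _ \<sigma>(1)]) simp
  finally show ?thesis unfolding q_def .
qed

text \<open>For the singular vectors \<open>u\<close>, \<open>v\<close> of \<open>F\<close> and \<open>k\<close> the rank of \<open>F\<close>, this is the partial isometry of the
  canonical polar decomposition; smaller \<open>k\<close> keep its leading part.\<close>

definition truncated_polar ::
  "nat \<Rightarrow> nat \<Rightarrow> (nat \<Rightarrow> complex vec) \<Rightarrow> (nat \<Rightarrow> complex vec) \<Rightarrow> nat \<Rightarrow> complex mat" where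
  "truncated_polar m n u v k = dyad_sum m n k (\<lambda>_. 1) u v"

lemma truncated_polar_system:
  assumes u: "orthonormal m m u" and v: "orthonormal n n v" and k: "k \<le> min m n"
  shows "singular_system m n (truncated_polar m n u v k) (\<lambda>i. if i < k then 1 else 0) u v"
proof -
  have "truncated_polar m n u v k *\<^sub>v v i =
      (if i < m then complex_of_real (if i < k then 1 else 0) \<cdot>\<^sub>v u i else 0\<^sub>v m)" if i: "i < n" for i
  proof -
    have "truncated_polar m n u v k *\<^sub>v v i = (if i < k then complex_of_real 1 \<cdot>\<^sub>v u i else 0\<^sub>v m)"
      unfolding truncated_polar_def using u k i by (intro dyad_sum_basis[OF v]) auto
    then show ?thesis using k smult_zero_vec[of "u i" m] u by auto
  qed
  then show ?thesis using u v unfolding singular_system_def truncated_polar_def by simp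
qed

lemma truncated_polar_partial_isometry:
  assumes "orthonormal m m u" "orthonormal n n v" "k \<le> min m n"
  shows "truncated_polar m n u v k \<in> partial_isometries_rank m n k"
proof -
  note S = truncated_polar_system[OF assms]
  have "partial_isometry (truncated_polar m n u v k)"
    by (rule singular_system_partial_isometry[OF S]) auto
  moreover have "mat_rank (truncated_polar m n u v k) = k"
    by (rule mat_rank_singular_system[OF S assms(3)]) auto
  ultimately show ?thesis
    using singular_systemD(1)[OF S] unfolding partial_isometries_rank_def by simp
qed

lemma ui_norm_minus_truncated_polar:
  assumes F: "svd m n F s u v" and k: "k \<le> min m n" and sg: "symmetric_gauge (min m n) \<Phi>"
  shows "ui_norm \<Phi> (F - truncated_polar m n u v k) =
    \<Phi> (vec (min m n) (\<lambda>i. \<bar>s i - (if i < k then 1 else 0)\<bar>))"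
proof (rule ui_norm_singular_system[OF _ sg])
  note D = singular_systemD[OF svdD(1)[OF F]]
  note S = truncated_polar_system[OF D(2,3) k]
  note DX = singular_systemD[OF S]
  have "(F - truncated_polar m n u v k) *\<^sub>v v i =
      (if i < m then complex_of_real (s i - (if i < k then 1 else 0)) \<cdot>\<^sub>v u i else 0\<^sub>v m)" if i: "i < n" for i
  proof -
    have vi: "v i \<in> carrier_vec n" using D(3) i by simp
    have *: "(F - truncated_polar m n u v k) *\<^sub>v v i = F *\<^sub>v v i - truncated_polar m n u v k *\<^sub>v v i"
      by (rule minus_mult_distrib_mat_vec[OF D(1) DX(1) vi])
    show ?thesis
    proof (cases "i < m")
      case True
      then have "dim_vec (u i) = m" using D(2) by simp
      then show ?thesis
        using True i * D(4)[of i] DX(4)[of i] by (intro eq_vecI) (auto simp: left_diff_distrib)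
    next
      case False
      then show ?thesis using i * D(5)[of i] DX(5)[of i] by simp
    qed
  qed
  then show "singular_system m n (F - truncated_polar m n u v k) (\<lambda>i. s i - (if i < k then 1 else 0)) u v"
    using D(1-3) DX(1) minus_carrier_mat[OF DX(1)] unfolding singular_system_def by auto
qed

section \<open>Partial isometries closest to a matrix\<close>

text \<open>Both sums are the trace of \<open>A\<^sup>* A\<close>.\<close>

lemma frobenius_basis_independent:
  assumes v: "orthonormal n n v" and w: "orthonormal n n w" and A: "A \<in> carrier_mat m n"
  shows "(\<Sum>i<n. (l2_norm (A *\<^sub>v v i))\<^sup>2) = (\<Sum>i<n. (l2_norm (A *\<^sub>v w i))\<^sup>2)"
proof -
  have AA: "mat_adjoint A * A \<in> carrier_mat n n" using A mat_adjoint_carrier by (metis mult_carrier_mat)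
  have *: "complex_of_real (\<Sum>i<n. (l2_norm (A *\<^sub>v z i))\<^sup>2) = cnj (\<Sum>a<n. (mat_adjoint A * A) $$ (a, a))"
    if z: "orthonormal n n z" for z
  proof -
    have "complex_of_real ((l2_norm (A *\<^sub>v z i))\<^sup>2) = cnj (((mat_adjoint A * A) *\<^sub>v z i) \<bullet>c z i)" if i: "i < n" for i
    proof -
      have zi: "z i \<in> carrier_vec n" using z i by simp
      have Az: "A *\<^sub>v z i \<in> carrier_vec m" using A zi by simp
      have "(A *\<^sub>v z i) \<bullet>c (A *\<^sub>v z i) = z i \<bullet>c ((mat_adjoint A * A) *\<^sub>v z i)"
        using cprod_adjoint[OF A zi Az] assoc_mult_mat_vec[OF mat_adjoint_carrier[OF A] A zi] by simp
      also have "\<dots> = cnj (((mat_adjoint A * A) *\<^sub>v z i) \<bullet>c z i)"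
        using AA zi by (intro cprod_commute) auto
      finally show ?thesis by (simp only: cprod_self)
    qed
    then have "complex_of_real (\<Sum>i<n. (l2_norm (A *\<^sub>v z i))\<^sup>2) = cnj (\<Sum>i<n. ((mat_adjoint A * A) *\<^sub>v z i) \<bullet>c z i)"
      unfolding of_real_sum cnj_sum by (intro sum.cong) auto
    then show ?thesis unfolding trace_in_basis[OF z AA] .
  qed
  show ?thesis using *[OF v] *[OF w] of_real_eq_iff by metis
qed

lemma l2_norm_minus_sq:
  assumes x: "x \<in> carrier_vec N" and y: "y \<in> carrier_vec N"
  shows "(l2_norm (x - y))\<^sup>2 = (l2_norm x)\<^sup>2 - 2 * Re (x \<bullet>c y) + (l2_norm y)\<^sup>2"
proof -
  have xy: "x - y \<in> carrier_vec N" using x y by simp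
  have "complex_of_real ((l2_norm (x - y))\<^sup>2) = x \<bullet>c (x - y) - y \<bullet>c (x - y)"
    unfolding cprod_self[symmetric] by (rule cprod_minus_left[OF x y xy])
  also have "x \<bullet>c (x - y) = cnj (x \<bullet>c x - y \<bullet>c x)"
    using cprod_commute[OF x xy] cprod_minus_left[OF x y x] by simp
  also have "y \<bullet>c (x - y) = cnj (x \<bullet>c y - y \<bullet>c y)"
    using cprod_commute[OF y xy] cprod_minus_left[OF x y y] by simp
  finally have "complex_of_real ((l2_norm (x - y))\<^sup>2) =
      cnj (x \<bullet>c x) - cnj (y \<bullet>c x) - cnj (x \<bullet>c y) + cnj (y \<bullet>c y)" by simp
  then have "Re (complex_of_real ((l2_norm (x - y))\<^sup>2)) =
      Re (cnj (x \<bullet>c x) - cnj (y \<bullet>c x) - cnj (x \<bullet>c y) + cnj (y \<bullet>c y))" by simp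
  then show ?thesis using cprod_commute[OF y x] unfolding cprod_self[of x] cprod_self[of y] by simp
qed

text \<open>All nonzero singular values of a partial isometry are \<open>1\<close>, so that it is the truncated polar factor of
  its own singular vectors. This makes norms of its values computable by the identity of Parseval.\<close>

lemma partial_isometry_is_truncated_polar:
  assumes X: "X \<in> partial_isometries_rank m n k"
  obtains x y where "orthonormal m m x" "orthonormal n n y" "X = truncated_polar m n x y k" "k \<le> min m n"
proof -
  have X': "X \<in> carrier_mat m n" "partial_isometry X" "mat_rank X = k"
    using X unfolding partial_isometries_rank_def by auto
  obtain t x y where svd: "svd m n X t x y" using svd_exists[OF X'(1)] by blast
  note D = singular_systemD[OF svdD(1)[OF svd]]
  obtain k' where k': "k' \<le> min m n" "\<And>i. i < min m n \<Longrightarrow> 0 < t i \<longleftrightarrow> i < k'"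
    using svd_positive_count[OF svd] by blast
  have "mat_rank X = k'"
    using k'(2) svdD(2)[OF svd] by (intro mat_rank_singular_system[OF svdD(1)[OF svd] k'(1)]) force
  then have k: "k \<le> min m n" using k' X'(3) by simp
  have t: "t i = (if i < k then 1 else 0)" if "i < min m n" for i
    using partial_isometry_svd[OF X'(2) svd that] X'(3) by simp
  note S = singular_systemD[OF truncated_polar_system[OF D(2,3) k]]
  have "X = truncated_polar m n x y k"
  proof (rule mat_eq_by_basis[OF D(3) D(1) S(1)])
    fix i assume "i < n"
    then show "X *\<^sub>v y i = truncated_polar m n x y k *\<^sub>v y i"
      using D(4)[of i] D(5)[of i] S(4)[of i] S(5)[of i] t[of i] by (cases "i < m") auto
  qed
  then show ?thesis using that D(2,3) k by blast
qed

lemma truncated_polar_norm: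
  assumes x: "orthonormal m m x" and y: "orthonormal n n y" and k: "k \<le> min m n" and f: "f \<in> carrier_vec n"
  shows "(l2_norm (truncated_polar m n x y k *\<^sub>v f))\<^sup>2 = (\<Sum>l<k. (cmod (f \<bullet>c y l))\<^sup>2)"
proof -
  let ?X = "truncated_polar m n x y k"
  have Xf: "?X *\<^sub>v f \<in> carrier_vec m" unfolding truncated_polar_def by (rule mult_mat_vec_carrier[OF dyad_sum_carrier f])
  have "(?X *\<^sub>v f) \<bullet>c x i = (if i < k then f \<bullet>c y i else 0)" if i: "i < m" for i
  proof -
    have "(?X *\<^sub>v f) \<bullet>c x i = (\<Sum>l<k. complex_of_real 1 * (f \<bullet>c y l) * (x l \<bullet>c x i))"
      unfolding truncated_polar_def using x y k f i by (intro dyad_sum_cprod) auto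
    also have "\<dots> = (\<Sum>l<k. if l = i then f \<bullet>c y l else 0)"
      using k i by (intro sum.cong refl) (simp add: orthonormal_cprod[OF x])
    finally show ?thesis by simp
  qed
  then have "(l2_norm (?X *\<^sub>v f))\<^sup>2 = (\<Sum>i<m. if i < k then (cmod (f \<bullet>c y i))\<^sup>2 else 0)"
    unfolding parseval_norm[OF x Xf] by (intro sum.cong) auto
  also have "\<dots> = (\<Sum>l<k. (cmod (f \<bullet>c y l))\<^sup>2)"
    using k by (intro sum.mono_neutral_cong_right) auto
  finally show ?thesis .
qed

lemma truncated_polar_contraction:
  assumes "orthonormal m m x" "orthonormal n n y" "k \<le> min m n" "f \<in> carrier_vec n"
  shows "(l2_norm (truncated_polar m n x y k *\<^sub>v f))\<^sup>2 \<le> (l2_norm f)\<^sup>2"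
  unfolding truncated_polar_norm[OF assms] parseval_norm[OF assms(2,4)]
  using assms(3) by (intro sum_mono2) auto

lemma truncated_polar_frobenius:
  assumes x: "orthonormal m m x" and y: "orthonormal n n y" and k: "k \<le> min m n" and v: "orthonormal n n v"
  shows "(\<Sum>i<n. (l2_norm (truncated_polar m n x y k *\<^sub>v v i))\<^sup>2) = k"
proof -
  have "truncated_polar m n x y k \<in> carrier_mat m n" unfolding truncated_polar_def by simp
  then have "(\<Sum>i<n. (l2_norm (truncated_polar m n x y k *\<^sub>v v i))\<^sup>2) =
      (\<Sum>i<n. (l2_norm (truncated_polar m n x y k *\<^sub>v y i))\<^sup>2)"
    by (rule frobenius_basis_independent[OF v y])
  also have "\<dots> = (\<Sum>i<n. if i < k then 1 else 0)"
  proof (intro sum.cong refl)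
    fix i assume "i \<in> {..<n}"
    then have i: "i < n" by simp
    have "(l2_norm (truncated_polar m n x y k *\<^sub>v y i))\<^sup>2 = (\<Sum>l<k. (cmod (y i \<bullet>c y l))\<^sup>2)"
      using y i by (intro truncated_polar_norm[OF x y k]) simp
    also have "\<dots> = (\<Sum>l<k. if l = i then 1 else 0)"
      using k i by (intro sum.cong refl) (simp add: orthonormal_cprod[OF y])
    finally show "(l2_norm (truncated_polar m n x y k *\<^sub>v y i))\<^sup>2 = (if i < k then 1 else 0)" by simp
  qed
  also have "\<dots> = (\<Sum>i<k. 1)" using k by (intro sum.mono_neutral_cong_right) auto
  finally show ?thesis by simp
qed

text \<open>Expand the inner product in the singular vectors and bound each term by the arithmetic mean of two
  squares. The bound is symmetric in the matrix and its adjoint, \<open>truncated_polar n m y x k\<close>.\<close>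

lemma truncated_polar_cprod_le:
  assumes x: "orthonormal m m x" and y: "orthonormal n n y" and k: "k \<le> min m n"
    and f: "f \<in> carrier_vec n" and g: "g \<in> carrier_vec m"
  shows "Re ((truncated_polar m n x y k *\<^sub>v f) \<bullet>c g) \<le>
    ((l2_norm (truncated_polar m n x y k *\<^sub>v f))\<^sup>2 + (l2_norm (truncated_polar n m y x k *\<^sub>v g))\<^sup>2) / 2"
proof -
  have k': "k \<le> min n m" using k by simp
  have "(truncated_polar m n x y k *\<^sub>v f) \<bullet>c g = (\<Sum>l<k. complex_of_real 1 * (f \<bullet>c y l) * (x l \<bullet>c g))"
    unfolding truncated_polar_def using x y k f g by (intro dyad_sum_cprod) auto
  then have "Re ((truncated_polar m n x y k *\<^sub>v f) \<bullet>c g) = (\<Sum>l<k. Re ((f \<bullet>c y l) * (x l \<bullet>c g)))" by simp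
  also have "\<dots> \<le> (\<Sum>l<k. ((cmod (f \<bullet>c y l))\<^sup>2 + (cmod (g \<bullet>c x l))\<^sup>2) / 2)"
  proof (intro sum_mono)
    fix l assume "l \<in> {..<k}"
    then have xl: "x l \<in> carrier_vec m" using x k by simp
    have "Re ((f \<bullet>c y l) * (x l \<bullet>c g)) \<le> cmod (f \<bullet>c y l) * cmod (g \<bullet>c x l)"
      using complex_Re_le_cmod[of "(f \<bullet>c y l) * (x l \<bullet>c g)"] cprod_commute[OF xl g] by (simp add: norm_mult)
    also have "\<dots> \<le> ((cmod (f \<bullet>c y l))\<^sup>2 + (cmod (g \<bullet>c x l))\<^sup>2) / 2"
      using sum_squares_bound[of "cmod (f \<bullet>c y l)" "cmod (g \<bullet>c x l)"] by simp
    finally show "Re ((f \<bullet>c y l) * (x l \<bullet>c g)) \<le> ((cmod (f \<bullet>c y l))\<^sup>2 + (cmod (g \<bullet>c x l))\<^sup>2) / 2" .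
  qed
  also have "\<dots> = ((l2_norm (truncated_polar m n x y k *\<^sub>v f))\<^sup>2 + (l2_norm (truncated_polar n m y x k *\<^sub>v g))\<^sup>2) / 2"
    unfolding truncated_polar_norm[OF x y k f] truncated_polar_norm[OF y x k' g]
    by (simp add: sum.distrib flip: sum_divide_distrib)
  finally show ?thesis .
qed

text \<open>In the case of equality, strict convexity identifies the squared singular values of \<open>F - X\<close>; their sum
  can be evaluated in any orthonormal basis, in particular in the right singular vectors of \<open>F\<close>.\<close>

lemma partial_isometry_distance:
  assumes F: "svd m n F s u v" and X: "X \<in> partial_isometries_rank m n j" and sg: "symmetric_gauge (min m n) \<Phi>"
  shows "\<Phi> (vec (min m n) (\<lambda>i. \<bar>s i - (if i < j then 1 else 0)\<bar>)) \<le> ui_norm \<Phi> (F - X)"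
    and "strictly_convex_gauge (min m n) \<Phi> \<Longrightarrow>
      ui_norm \<Phi> (F - X) \<le> \<Phi> (vec (min m n) (\<lambda>i. \<bar>s i - (if i < j then 1 else 0)\<bar>)) \<Longrightarrow>
      (\<Sum>i<n. (l2_norm ((F - X) *\<^sub>v v i))\<^sup>2) = (\<Sum>i<min m n. (s i - (if i < j then 1 else 0))\<^sup>2)"
proof -
  define q where "q = min m n"
  note D = singular_systemD[OF svdD(1)[OF F]]
  have X': "X \<in> carrier_mat m n" "partial_isometry X" "mat_rank X = j"
    using X unfolding partial_isometries_rank_def by auto
  obtain t x y where svdX: "svd m n X t x y" using svd_exists[OF X'(1)] by blast
  have t: "t i = (if i < j then 1 else 0)" if "i < q" for i
    using partial_isometry_svd[OF X'(2) svdX] that X'(3) unfolding q_def by simp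
  have FX: "F - X \<in> carrier_mat m n" by (rule minus_carrier_mat[OF X'(1)])
  obtain e x' y' where E: "svd m n (F - X) e x' y'" using svd_exists[OF FX] by blast
  note DE = singular_systemD[OF svdD(1)[OF E]]
  have maj: "(\<Sum>i\<in>J. \<bar>s i - (if i < j then 1 else 0)\<bar>) \<le> (\<Sum>i<card J. e i)" if J: "J \<subseteq> {..<q}" for J
  proof -
    have "(\<Sum>i\<in>J. \<bar>s i - (if i < j then 1 else 0)\<bar>) = (\<Sum>i\<in>J. \<bar>s i - t i\<bar>)"
      using t J by (intro sum.cong) auto
    also have "\<dots> \<le> (\<Sum>i<card J. e i)" using mirsky[OF F svdX E] J unfolding q_def .
    finally show ?thesis .
  qed
  have norm: "ui_norm \<Phi> (F - X) = \<Phi> (vec q e)" using ui_norm_svd[OF E] unfolding q_def .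
  have e0: "0 \<le> e i" if "i < q" for i using svdD(2)[OF E] that unfolding q_def .
  note major = gauge_weak_majorization[OF sg[folded q_def], of "\<lambda>i. \<bar>s i - (if i < j then 1 else 0)\<bar>" e, OF _ e0 maj]
  show "\<Phi> (vec (min m n) (\<lambda>i. \<bar>s i - (if i < j then 1 else 0)\<bar>)) \<le> ui_norm \<Phi> (F - X)"
    using major(1) unfolding norm q_def[symmetric] by simp
  assume "strictly_convex_gauge (min m n) \<Phi>"
    and "ui_norm \<Phi> (F - X) \<le> \<Phi> (vec (min m n) (\<lambda>i. \<bar>s i - (if i < j then 1 else 0)\<bar>))"
  then have eq: "(\<Sum>i<q. (e i)\<^sup>2) = (\<Sum>i<q. (s i - (if i < j then 1 else 0))\<^sup>2)"
    using major(2) unfolding norm q_def[symmetric] by simp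
  have "(\<Sum>i<n. (l2_norm ((F - X) *\<^sub>v v i))\<^sup>2) = (\<Sum>i<n. (l2_norm ((F - X) *\<^sub>v y' i))\<^sup>2)"
    by (rule frobenius_basis_independent[OF D(3) DE(3) FX])
  also have "\<dots> = (\<Sum>i<n. if i < q then (e i)\<^sup>2 else 0)"
  proof (intro sum.cong refl)
    fix i assume "i \<in> {..<n}"
    then show "(l2_norm ((F - X) *\<^sub>v y' i))\<^sup>2 = (if i < q then (e i)\<^sup>2 else 0)"
      using DE(4)[of i] DE(5)[of i] l2_norm_smult_unit[OF DE(2), of i "e i"] l2_norm_eq_0_iff[of "0\<^sub>v m" m]
      by (cases "i < m") (auto simp: q_def)
  qed
  also have "\<dots> = (\<Sum>i<q. (e i)\<^sup>2)" unfolding q_def by (intro sum.mono_neutral_cong_right) auto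
  finally show "(\<Sum>i<n. (l2_norm ((F - X) *\<^sub>v v i))\<^sup>2) = (\<Sum>i<min m n. (s i - (if i < j then 1 else 0))\<^sup>2)"
    using eq unfolding q_def by simp
qed

lemma nearest_iff: "X \<in> nearest \<Phi> F S \<longleftrightarrow> X \<in> S \<and> (\<forall>Y\<in>S. ui_norm \<Phi> (F - X) \<le> ui_norm \<Phi> (F - Y))"
  unfolding nearest_def by (auto simp: is_arg_min_linorder)

text \<open>All coordinates are minimized at once. That such a rank exists is special to partial isometries: their
  singular values are only \<open>0\<close> and \<open>1\<close>, and the preference for one of them is monotone in \<open>s i\<close>.\<close>

definition optimal_rank :: "nat \<Rightarrow> (nat \<Rightarrow> real) \<Rightarrow> nat \<Rightarrow> bool" where
  "optimal_rank q s k \<longleftrightarrow> k \<in> {1..q} \<and>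
     (\<forall>j\<in>{1..q}. \<forall>i<q. \<bar>s i - (if i < k then 1 else 0)\<bar> \<le> \<bar>s i - (if i < j then 1 else 0)\<bar>)"

text \<open>The index \<open>i = 0\<close> is exempt from the lower bound because every admissible rank is at least \<open>1\<close>.\<close>

lemma optimal_rank_iff:
  "optimal_rank q s k \<longleftrightarrow> k \<in> {1..q} \<and> (\<forall>i<q. (0 < i \<and> i < k \<longrightarrow> 1/2 \<le> s i) \<and> (k \<le> i \<longrightarrow> s i \<le> 1/2))"
  (is "_ \<longleftrightarrow> ?R")
proof
  assume opt: "optimal_rank q s k"
  then have k: "k \<in> {1..q}"
    and le: "\<And>j i. j \<in> {1..q} \<Longrightarrow> i < q \<Longrightarrow> \<bar>s i - (if i < k then 1 else 0)\<bar> \<le> \<bar>s i - (if i < j then 1 else 0)\<bar>"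
    unfolding optimal_rank_def by auto
  show ?R
  proof (intro conjI k allI impI)
    fix i assume i: "i < q"
    show "1/2 \<le> s i" if "0 < i \<and> i < k" using le[of i i] that i by auto
    show "s i \<le> 1/2" if "k \<le> i" using le[of "Suc i" i] that i by auto
  qed
next
  assume R: ?R
  then show "optimal_rank q s k" unfolding optimal_rank_def
  proof (intro conjI ballI allI impI)
    fix j i assume ji: "j \<in> {1..q}" "i < q"
    then have "0 < i \<and> i < k \<longrightarrow> 1/2 \<le> s i" "k \<le> i \<longrightarrow> s i \<le> 1/2" "1 \<le> j" "1 \<le> k" using R by auto
    then show "\<bar>s i - (if i < k then 1 else 0)\<bar> \<le> \<bar>s i - (if i < j then 1 else 0)\<bar>" by (cases "i = 0") auto
  qed auto
qed

lemma optimal_rankI: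
  assumes "1 \<le> k" "k \<le> q" "\<And>i. i < q \<Longrightarrow> 0 < i \<Longrightarrow> i < k \<Longrightarrow> 1/2 \<le> s i"
    and "\<And>i. i < q \<Longrightarrow> k \<le> i \<Longrightarrow> s i \<le> 1/2"
  shows "optimal_rank q s k"
  using assms unfolding optimal_rank_iff by simp

lemma optimal_rankD:
  assumes "optimal_rank q s k"
  shows "1 \<le> k" "k \<le> q" "i < q \<Longrightarrow> 0 < i \<Longrightarrow> i < k \<Longrightarrow> 1/2 \<le> s i"
    and "i < q \<Longrightarrow> k \<le> i \<Longrightarrow> s i \<le> 1/2"
  using assms unfolding optimal_rank_iff by simp_all

text \<open>The bound for rank \<open>j\<close> is monotone in its coordinates, so it is smallest for optimal ranks. If \<open>\<Phi>\<close> is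
  strictly convex, a rank that is worse in a single coordinate is already worse in norm.\<close>

lemma truncated_polar_optimal:
  assumes F: "svd m n F s u v" and sg: "symmetric_gauge (min m n) \<Phi>" and k: "optimal_rank (min m n) s k"
  shows "truncated_polar m n u v k \<in> closest_rank \<Phi> F k"
    and "truncated_polar m n u v k \<in> minimizers \<Phi> F"
    and "closest_rank \<Phi> F k \<subseteq> minimizers \<Phi> F"
    and "strictly_convex_gauge (min m n) \<Phi> \<Longrightarrow>
      minimizers \<Phi> F = (\<Union>j\<in>{j. optimal_rank (min m n) s j}. closest_rank \<Phi> F j)"
proof -
  note D = singular_systemD[OF svdD(1)[OF F]]
  define q where "q = min m n"
  define d where "d j = \<Phi> (vec q (\<lambda>i. \<bar>s i - (if i < j then 1 else 0)\<bar>))" for j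
  have dims: "dim_row F = m" "dim_col F = n" using D(1) by auto
  have lower: "d j \<le> ui_norm \<Phi> (F - X)" if "X \<in> partial_isometries_rank m n j" for X j
    using partial_isometry_distance(1)[OF F that sg] unfolding d_def q_def .
  have dist: "ui_norm \<Phi> (F - truncated_polar m n u v j) = d j" if "j \<le> q" for j
    using ui_norm_minus_truncated_polar[OF F _ sg] that unfolding d_def q_def by simp
  have T: "truncated_polar m n u v j \<in> partial_isometries_rank m n j" if "j \<le> q" for j
    using truncated_polar_partial_isometry[OF D(2,3)] that unfolding q_def by simp
  have all: "X \<in> partial_isometries m n \<longleftrightarrow> (\<exists>j\<in>{1..q}. X \<in> partial_isometries_rank m n j)" for X
    unfolding partial_isometries_def q_def by auto
  have closest: "X \<in> closest_rank \<Phi> F j \<longleftrightarrow> X \<in> partial_isometries_rank m n j \<and>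
      (\<forall>Y\<in>partial_isometries_rank m n j. ui_norm \<Phi> (F - X) \<le> ui_norm \<Phi> (F - Y))" for X j
    unfolding closest_rank_def nearest_iff dims ..
  have minim: "X \<in> minimizers \<Phi> F \<longleftrightarrow> X \<in> partial_isometries m n \<and>
      (\<forall>Y\<in>partial_isometries m n. ui_norm \<Phi> (F - X) \<le> ui_norm \<Phi> (F - Y))" for X
    unfolding minimizers_def nearest_iff dims ..
  have main: "truncated_polar m n u v j \<in> closest_rank \<Phi> F j \<and> truncated_polar m n u v j \<in> minimizers \<Phi> F \<and>
      closest_rank \<Phi> F j \<subseteq> minimizers \<Phi> F" if j: "optimal_rank q s j" for j
  proof -
    have jq: "j \<in> {1..q}" using j unfolding optimal_rank_def by blast
    have best: "d j \<le> d i" if "i \<in> {1..q}" for i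
      unfolding d_def using j that by (intro gauge_mono(1)[OF sg[folded q_def]]) (auto simp: optimal_rank_def)
    have "d j \<le> ui_norm \<Phi> (F - Y)" if "Y \<in> partial_isometries m n" for Y
      using that best lower unfolding all by (meson order_trans)
    note least = this
    have Tj: "truncated_polar m n u v j \<in> partial_isometries_rank m n j"
      and dj: "ui_norm \<Phi> (F - truncated_polar m n u v j) = d j" using T dist jq by auto
    have sub: "partial_isometries_rank m n j \<subseteq> partial_isometries m n" using all jq by blast
    have "truncated_polar m n u v j \<in> closest_rank \<Phi> F j"
      unfolding closest dj using Tj lower by blast
    moreover have "truncated_polar m n u v j \<in> minimizers \<Phi> F"
      unfolding minim dj using Tj sub least by blast
    moreover have "closest_rank \<Phi> F j \<subseteq> minimizers \<Phi> F"
    proof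
      fix X assume "X \<in> closest_rank \<Phi> F j"
      then have "X \<in> partial_isometries_rank m n j" "ui_norm \<Phi> (F - X) \<le> d j"
        using Tj dj unfolding closest by auto
      then show "X \<in> minimizers \<Phi> F" unfolding minim using sub least by (blast intro: order_trans)
    qed
    ultimately show ?thesis by blast
  qed
  show "truncated_polar m n u v k \<in> closest_rank \<Phi> F k" "truncated_polar m n u v k \<in> minimizers \<Phi> F"
    "closest_rank \<Phi> F k \<subseteq> minimizers \<Phi> F" using main[of k] k unfolding q_def by blast+
  assume sc: "strictly_convex_gauge (min m n) \<Phi>"
  show "minimizers \<Phi> F = (\<Union>j\<in>{j. optimal_rank (min m n) s j}. closest_rank \<Phi> F j)"
  proof (intro equalityI subsetI)
    fix X assume X: "X \<in> minimizers \<Phi> F"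
    then obtain j where j: "j \<in> {1..q}" "X \<in> partial_isometries_rank m n j" using minim all by blast
    have kq: "k \<in> {1..q}" using k unfolding optimal_rank_def q_def by blast
    have "ui_norm \<Phi> (F - X) \<le> d k"
      using X minim all T[of k] dist[of k] kq by (metis atLeastAtMost_iff)
    then have "\<not> d k < d j" using lower[OF j(2)] by simp
    moreover have le: "\<bar>s i - (if i < k then 1 else 0)\<bar> \<le> \<bar>s i - (if i < j then 1 else 0)\<bar>" if "i < q" for i
      using k j(1) that unfolding optimal_rank_def q_def by blast
    ultimately have "\<bar>s i - (if i < k then 1 else 0)\<bar> = \<bar>s i - (if i < j then 1 else 0)\<bar>" if "i < q" for i
      using gauge_mono(2)[OF sg[folded q_def], of "\<lambda>i. \<bar>s i - (if i < k then 1 else 0)\<bar>"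
          "\<lambda>i. \<bar>s i - (if i < j then 1 else 0)\<bar>"] sc that unfolding d_def q_def[symmetric] by fastforce
    then have "optimal_rank q s j" using k j(1) unfolding optimal_rank_def q_def by simp
    moreover have "X \<in> closest_rank \<Phi> F j" using X j closest minim all by blast
    ultimately show "X \<in> (\<Union>j\<in>{j. optimal_rank (min m n) s j}. closest_rank \<Phi> F j)" unfolding q_def by blast
  qed (use main in \<open>auto simp: q_def\<close>)
qed

text \<open>Put \<open>a i = Re \<langle>X v\<^sub>i, u\<^sub>i\<rangle>\<close> and \<open>b i = (\<parallel>X v\<^sub>i\<parallel>\<^sup>2 + \<parallel>X\<^sup>* u\<^sub>i\<parallel>\<^sup>2) / 2\<close>, so that \<open>a i \<le> b i\<close>, \<open>0 \<le> b i \<le> 1\<close> and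
  \<open>\<Sum>i b i \<le> k\<close>. Equality of norms yields \<open>\<Sum>i s i a i = \<Sum>i<k s i\<close>. The weights \<open>2 s i - 1\<close> are positive for
  \<open>i < k\<close> and negative afterwards, so \<open>\<Sum>i (2 s i - 1) b i\<close> has its maximum over \<open>0 \<le> b i \<le> 1\<close> only at
  \<open>b i = [i < k]\<close>; the constraints force this maximum. Then \<open>a i = 1\<close> for \<open>i < k\<close>, which is equality in
  Cauchy--Schwarz and gives \<open>X v\<^sub>i = u\<^sub>i\<close>, and the Frobenius norm leaves nothing for the other \<open>v\<^sub>i\<close>.\<close>

lemma closest_rank_unique:
  assumes F: "svd m n F s u v" and sg: "symmetric_gauge (min m n) \<Phi>" and sc: "strictly_convex_gauge (min m n) \<Phi>"
    and X: "X \<in> partial_isometries_rank m n k"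
    and above: "\<And>i. i < k \<Longrightarrow> 1/2 < s i" and below: "\<And>i. k \<le> i \<Longrightarrow> i < min m n \<Longrightarrow> s i < 1/2"
    and near: "ui_norm \<Phi> (F - X) \<le> \<Phi> (vec (min m n) (\<lambda>i. \<bar>s i - (if i < k then 1 else 0)\<bar>))"
  shows "X = truncated_polar m n u v k"
proof -
  note D = singular_systemD[OF svdD(1)[OF F]]
  define q where "q = min m n"
  obtain x y where xy: "orthonormal m m x" "orthonormal n n y" and Xt: "X = truncated_polar m n x y k" and kq: "k \<le> min m n"
    using partial_isometry_is_truncated_polar[OF X] by blast
  have kq': "k \<le> min n m" "k \<le> q" using kq unfolding q_def by auto
  have Xm: "X \<in> carrier_mat m n" using X unfolding partial_isometries_rank_def by simp
  have vc: "v i \<in> carrier_vec n" "X *\<^sub>v v i \<in> carrier_vec m" "l2_norm (v i) = 1" if "i < n" for i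
    using D(3) Xm that l2_norm_unit[OF D(3) that] by auto
  have uc: "u i \<in> carrier_vec m" "l2_norm (u i) = 1" if "i < m" for i
    using D(2) that l2_norm_unit[OF D(2) that] by auto
  define a where "a i = Re ((X *\<^sub>v v i) \<bullet>c u i)" for i
  define c where "c i = (l2_norm (X *\<^sub>v v i))\<^sup>2" for i
  define b where "b i = (c i + (l2_norm (truncated_polar n m y x k *\<^sub>v u i))\<^sup>2) / 2" for i
  have ab: "a i \<le> b i" if "i < q" for i
    unfolding a_def b_def c_def Xt using that by (intro truncated_polar_cprod_le[OF xy kq]) (auto simp: q_def vc uc)
  have c1: "c i \<le> 1" if "i < n" for i
    using truncated_polar_contraction[OF xy kq vc(1)[OF that]] vc(3)[OF that] unfolding c_def Xt by simp
  have b01: "0 \<le> b i" "b i \<le> 1" if "i < q" for i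
    using truncated_polar_contraction[OF xy(2,1) kq'(1) uc(1), of i] uc(2)[of i] c1[of i] that
    unfolding b_def q_def c_def by auto
  have csum: "(\<Sum>i<n. c i) = k" unfolding c_def Xt by (rule truncated_polar_frobenius[OF xy kq D(3)])
  have bsum: "(\<Sum>i<q. b i) \<le> k"
  proof -
    have "(\<Sum>i<q. c i) \<le> (\<Sum>i<n. c i)" unfolding q_def c_def by (intro sum_mono2) auto
    moreover have "(\<Sum>i<q. (l2_norm (truncated_polar n m y x k *\<^sub>v u i))\<^sup>2) \<le>
        (\<Sum>i<m. (l2_norm (truncated_polar n m y x k *\<^sub>v u i))\<^sup>2)" unfolding q_def by (intro sum_mono2) auto
    moreover have "(\<Sum>i<m. (l2_norm (truncated_polar n m y x k *\<^sub>v u i))\<^sup>2) = k"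
      by (rule truncated_polar_frobenius[OF xy(2,1) kq'(1) D(2)])
    ultimately show ?thesis using csum by (simp add: b_def sum.distrib flip: sum_divide_distrib)
  qed
  have "(l2_norm ((F - X) *\<^sub>v v i))\<^sup>2 = (if i < q then (s i)\<^sup>2 - 2 * s i * a i else 0) + c i" if i: "i < n" for i
  proof -
    have Fv: "F *\<^sub>v v i \<in> carrier_vec m" using D(1) vc(1)[OF i] by simp
    have "(l2_norm ((F - X) *\<^sub>v v i))\<^sup>2 = (l2_norm (X *\<^sub>v v i - F *\<^sub>v v i))\<^sup>2"
    proof -
      have "(F - X) *\<^sub>v v i = F *\<^sub>v v i - X *\<^sub>v v i"
        by (rule minus_mult_distrib_mat_vec[OF D(1) Xm vc(1)[OF i]])
      then show ?thesis using Fv vc(2)[OF i] cprod_commute[OF Fv vc(2)[OF i]] by (simp add: l2_norm_minus_sq[of _ m])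
    qed
    also have "\<dots> = c i - 2 * Re ((X *\<^sub>v v i) \<bullet>c (F *\<^sub>v v i)) + (l2_norm (F *\<^sub>v v i))\<^sup>2"
      unfolding c_def by (rule l2_norm_minus_sq[OF vc(2)[OF i] Fv])
    also have "\<dots> = (if i < q then (s i)\<^sup>2 - 2 * s i * a i else 0) + c i"
    proof (cases "i < m")
      case True
      then have q: "i < q" using i unfolding q_def by simp
      then have Fi: "F *\<^sub>v v i = complex_of_real (s i) \<cdot>\<^sub>v u i" using D(4) unfolding q_def by simp
      then show ?thesis
        using q l2_norm_smult_unit[OF D(2) True, of "s i"] cprod_smult_right[OF vc(2)[OF i] uc(1)[OF True]]
        by (simp add: a_def)
    next
      case False
      then have "F *\<^sub>v v i = 0\<^sub>v m" using D(5) i by simp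
      then show ?thesis
        using False vc(2)[OF i] l2_norm_eq_0_iff[of "0\<^sub>v m" m] by (simp add: q_def cprod_sum[of _ m])
    qed
    finally show ?thesis .
  qed
  then have "(\<Sum>i<n. (l2_norm ((F - X) *\<^sub>v v i))\<^sup>2) = (\<Sum>i<n. (if i < q then (s i)\<^sup>2 - 2 * s i * a i else 0) + c i)"
    by (intro sum.cong) auto
  also have "\<dots> = (\<Sum>i<n. if i < q then (s i)\<^sup>2 - 2 * s i * a i else 0) + k" by (simp add: sum.distrib csum)
  also have "(\<Sum>i<n. if i < q then (s i)\<^sup>2 - 2 * s i * a i else 0) = (\<Sum>i<q. (s i)\<^sup>2 - 2 * s i * a i)"
    unfolding q_def by (intro sum.mono_neutral_cong_right) auto
  finally have "(\<Sum>i<q. (s i)\<^sup>2 - 2 * s i * a i) + k = (\<Sum>i<q. (s i - (if i < k then 1 else 0))\<^sup>2)"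
    using partial_isometry_distance(2)[OF F X sg sc near] unfolding q_def by simp
  also have "\<dots> = (\<Sum>i<q. (s i)\<^sup>2 - 2 * s i * (if i < k then 1 else 0) + (if i < k then 1 else 0))"
    by (intro sum.cong) (auto simp: power2_diff)
  also have "\<dots> = (\<Sum>i<q. (s i)\<^sup>2 - 2 * s i * (if i < k then 1 else 0)) + (\<Sum>i<q. if i < k then 1 else 0)"
    by (rule sum.distrib)
  also have "(\<Sum>i<q. if i < k then 1 else 0 :: real) = (\<Sum>i<k. 1)"
    using kq' by (intro sum.mono_neutral_cong_right) auto
  finally have sa: "(\<Sum>i<q. s i * a i) = (\<Sum>i<q. s i * (if i < k then 1 else 0))"
    by (simp add: sum_subtractf mult.assoc flip: sum_distrib_left)
  have jsum: "(\<Sum>i<q. if i < k then 1 else 0 :: real) = k"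
    using kq' by (subst sum.mono_neutral_cong_right[of "{..<q}" "{..<k}" _ "\<lambda>_. 1"]) auto
  have s0: "0 \<le> s i" if "i < q" for i using svdD(2)[OF F] that unfolding q_def .
  have gap: "0 \<le> ((if i < k then 1 else 0) - b i) * (2 * s i - 1)" if "i < q" for i
    using b01[OF that] above[of i] below[of i] that unfolding q_def
    by (cases "i < k") (auto intro: mult_nonneg_nonneg mult_nonneg_nonpos2 simp: mult_nonpos_nonpos mult_le_0_iff zero_le_mult_iff)
  have sab: "(\<Sum>i<q. s i * a i) \<le> (\<Sum>i<q. s i * b i)"
    using ab s0 by (intro sum_mono mult_left_mono) auto
  \<comment> \<open>\<open>gap\<close> says that the terms are nonnegative, while their sum is at most zero.\<close>
  have "(\<Sum>i<q. ((if i < k then 1 else 0) - b i) * (2 * s i - 1)) =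
      2 * (\<Sum>i<q. s i * (if i < k then 1 else 0)) - (\<Sum>i<q. if i < k then 1 else 0) - 2 * (\<Sum>i<q. s i * b i) + (\<Sum>i<q. b i)"
    unfolding sum_distrib_left sum_subtractf[symmetric] sum.distrib[symmetric]
    by (intro sum.cong) (auto simp: algebra_simps)
  also have "\<dots> \<le> 0" using sab sa bsum jsum by simp
  finally have "((if i < k then 1 else 0) - b i) * (2 * s i - 1) = 0" if "i < q" for i
    using sum_nonneg_eq_0_iff[of "{..<q}" "\<lambda>i. ((if i < k then 1 else 0) - b i) * (2 * s i - 1)"] gap that
      sum_nonneg[of "{..<q}" "\<lambda>i. ((if i < k then 1 else 0) - b i) * (2 * s i - 1)"] by force
  then have b: "b i = (if i < k then 1 else 0)" if "i < q" for i
    using that above[of i] below[of i] unfolding q_def by (cases "i < k") force+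
  have "(\<Sum>i<q. s i * (b i - a i)) = 0"
    using sa b by (simp add: right_diff_distrib sum_subtractf)
  moreover have "0 \<le> s i * (b i - a i)" if "i < q" for i using s0 ab that by simp
  ultimately have sab0: "s i * (b i - a i) = 0" if "i < q" for i
    using sum_nonneg_eq_0_iff[of "{..<q}" "\<lambda>i. s i * (b i - a i)"] that by simp
  have a: "a i = 1" if "i < k" for i
  proof -
    have iq: "i < q" using that kq' by simp
    show ?thesis using sab0[OF iq] b[OF iq] above[OF that] that by simp
  qed
  have Xv: "X *\<^sub>v v i = u i \<and> c i = 1" if i: "i < k" for i
  proof -
    have im: "i < m" "i < n" using i kq by auto
    have "(l2_norm (X *\<^sub>v v i - u i))\<^sup>2 = c i - 2 * a i + 1"
      using l2_norm_minus_sq[OF vc(2)[OF im(2)] uc(1)[OF im(1)]] uc(2)[OF im(1)] unfolding c_def a_def by simp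
    also have "\<dots> = c i - 1" using a[OF i] by simp
    finally have *: "(l2_norm (X *\<^sub>v v i - u i))\<^sup>2 = c i - 1" .
    then have ci: "c i = 1" using c1[OF im(2)] by (smt (verit) zero_le_power2)
    then have z: "X *\<^sub>v v i - u i = 0\<^sub>v m" using * l2_norm_eq_0_iff[of "X *\<^sub>v v i - u i" m] vc(2)[OF im(2)] uc(1)[OF im(1)] by simp
    have "X *\<^sub>v v i = u i"
    proof (rule eq_vecI)
      fix j assume "j < dim_vec (u i)"
      then have j: "j < m" using uc(1)[OF im(1)] by simp
      then have "(X *\<^sub>v v i - u i) $ j = 0" using z by simp
      then show "(X *\<^sub>v v i) $ j = u i $ j" using j uc(1)[OF im(1)] by simp
    qed (use vc(2)[OF im(2)] uc(1)[OF im(1)] Xm in simp)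
    then show ?thesis using ci by simp
  qed
  have "(\<Sum>i<n. c i) = (\<Sum>i<k. c i) + (\<Sum>i\<in>{k..<n}. c i)"
    using kq by (simp add: lessThan_atLeast0 sum.atLeastLessThan_concat)
  then have "(\<Sum>i\<in>{k..<n}. c i) = 0" using csum Xv by simp
  then have "c i = 0" if "k \<le> i" "i < n" for i
    using sum_nonneg_eq_0_iff[of "{k..<n}" c] that unfolding c_def by simp
  then have Xv0: "X *\<^sub>v v i = 0\<^sub>v m" if "k \<le> i" "i < n" for i
    using that l2_norm_eq_0_iff[OF vc(2)] unfolding c_def by simp
  note S = singular_systemD[OF truncated_polar_system[OF D(2,3) kq]]
  show ?thesis
  proof (rule mat_eq_by_basis[OF D(3) Xm S(1)])
    fix i assume "i < n"
    then show "X *\<^sub>v v i = truncated_polar m n u v k *\<^sub>v v i"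
      using Xv[of i] Xv0[of i] S(4)[of i] S(5)[of i] kq smult_zero_vec[OF uc(1), of i]
      by (cases "i < k"; cases "i < m") auto
  qed
qed

text \<open>From \<open>\<bar>F\<bar> v\<^sub>i = s\<^sub>i v\<^sub>i\<close> and \<open>F v\<^sub>i = s\<^sub>i u\<^sub>i\<close>, the factor \<open>U\<close> maps \<open>v\<^sub>i\<close> to \<open>u\<^sub>i\<close> when \<open>s\<^sub>i > 0\<close>; the remaining
  \<open>v\<^sub>i\<close> lie in the common kernel of \<open>F\<close> and \<open>U\<close>.\<close>

lemma canonical_polar_decomposition_truncated_polar:
  assumes F: "svd m n F s u v" and U: "canonical_polar_decomposition F U"
    and k: "k \<le> min m n" and pos: "\<And>i. i < min m n \<Longrightarrow> 0 < s i \<longleftrightarrow> i < k"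
  shows "U = truncated_polar m n u v k"
proof -
  note D = singular_systemD[OF svdD(1)[OF F]]
  have Um: "U \<in> carrier_mat m n" and ker: "mat_kernel U = mat_kernel F" and FU: "F = U * mat_abs F"
    using U D(1) unfolding canonical_polar_decomposition_def by auto
  note S = singular_systemD[OF truncated_polar_system[OF D(2,3) k]]
  show ?thesis
  proof (rule mat_eq_by_basis[OF D(3) Um S(1)])
    fix i assume i: "i < n"
    have vi: "v i \<in> carrier_vec n" using D(3) i by simp
    show "U *\<^sub>v v i = truncated_polar m n u v k *\<^sub>v v i"
    proof (cases "i < k")
      case True
      then have q: "i < min m n" using k by simp
      have s: "0 < s i" using pos[OF q] True by simp
      have abs: "mat_abs F \<in> carrier_mat n n" "mat_abs F *\<^sub>v v i = complex_of_real (s i) \<cdot>\<^sub>v v i"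
        unfolding mat_abs_svd[OF F]
        using dyad_sum_basis[OF D(3), of n v n i "\<lambda>i. if i < m then s i else 0"] D(3) i q by auto
      have "complex_of_real (s i) \<cdot>\<^sub>v u i = (U * mat_abs F) *\<^sub>v v i" using D(4)[OF q] FU by simp
      also have "\<dots> = U *\<^sub>v (mat_abs F *\<^sub>v v i)" by (rule assoc_mult_mat_vec[OF Um abs(1) vi])
      also have "\<dots> = complex_of_real (s i) \<cdot>\<^sub>v (U *\<^sub>v v i)" unfolding abs(2) by (rule mult_mat_vec[OF Um vi])
      finally have "complex_of_real (1 / s i) \<cdot>\<^sub>v (complex_of_real (s i) \<cdot>\<^sub>v u i) =
          complex_of_real (1 / s i) \<cdot>\<^sub>v (complex_of_real (s i) \<cdot>\<^sub>v (U *\<^sub>v v i))" by simp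
      then have "U *\<^sub>v v i = u i" using s by (simp add: smult_smult_assoc)
      then show ?thesis using S(4)[OF q] True by simp
    next
      case False
      have z: "0 \<cdot>\<^sub>v u i = 0\<^sub>v m" if "i < m" using D(2) that by (intro smult_zero_vec) simp
      have "F *\<^sub>v v i = 0\<^sub>v m"
        using D(4)[of i] D(5)[of i] False pos[of i] svdD(2)[OF F, of i] i z by (cases "i < m") auto
      then have "v i \<in> mat_kernel U" unfolding ker using D(1) vi by (intro mat_kernelI)
      then have "U *\<^sub>v v i = 0\<^sub>v m" using mat_kernelD[OF Um] by simp
      then show ?thesis using S(4)[of i] S(5)[of i] False i z by (cases "i < m") auto
    qed
  qed
qed

theorem theorem3p7:
  fixes m n q r :: nat and \<Phi> :: "real vec \<Rightarrow> real" and F :: "complex mat"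
  assumes "1 \<le> m" and "1 \<le> n" and "q = min m n"
    and "symmetric_gauge q \<Phi>"
    and "F \<in> carrier_mat m n" and "mat_rank F = r"
  shows
    "((\<forall>i \<in> {1..r}. sing_val F i \<noteq> 1/2) \<longrightarrow>
        (1 \<le> r \<and> sing_val F r > 1/2 \<longrightarrow>
          (\<forall>U. canonical_polar_decomposition F U \<longrightarrow>
             U \<in> minimizers \<Phi> F \<and>
             (strictly_convex_gauge q \<Phi> \<longrightarrow> minimizers \<Phi> F = {U}))) \<and>
        (\<forall>k. 1 \<le> k \<and> k + 1 \<le> r \<and> sing_val F k > 1/2 \<and> 1/2 > sing_val F (k + 1) \<longrightarrow>
          closest_rank \<Phi> F k \<noteq> {} \<and>
          closest_rank \<Phi> F k \<subseteq> minimizers \<Phi> F \<and>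
          (strictly_convex_gauge q \<Phi> \<longrightarrow>
             (\<exists>X. closest_rank \<Phi> F k = {X} \<and> minimizers \<Phi> F = {X}))) \<and>
        (sing_val F 1 < 1/2 \<longrightarrow>
          closest_rank \<Phi> F 1 \<noteq> {} \<and>
          closest_rank \<Phi> F 1 \<subseteq> minimizers \<Phi> F \<and>
          (strictly_convex_gauge q \<Phi> \<longrightarrow> minimizers \<Phi> F = closest_rank \<Phi> F 1)))
     \<and>
     (\<forall>k l. 1 \<le> k \<and> k \<le> r \<and> l \<le> r - k \<and>
            {j \<in> {1..q}. sing_val F j = 1/2} = {k..k + l} \<longrightarrow>
        (k = 1 \<longrightarrow>
          (\<forall>j \<in> {1..l + 1}. closest_rank \<Phi> F j \<noteq> {} \<and>
             closest_rank \<Phi> F j \<subseteq> minimizers \<Phi> F) \<and>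
          (strictly_convex_gauge q \<Phi> \<longrightarrow>
             minimizers \<Phi> F = (\<Union>j \<in> {1..l + 1}. closest_rank \<Phi> F j))) \<and>
        (1 < k \<longrightarrow>
          (\<forall>j \<in> {k - 1..k + l}. closest_rank \<Phi> F j \<noteq> {} \<and>
             closest_rank \<Phi> F j \<subseteq> minimizers \<Phi> F) \<and>
          (strictly_convex_gauge q \<Phi> \<longrightarrow>
             minimizers \<Phi> F = (\<Union>j \<in> {k - 1..k + l}. closest_rank \<Phi> F j))))"
proof -
  have q: "q = min m n" and sg: "symmetric_gauge (min m n) \<Phi>" using assms by auto
  have dims: "dim_row F = m" "dim_col F = n" using assms by auto
  obtain s u v where F: "svd m n F s u v" using svd_exists[OF \<open>F \<in> carrier_mat m n\<close>] by blast
  have s0: "0 \<le> s i" if "i < q" for i using svdD(2)[OF F] that q by simp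
  have dec: "s j \<le> s i" if "i \<le> j" "j < q" for i j using svdD(3)[OF F that(1)] that q by simp
  obtain k0 where k0: "k0 \<le> min m n" "\<And>i. i < min m n \<Longrightarrow> 0 < s i \<longleftrightarrow> i < k0"
    using svd_positive_count[OF F] by blast
  have "mat_rank F = k0"
    using k0(2) svdD(2)[OF F] by (intro mat_rank_singular_system[OF svdD(1)[OF F] k0(1)]) force
  then have rq: "r \<le> q" and pos: "\<And>i. i < q \<Longrightarrow> 0 < s i \<longleftrightarrow> i < r" using k0 assms(6) q by auto
  \<comment> \<open>Singular values count from \<open>1\<close>, while \<open>s\<close> counts from \<open>0\<close>: rank \<open>k\<close> separates \<open>s (k - 1)\<close> from \<open>s k\<close>.\<close>
  have sv: "sing_val F i = s (i - 1)" if "1 \<le> i" "i \<le> q" for i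
  proof -
    have "i - 1 < min m n" using that q by linarith
    from sing_val_svd[OF F this] that show ?thesis by simp
  qed
  have q1: "1 \<le> q" using assms q by simp
  let ?T = "truncated_polar m n u v"
  note opt = truncated_polar_optimal[OF F sg, folded q]
  have unique: "minimizers \<Phi> F = {?T k} \<and> closest_rank \<Phi> F k = {?T k}"
    if k: "1 \<le> k" "k \<le> q" and above: "\<And>i. i < k \<Longrightarrow> 1/2 < s i"
      and below: "\<And>i. k \<le> i \<Longrightarrow> i < q \<Longrightarrow> s i < 1/2" and sc: "strictly_convex_gauge q \<Phi>" for k
  proof -
    have k_opt: "optimal_rank q s k"
      using k above below by (intro optimal_rankI) (auto intro: less_imp_le)
    have only: "j = k" if "optimal_rank q s j" for j
    proof (rule ccontr)
      assume "j \<noteq> k"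
      then consider "j < k" | "k < j" by linarith
      then show False
      proof cases
        case 1
        then have "s j \<le> 1/2" using optimal_rankD(4)[OF that, of j] k by simp
        then show False using above[OF 1] by simp
      next
        case 2
        then have "k < q" using optimal_rankD(2)[OF that] by simp
        then have "1/2 \<le> s k" using optimal_rankD(3)[OF that, of k] 2 k by simp
        then show False using below[of k] \<open>k < q\<close> by simp
      qed
    qed
    have "X = ?T k" if X: "X \<in> closest_rank \<Phi> F k" for X
    proof (rule closest_rank_unique[OF F sg sc[unfolded q] _ above])
      have mem: "X \<in> partial_isometries_rank m n k"
        and le: "ui_norm \<Phi> (F - X) \<le> ui_norm \<Phi> (F - ?T k)"
        using X opt(1)[OF k_opt] unfolding closest_rank_def nearest_iff dims by auto
      show "X \<in> partial_isometries_rank m n k" by (rule mem)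
      show "s i < 1/2" if "k \<le> i" "i < min m n" for i using below that q by simp
      show "ui_norm \<Phi> (F - X) \<le> \<Phi> (vec (min m n) (\<lambda>i. \<bar>s i - (if i < k then 1 else 0)\<bar>))"
        using le ui_norm_minus_truncated_polar[OF F _ sg] k q by simp
    qed
    then have closest: "closest_rank \<Phi> F k = {?T k}" using opt(1)[OF k_opt] by blast
    have "{j. optimal_rank q s j} = {k}" using k_opt only by blast
    then have "minimizers \<Phi> F = {?T k}" using opt(4)[OF k_opt sc] closest by simp
    then show ?thesis using closest by simp
  qed
  have part_a: "(1 \<le> r \<and> sing_val F r > 1/2 \<longrightarrow>
        (\<forall>U. canonical_polar_decomposition F U \<longrightarrow>
           U \<in> minimizers \<Phi> F \<and> (strictly_convex_gauge q \<Phi> \<longrightarrow> minimizers \<Phi> F = {U}))) \<and>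
      (\<forall>k. 1 \<le> k \<and> k + 1 \<le> r \<and> sing_val F k > 1/2 \<and> 1/2 > sing_val F (k + 1) \<longrightarrow>
        closest_rank \<Phi> F k \<noteq> {} \<and> closest_rank \<Phi> F k \<subseteq> minimizers \<Phi> F \<and>
        (strictly_convex_gauge q \<Phi> \<longrightarrow> (\<exists>X. closest_rank \<Phi> F k = {X} \<and> minimizers \<Phi> F = {X}))) \<and>
      (sing_val F 1 < 1/2 \<longrightarrow>
        closest_rank \<Phi> F 1 \<noteq> {} \<and> closest_rank \<Phi> F 1 \<subseteq> minimizers \<Phi> F \<and>
        (strictly_convex_gauge q \<Phi> \<longrightarrow> minimizers \<Phi> F = closest_rank \<Phi> F 1))"
  proof (intro conjI)
    show "1 \<le> r \<and> sing_val F r > 1/2 \<longrightarrow>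
        (\<forall>U. canonical_polar_decomposition F U \<longrightarrow>
           U \<in> minimizers \<Phi> F \<and> (strictly_convex_gauge q \<Phi> \<longrightarrow> minimizers \<Phi> F = {U}))"
    proof (intro impI allI)
      fix U assume r: "1 \<le> r \<and> sing_val F r > 1/2" and U: "canonical_polar_decomposition F U"
      have above: "1/2 < s i" if "i < r" for i
      proof -
        have "s (r - 1) \<le> s i" using that rq by (intro dec) linarith+
        then show ?thesis using r sv[of r] rq by simp
      qed
      have below: "s i < 1/2" if "r \<le> i" "i < q" for i using pos[OF that(2)] that by simp
      have UT: "U = ?T r"
        using canonical_polar_decomposition_truncated_polar[OF F U, of r] rq pos q by simp
      have "optimal_rank q s r"
        using r rq above below by (intro optimal_rankI) (auto intro: less_imp_le)
      then show "U \<in> minimizers \<Phi> F \<and> (strictly_convex_gauge q \<Phi> \<longrightarrow> minimizers \<Phi> F = {U})"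
        using opt(2) unique[OF _ rq above below] r unfolding UT by blast
    qed
    show "\<forall>k. 1 \<le> k \<and> k + 1 \<le> r \<and> sing_val F k > 1/2 \<and> 1/2 > sing_val F (k + 1) \<longrightarrow>
        closest_rank \<Phi> F k \<noteq> {} \<and> closest_rank \<Phi> F k \<subseteq> minimizers \<Phi> F \<and>
        (strictly_convex_gauge q \<Phi> \<longrightarrow> (\<exists>X. closest_rank \<Phi> F k = {X} \<and> minimizers \<Phi> F = {X}))"
    proof (intro allI impI)
      fix k assume k: "1 \<le> k \<and> k + 1 \<le> r \<and> sing_val F k > 1/2 \<and> 1/2 > sing_val F (k + 1)"
      have above: "1/2 < s i" if "i < k" for i
      proof -
        have "s (k - 1) \<le> s i" using that k rq by (intro dec) linarith+
        then show ?thesis using k sv[of k] rq by simp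
      qed
      have below: "s i < 1/2" if "k \<le> i" "i < q" for i
      proof -
        have "s i \<le> s k" using that by (intro dec)
        then show ?thesis using k sv[of "k + 1"] rq by simp
      qed
      have "optimal_rank q s k"
        using k rq above below by (intro optimal_rankI) (auto intro: less_imp_le)
      then show "closest_rank \<Phi> F k \<noteq> {} \<and> closest_rank \<Phi> F k \<subseteq> minimizers \<Phi> F \<and>
          (strictly_convex_gauge q \<Phi> \<longrightarrow> (\<exists>X. closest_rank \<Phi> F k = {X} \<and> minimizers \<Phi> F = {X}))"
        using opt(1)[of k] opt(3)[of k] unique[OF _ _ above below] k rq by force
    qed
    show "sing_val F 1 < 1/2 \<longrightarrow>
        closest_rank \<Phi> F 1 \<noteq> {} \<and> closest_rank \<Phi> F 1 \<subseteq> minimizers \<Phi> F \<and>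
        (strictly_convex_gauge q \<Phi> \<longrightarrow> minimizers \<Phi> F = closest_rank \<Phi> F 1)"
    proof
      assume "sing_val F 1 < 1/2"
      then have below: "s i < 1/2" if "i < q" for i using dec[of 0 i] sv[of 1] q1 that by simp
      have o1: "optimal_rank q s 1"
        using q1 below by (intro optimal_rankI) (auto intro: less_imp_le)
      have "j = 1" if "optimal_rank q s j" for j
      proof (rule ccontr)
        assume "j \<noteq> 1"
        then have "1 < j" "1 < q" using optimal_rankD(1,2)[OF that] by linarith+
        then show False using below[of 1] optimal_rankD(3)[OF that, of 1] by simp
      qed
      then have "{j. optimal_rank q s j} = {1}" using o1 by blast
      then have "strictly_convex_gauge q \<Phi> \<Longrightarrow> minimizers \<Phi> F = closest_rank \<Phi> F 1"
        using opt(4)[OF o1] by simp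
      then show "closest_rank \<Phi> F 1 \<noteq> {} \<and> closest_rank \<Phi> F 1 \<subseteq> minimizers \<Phi> F \<and>
          (strictly_convex_gauge q \<Phi> \<longrightarrow> minimizers \<Phi> F = closest_rank \<Phi> F 1)"
        using opt(1,3)[OF o1] by blast
    qed
  qed
  have part_b: "(k = 1 \<longrightarrow>
          (\<forall>j\<in>{1..l + 1}. closest_rank \<Phi> F j \<noteq> {} \<and> closest_rank \<Phi> F j \<subseteq> minimizers \<Phi> F) \<and>
          (strictly_convex_gauge q \<Phi> \<longrightarrow> minimizers \<Phi> F = (\<Union>j\<in>{1..l + 1}. closest_rank \<Phi> F j))) \<and>
      (1 < k \<longrightarrow>
          (\<forall>j\<in>{k - 1..k + l}. closest_rank \<Phi> F j \<noteq> {} \<and> closest_rank \<Phi> F j \<subseteq> minimizers \<Phi> F) \<and>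
          (strictly_convex_gauge q \<Phi> \<longrightarrow> minimizers \<Phi> F = (\<Union>j\<in>{k - 1..k + l}. closest_rank \<Phi> F j)))"
    if k: "1 \<le> k" "k \<le> r" "l \<le> r - k" and half: "{j \<in> {1..q}. sing_val F j = 1/2} = {k..k + l}" for k l
  proof -
    have klq: "k + l \<le> q" using k rq by simp
    have eq: "s i = 1/2 \<longleftrightarrow> k \<le> i + 1 \<and> i < k + l" if "i < q" for i
    proof -
      have "i + 1 \<in> {j \<in> {1..q}. sing_val F j = 1/2} \<longleftrightarrow> i + 1 \<in> {k..k + l}" using half by simp
      then show ?thesis using that sv[of "i + 1"] by auto
    qed
    have above: "1/2 < s i" if "i + 1 < k" for i
    proof -
      have "i < q" using that klq by linarith
      have "s (k - 1) \<le> s i" using that k klq by (intro dec) linarith+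
      moreover have "s (k - 1) = 1/2" using eq[of "k - 1"] k klq by simp
      moreover have "s i \<noteq> 1/2" using eq[OF \<open>i < q\<close>] that by simp
      ultimately show ?thesis by simp
    qed
    have below: "s i < 1/2" if "k + l \<le> i" "i < q" for i
    proof -
      have "s i \<le> s (k - 1)" using that by (intro dec) linarith+
      moreover have "s (k - 1) = 1/2" using eq[of "k - 1"] k klq by simp
      moreover have "s i \<noteq> 1/2" using eq[OF that(2)] that by simp
      ultimately show ?thesis by simp
    qed
    have ranks: "optimal_rank q s j \<longleftrightarrow> 1 \<le> j \<and> k - 1 \<le> j \<and> j \<le> k + l" for j
    proof
      assume j: "optimal_rank q s j"
      note J = optimal_rankD[OF j]
      have "\<not> j < k - 1"
      proof
        assume "j < k - 1"
        then have "j + 1 < k" "j < q" using klq by linarith+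
        then show False using above[of j] J(4)[of j] by simp
      qed
      moreover have "\<not> k + l < j"
      proof
        assume "k + l < j"
        then have "k + l < q" using J(2) by linarith
        then show False using below[of "k + l"] J(3)[of "k + l"] \<open>k + l < j\<close> k by simp
      qed
      ultimately show "1 \<le> j \<and> k - 1 \<le> j \<and> j \<le> k + l" using J(1) by linarith
    next
      assume j: "1 \<le> j \<and> k - 1 \<le> j \<and> j \<le> k + l"
      have "1/2 \<le> s i" if "i < j" "i < q" for i
      proof (cases "i + 1 < k")
        case False
        then have "k \<le> i + 1 \<and> i < k + l" using that j by linarith
        then show ?thesis using eq[OF that(2)] by simp
      qed (use above[of i] in simp)
      moreover have "s i \<le> 1/2" if "j \<le> i" "i < q" for i
      proof (cases "i < k + l")
        case True
        then have "k \<le> i + 1 \<and> i < k + l" using that j by linarith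
        then show ?thesis using eq[OF that(2)] by simp
      qed (use below[of i] that in simp)
      ultimately show "optimal_rank q s j" using j klq by (intro optimal_rankI) auto
    qed
    have k_opt: "optimal_rank q s k" unfolding ranks using k by simp
    have good: "closest_rank \<Phi> F j \<noteq> {} \<and> closest_rank \<Phi> F j \<subseteq> minimizers \<Phi> F" if "optimal_rank q s j" for j
      using opt(1,3)[OF that] by blast
    show ?thesis
    proof (intro conjI impI)
      assume k1: "k = 1"
      have set: "{j. optimal_rank q s j} = {1..l + 1}" unfolding ranks using k1 by auto
      show "\<forall>j\<in>{1..l + 1}. closest_rank \<Phi> F j \<noteq> {} \<and> closest_rank \<Phi> F j \<subseteq> minimizers \<Phi> F"
        using good set by blast
      show "minimizers \<Phi> F = (\<Union>j\<in>{1..l + 1}. closest_rank \<Phi> F j)" if "strictly_convex_gauge q \<Phi>"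
        using opt(4)[OF k_opt that] unfolding set .
    next
      assume k1: "1 < k"
      have set: "{j. optimal_rank q s j} = {k - 1..k + l}" unfolding ranks using k1 by auto
      show "\<forall>j\<in>{k - 1..k + l}. closest_rank \<Phi> F j \<noteq> {} \<and> closest_rank \<Phi> F j \<subseteq> minimizers \<Phi> F"
        using good set by blast
      show "minimizers \<Phi> F = (\<Union>j\<in>{k - 1..k + l}. closest_rank \<Phi> F j)" if "strictly_convex_gauge q \<Phi>"
        using opt(4)[OF k_opt that] unfolding set .
    qed
  qed
  show ?thesis
    by (rule conjI[OF impI[OF part_a]]) (intro allI impI part_b; elim conjE; assumption)
qed

end
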